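(* Assume (OA0), (OA1) and (OA2) (all conditions are listed in the context), and let $\Phi=((U_\omega(t))_{\omega\in\Omega,t\ge0},(\theta_t)_{t\in\mathbb R})$. (1) If, moreover, either (OA3)(i)–(ii) or (OA4)(i)–(ii) holds, then $\Phi$ admits a family of generalized principal Floquet subspaces $\{\tilde E_1(\omega)\}_{\omega\in\tilde\Omega_1}=\{\mathrm{span}\{w(\omega)\}\}_{\omega\in\tilde\Omega_1}$. (2) If, moreover, either (OA3)(i)–(iii) or (OA4)(i)–(iii) holds, then $\tilde\lambda_1>-\infty$, where $\tilde\lambda_1$ is the generalized principal Lyapunov exponent of $\Phi$ associated to the generalized principal Floquet subspaces $\{\tilde E_1(\omega)\}_{\omega\in\tilde\Omega_1}$.
   Context: $(\Omega,\mathfrak F,\mathbb P)$ is a complete probability space and $(\theta_t)_{t\in\mathbb R}$ is an ergodic metric dynamical system on it: a $(\mathfrak B(\mathbb R)\otimes\mathfrak F,\mathfrak F)$-measurable flow preserving $\mathbb P$, such that every $F\in\mathfrak F$ with $\theta_t(F)=F$ for all $t$ has $\mathbb P(F)\in\{0,1\}$. A set is invariant if it is preserved by all $\theta_t$. Let $N\ge2$ and $A=(a_{ij}),B=(b_{ij})\colon\Omega\to\mathbb R^{N\times N}$. The delay system (D)$_\omega$ is $\frac{du}{dt}=A(\theta_t\omega)u(t)+B(\theta_t\omega)u(t-1)$, $u\in\mathbb R^N$. For $u_0\in X:=C([-1,0],\mathbb R^N)$, $u(\cdot;\omega,u_0)\colon[-1,\infty)\to\mathbb R^N$ is its unique solution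 for $t\ge0$ (right-hand derivative at $0$) with $u(\tau;\omega,u_0)=u_0(\tau)$ for $\tau\in[-1,0]$, and $(U_\omega(t)u_0)(\tau)=u(t+\tau;\omega,u_0)$, $\tau\in[-1,0]$, $t\ge0$. $\|\cdot\|$ is the maximum norm on $X$ (Euclidean norm on $\mathbb R^N$), and $X^+$ is the cone of functions with all components nonnegative. $\ln^+=\max(\ln,0)$, $\ln^-=\max(-\ln,0)$. (OA0) $A,B$ are $(\mathfrak F,\mathfrak B(\mathbb R^{N\times N}))$-measurable and $t\mapsto A(\theta_t\omega)$, $t\mapsto B(\theta_t\omega)$ are continuous on $\mathbb R$ for all $\omega$. (OA1) $a_{ij}(\omega)\ge0$ for all $i\ne j$, $\omega\in\Omega$; $b_{ij}(\omega)\ge0$ for all $i,j$, $\omega\in\Omega$. (OA2) $\omega\mapsto\max_{i,j}a_{ij}(\omega)$ and $\omega\mapsto\max_{i,j}b_{ij}(\omega)$ belong to $L_1((\Omega,\mathfrak F,\mathbb P))$. Put $\underline a_{ii}(\omega)=\inf\{\int_{k+s}^{k+t}a_{ii}(\theta_\tau\omega)d\tau:0\le s<t\le1,\ k=0,1,\dots,N+1\}$ and $\underline a(\omega)=\min_{1\le i\le N}e^{\underline a_{ii}(\omega)}$. (OA3) There is a measurable $\underline\delta\colon\Omega\to(0,\infty)$ such that for each $\omega\in\Omega$ and $i\in\{1,\dots,N\}$ there are $j_0=i,j_1,j_2,\dots,j_{N-1}\in\{1,\dots,N\}$ satisfying: (i) $\{j_0,\dots,j_{N-1}\}=\{1,\dots,N\}$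 and $b_{j_{l+1}j_l}(\theta_t\omega)\ge\underline\delta(\omega)$ for $0\le t\le N+2$ and $l=0,\dots,N-2$; (ii) $\ln^+\ln(\overline\beta/\underline\beta)\in L_1((\Omega,\mathfrak F,\mathbb P))$, where $\underline\beta(\omega)=\min\big\{\underline a^{N+2}(\omega)\underline\delta^k(\omega)/k!,\ \underline a^{N+3}(\omega)\underline\delta^k(\omega)/k!:k=1,\dots,N\big\}$, $\overline\beta(\omega)=\max\{\bar a^{N+2}(\omega)(1+N\bar\delta(\omega))^{N+1},\ \bar a^{N+2}(\omega)N\bar\delta(\omega)(1+N\bar\delta(\omega))^{N+1}\}$, with $\bar a(\omega)=\exp\big(\int_0^{N+2}\sum_{l=1}^N\max_{1\le k\le N}a_{lk}(\theta_\tau\omega)d\tau\big)$, $\bar\delta(\omega)=\max_{0\le t\le N+2,\,1\le i,j\le N}b_{ij}(\theta_t\omega)$; (iii) $\ln^-\underline\beta\in L_1((\Omega,\mathfrak F,\mathbb P))$. (OA4) (i) There is a measurable $\underline\delta\colon\Omega\to(0,\infty)$ such that for any $\omega\in\Omega$ and any $i\ne j$, $b_{ij}(\theta_t\omega)\ge\underline\delta(\omega)$ for $t\in[0,2]$; (ii) $\ln^+\ln(\overline{\overline\beta}/\underline{\underline\beta})\in L_1((\Omega,\mathfrak F,\mathbb P))$, where $\underline{\underline\beta}(\omega)=\underline a^2(\omega)\underline\delta(\omega)$ and $\overline{\overline\beta}(\omega)=\max\{\bar a^2(\omega)(1+N\bar\delta(\omega)),\ \bar a^2(\omega)N\bar\delta(\omega)(1+N\bar\delta(\omega))\}$,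 with here $\bar a(\omega)=\exp\big(\int_0^2\sum_{l=1}^N\max_{1\le k\le N}a_{lk}(\theta_\tau\omega)d\tau\big)$, $\bar\delta(\omega)=\max_{0\le t\le2,\,1\le i,j\le N}b_{ij}(\theta_t\omega)$; (iii) $\ln^-\underline{\underline\beta}\in L_1((\Omega,\mathfrak F,\mathbb P))$. Generalized principal Floquet subspaces. A family of one-dimensional subspaces $\{\tilde E(\omega)\}_{\omega\in\tilde\Omega}$ of $X$ is a family of generalized principal Floquet subspaces of $\Phi$ if $\tilde\Omega\subset\Omega$ is invariant, $\mathbb P(\tilde\Omega)=1$, and (a) $\tilde E(\omega)=\mathrm{span}\{w(\omega)\}$ with $w\colon\tilde\Omega\to X^+\setminus\{0\}$ $(\mathfrak F,\mathfrak B(X))$-measurable; (b) $U_\omega(t)\tilde E(\omega)=\tilde E(\theta_t\omega)$ for all $\omega\in\tilde\Omega$, $t>0$; (c) there is $\tilde\lambda\in[-\infty,\infty)$ with $\tilde\lambda=\lim_{t\to\infty}\frac1t\ln\|U_\omega(t)w(\omega)\|$ for all $\omega\in\tilde\Omega$; (d) $\limsup_{t\to\infty}\frac1t\ln\|U_\omega(t)u\|\le\tilde\lambda$ for all $\omega\in\tilde\Omega$, $u\in X\setminus\{0\}$. Then $\tilde\lambda$ is called the generalized principal Lyapunov exponent. *)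

theory Defs
  imports "HOL-Probability.Probability_Measure"
begin

section \<open>Ergodic metric dynamical systems\<close>

definition invariant_set :: "(real \<Rightarrow> 'a \<Rightarrow> 'a) \<Rightarrow> 'a set \<Rightarrow> bool" where
  "invariant_set \<theta> F \<longleftrightarrow> (\<forall>t. \<theta> t ` F = F)"

locale ergodic_mds = prob_space M + complete_measure M for M :: "'a measure" +
  fixes \<theta> :: "real \<Rightarrow> 'a \<Rightarrow> 'a"
  assumes joint_measurable: "(\<lambda>(t, \<omega>). \<theta> t \<omega>) \<in> borel \<Otimes>\<^sub>M M \<rightarrow>\<^sub>M M"
    and flow_zero: "\<And>\<omega>. \<omega> \<in> space M \<Longrightarrow> \<theta> 0 \<omega> = \<omega>"
    and flow_add: "\<And>s t \<omega>. \<omega> \<in> space M \<Longrightarrow> \<theta> (s + t) \<omega> = \<theta> s (\<theta> t \<omega>)"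
    and preserves: "\<And>t. distr M M (\<theta> t) = M"
    and ergodic: "\<And>F. F \<in> sets M \<Longrightarrow> invariant_set \<theta> F \<Longrightarrow> prob F = 0 \<or> prob F = 1"


section \<open>The phase space \<open>C([-1,0], \<real>\<^sup>N)\<close>\<close>

text \<open>The interval \<open>[-1,0]\<close> is made a type with its usual metric. As it is compact,
  \<^typ>\<open>'a \<Rightarrow>\<^sub>C 'b\<close> over it consists of all continuous functions, the norm is the maximum norm, and
  spans and the Borel \<open>\<sigma>\<close>-algebra are those of the library.\<close>

typedef lag = "{-1..0::real}" morphisms lag_time Lag
  by (rule exI[of _ 0]) simp

instantiation lag :: metric_space
begin

definition dist_lag :: "lag \<Rightarrow> lag \<Rightarrow> real" where
  "dist_lag x y = dist (lag_time x) (lag_time y)"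

definition uniformity_lag :: "(lag \<times> lag) filter" where
  "uniformity_lag = (INF e\<in>{0 <..}. principal {(x, y). dist x y < e})"

definition open_lag :: "lag set \<Rightarrow> bool" where
  "open_lag S = (\<forall>x\<in>S. \<forall>\<^sub>F (x', y) in uniformity. x' = x \<longrightarrow> y \<in> S)"

instance
proof
  fix x y z :: lag
  show "dist x y = 0 \<longleftrightarrow> x = y"
    by (simp add: dist_lag_def lag_time_inject)
  show "dist x y \<le> dist x z + dist y z"
    unfolding dist_lag_def by (rule dist_triangle2)
qed (rule uniformity_lag_def open_lag_def)+

end

type_synonym 'n phase = "lag \<Rightarrow>\<^sub>C (real ^ 'n)"

lemma continuous_on_lag_time: "continuous_on UNIV lag_time"
  by (auto simp: continuous_on_iff dist_lag_def)

lemma range_lag_time: "range lag_time = {-1..0}"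
  using type_definition.Rep_range[OF type_definition_lag] .

text \<open>Hence \<^term>\<open>Bcontfun\<close> is applied inside its domain in \<open>segment\<close> below.\<close>

lemma lag_restriction_bcontfun:
  fixes f :: "real \<Rightarrow> 'b::metric_space"
  assumes "continuous_on {-1..0} f"
  shows "(\<lambda>\<tau>. f (lag_time \<tau>)) \<in> bcontfun"
proof -
  have "continuous_on UNIV (\<lambda>\<tau>. f (lag_time \<tau>))"
    using continuous_on_compose[OF continuous_on_lag_time, of f] assms
    by (simp add: range_lag_time comp_def)
  moreover have "range (\<lambda>\<tau>. f (lag_time \<tau>)) = f ` {-1..0}"
    by (simp add: range_lag_time[symmetric] image_image)
  moreover have "bounded (f ` {-1..0})"
    using assms by (intro compact_imp_bounded compact_continuous_image) auto
  ultimately show ?thesis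
    by (simp add: bcontfun_def)
qed

definition phase_cone :: "'n::finite phase set" where
  "phase_cone = {u. \<forall>\<tau> i. 0 \<le> apply_bcontfun u \<tau> $ i}"


section \<open>The delay system and its solution operators\<close>

text \<open>\<^term>\<open>at t within {0..}\<close> gives the two-sided derivative for \<open>t > 0\<close> and the right-hand one
  at \<open>0\<close>.\<close>

definition solves_delay ::
  "(real \<Rightarrow> 'a \<Rightarrow> 'a) \<Rightarrow> ('a \<Rightarrow> real ^ 'n ^ 'n) \<Rightarrow> ('a \<Rightarrow> real ^ 'n ^ 'n) \<Rightarrow>
    'a \<Rightarrow> 'n::finite phase \<Rightarrow> (real \<Rightarrow> real ^ 'n) \<Rightarrow> bool" where
  "solves_delay \<theta> A B \<omega> u0 u \<longleftrightarrow>
     (\<forall>\<tau>. u (lag_time \<tau>) = apply_bcontfun u0 \<tau>) \<and>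
     (\<forall>t\<ge>0. (u has_vector_derivative (A (\<theta> t \<omega>) *v u t + B (\<theta> t \<omega>) *v u (t - 1)))
              (at t within {0..}))"

text \<open>Solutions live on \<open>[-1,\<infinity>)\<close>; the value \<open>0\<close> to the left of \<open>-1\<close> only makes the total
  function unique.\<close>

definition delay_solution ::
  "(real \<Rightarrow> 'a \<Rightarrow> 'a) \<Rightarrow> ('a \<Rightarrow> real ^ 'n ^ 'n) \<Rightarrow> ('a \<Rightarrow> real ^ 'n ^ 'n) \<Rightarrow>
    'a \<Rightarrow> 'n::finite phase \<Rightarrow> real \<Rightarrow> real ^ 'n" where
  "delay_solution \<theta> A B \<omega> u0 = (THE u. solves_delay \<theta> A B \<omega> u0 u \<and> (\<forall>t < -1. u t = 0))"

definition segment :: "(real \<Rightarrow> real ^ 'n) \<Rightarrow> real \<Rightarrow> 'n::finite phase" where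
  "segment u t = Bcontfun (\<lambda>\<tau>. u (t + lag_time \<tau>))"

definition delay_semiflow ::
  "(real \<Rightarrow> 'a \<Rightarrow> 'a) \<Rightarrow> ('a \<Rightarrow> real ^ 'n ^ 'n) \<Rightarrow> ('a \<Rightarrow> real ^ 'n ^ 'n) \<Rightarrow>
    'a \<Rightarrow> real \<Rightarrow> 'n::finite phase \<Rightarrow> 'n phase" where
  "delay_semiflow \<theta> A B \<omega> t u0 = segment (delay_solution \<theta> A B \<omega> u0) t"


section \<open>Assumptions on the coefficients\<close>

definition ln_plus :: "real \<Rightarrow> real" where
  "ln_plus x = max (ln x) 0"

definition ln_minus :: "real \<Rightarrow> real" where
  "ln_minus x = max (- ln x) 0"

definition OA0 :: "'a measure \<Rightarrow> (real \<Rightarrow> 'a \<Rightarrow> 'a) \<Rightarrow> ('a \<Rightarrow> real ^ 'n ^ 'n) \<Rightarrow>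
    ('a \<Rightarrow> real ^ 'n::finite ^ 'n) \<Rightarrow> bool" where
  "OA0 M \<theta> A B \<longleftrightarrow> A \<in> M \<rightarrow>\<^sub>M borel \<and> B \<in> M \<rightarrow>\<^sub>M borel \<and>
     (\<forall>\<omega>\<in>space M. continuous_on UNIV (\<lambda>t. A (\<theta> t \<omega>)) \<and> continuous_on UNIV (\<lambda>t. B (\<theta> t \<omega>)))"

definition OA1 :: "'a measure \<Rightarrow> ('a \<Rightarrow> real ^ 'n ^ 'n) \<Rightarrow> ('a \<Rightarrow> real ^ 'n::finite ^ 'n) \<Rightarrow> bool" where
  "OA1 M A B \<longleftrightarrow>
     (\<forall>\<omega>\<in>space M. (\<forall>i j. i \<noteq> j \<longrightarrow> 0 \<le> A \<omega> $ i $ j) \<and> (\<forall>i j. 0 \<le> B \<omega> $ i $ j))"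

definition OA2 :: "'a measure \<Rightarrow> ('a \<Rightarrow> real ^ 'n ^ 'n) \<Rightarrow> ('a \<Rightarrow> real ^ 'n::finite ^ 'n) \<Rightarrow> bool" where
  "OA2 M A B \<longleftrightarrow> integrable M (\<lambda>\<omega>. MAX (i, j). A \<omega> $ i $ j) \<and>
     integrable M (\<lambda>\<omega>. MAX (i, j). B \<omega> $ i $ j)"

definition a_diag_low :: "(real \<Rightarrow> 'a \<Rightarrow> 'a) \<Rightarrow> ('a \<Rightarrow> real ^ 'n::finite ^ 'n) \<Rightarrow> 'n \<Rightarrow> 'a \<Rightarrow> real" where
  "a_diag_low \<theta> A i \<omega> =
     Inf {integral {real k + s..real k + t} (\<lambda>\<tau>. A (\<theta> \<tau> \<omega>) $ i $ i) |s t k.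
            0 \<le> s \<and> s < t \<and> t \<le> 1 \<and> k \<in> {0..CARD('n) + 1}}"

definition a_low :: "(real \<Rightarrow> 'a \<Rightarrow> 'a) \<Rightarrow> ('a \<Rightarrow> real ^ 'n::finite ^ 'n) \<Rightarrow> 'a \<Rightarrow> real" where
  "a_low \<theta> A \<omega> = (MIN i. exp (a_diag_low \<theta> A i \<omega>))"

text \<open>The following two are used with horizon \<open>T = N + 2\<close> in \<open>OA3\<close> and \<open>T = 2\<close> in \<open>OA4\<close>.\<close>

definition a_up :: "real \<Rightarrow> (real \<Rightarrow> 'a \<Rightarrow> 'a) \<Rightarrow> ('a \<Rightarrow> real ^ 'n::finite ^ 'n) \<Rightarrow> 'a \<Rightarrow> real" where
  "a_up T \<theta> A \<omega> = exp (integral {0..T} (\<lambda>\<tau>. \<Sum>l\<in>UNIV. MAX k. A (\<theta> \<tau> \<omega>) $ l $ k))"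

definition delta_up :: "real \<Rightarrow> (real \<Rightarrow> 'a \<Rightarrow> 'a) \<Rightarrow> ('a \<Rightarrow> real ^ 'n::finite ^ 'n) \<Rightarrow> 'a \<Rightarrow> real" where
  "delta_up T \<theta> B \<omega> = Sup {B (\<theta> t \<omega>) $ i $ j |t i j. 0 \<le> t \<and> t \<le> T}"

definition beta_low3 :: "(real \<Rightarrow> 'a \<Rightarrow> 'a) \<Rightarrow> ('a \<Rightarrow> real ^ 'n::finite ^ 'n) \<Rightarrow> ('a \<Rightarrow> real) \<Rightarrow>
    'a \<Rightarrow> real" where
  "beta_low3 \<theta> A \<delta> \<omega> =
     Min ((\<lambda>k. a_low \<theta> A \<omega> ^ (CARD('n) + 2) * \<delta> \<omega> ^ k / fact k) ` {1..CARD('n)} \<union>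
          (\<lambda>k. a_low \<theta> A \<omega> ^ (CARD('n) + 3) * \<delta> \<omega> ^ k / fact k) ` {1..CARD('n)})"

definition beta_up3 :: "(real \<Rightarrow> 'a \<Rightarrow> 'a) \<Rightarrow> ('a \<Rightarrow> real ^ 'n ^ 'n) \<Rightarrow>
    ('a \<Rightarrow> real ^ 'n::finite ^ 'n) \<Rightarrow> 'a \<Rightarrow> real" where
  "beta_up3 \<theta> A B \<omega> =
     (let N = CARD('n); a = a_up (real N + 2) \<theta> A \<omega>; d = delta_up (real N + 2) \<theta> B \<omega>
      in max (a ^ (N + 2) * (1 + real N * d) ^ (N + 1))
             (a ^ (N + 2) * (real N * d) * (1 + real N * d) ^ (N + 1)))"

definition beta_low4 :: "(real \<Rightarrow> 'a \<Rightarrow> 'a) \<Rightarrow> ('a \<Rightarrow> real ^ 'n::finite ^ 'n) \<Rightarrow> ('a \<Rightarrow> real) \<Rightarrow>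
    'a \<Rightarrow> real" where
  "beta_low4 \<theta> A \<delta> \<omega> = a_low \<theta> A \<omega> ^ 2 * \<delta> \<omega>"

definition beta_up4 :: "(real \<Rightarrow> 'a \<Rightarrow> 'a) \<Rightarrow> ('a \<Rightarrow> real ^ 'n ^ 'n) \<Rightarrow>
    ('a \<Rightarrow> real ^ 'n::finite ^ 'n) \<Rightarrow> 'a \<Rightarrow> real" where
  "beta_up4 \<theta> A B \<omega> =
     (let N = CARD('n); a = a_up 2 \<theta> A \<omega>; d = delta_up 2 \<theta> B \<omega>
      in max (a ^ 2 * (1 + real N * d)) (a ^ 2 * (real N * d) * (1 + real N * d)))"

definition positive_measurable :: "'a measure \<Rightarrow> ('a \<Rightarrow> real) \<Rightarrow> bool" where
  "positive_measurable M \<delta> \<longleftrightarrow> \<delta> \<in> borel_measurable M \<and> (\<forall>\<omega>\<in>space M. 0 < \<delta> \<omega>)"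

text \<open>Parts (i)--(iii) of \<open>OA3\<close> and \<open>OA4\<close> speak about one and the same function \<open>\<delta>\<close>, which is
  therefore a parameter of the parts and is quantified only over their conjunctions. Part (i) together
  with \<open>OA0\<close>, \<open>OA1\<close> and \<open>N \<ge> 2\<close> forces \<open>\<beta>_up / \<beta>_low > 1\<close> and \<open>\<beta>_low > 0\<close>, so all logarithms in
  (ii) and (iii) are taken at positive arguments.\<close>

definition OA3_i :: "'a measure \<Rightarrow> (real \<Rightarrow> 'a \<Rightarrow> 'a) \<Rightarrow> ('a \<Rightarrow> real ^ 'n::finite ^ 'n) \<Rightarrow>
    ('a \<Rightarrow> real) \<Rightarrow> bool" where
  "OA3_i M \<theta> B \<delta> \<longleftrightarrow>
     (\<forall>\<omega>\<in>space M. \<forall>i::'n. \<exists>j::nat \<Rightarrow> 'n. j 0 = i \<and> j ` {0..CARD('n) - 1} = UNIV \<and>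
        (\<forall>t\<in>{0..real CARD('n) + 2}. \<forall>l\<in>{0..CARD('n) - 2}.
           \<delta> \<omega> \<le> B (\<theta> t \<omega>) $ j (l + 1) $ j l))"

definition OA3_ii :: "'a measure \<Rightarrow> (real \<Rightarrow> 'a \<Rightarrow> 'a) \<Rightarrow> ('a \<Rightarrow> real ^ 'n ^ 'n) \<Rightarrow>
    ('a \<Rightarrow> real ^ 'n::finite ^ 'n) \<Rightarrow> ('a \<Rightarrow> real) \<Rightarrow> bool" where
  "OA3_ii M \<theta> A B \<delta> \<longleftrightarrow>
     integrable M (\<lambda>\<omega>. ln_plus (ln (beta_up3 \<theta> A B \<omega> / beta_low3 \<theta> A \<delta> \<omega>)))"

definition OA3_iii :: "'a measure \<Rightarrow> (real \<Rightarrow> 'a \<Rightarrow> 'a) \<Rightarrow> ('a \<Rightarrow> real ^ 'n::finite ^ 'n) \<Rightarrow>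
    ('a \<Rightarrow> real) \<Rightarrow> bool" where
  "OA3_iii M \<theta> A \<delta> \<longleftrightarrow> integrable M (\<lambda>\<omega>. ln_minus (beta_low3 \<theta> A \<delta> \<omega>))"

definition OA4_i :: "'a measure \<Rightarrow> (real \<Rightarrow> 'a \<Rightarrow> 'a) \<Rightarrow> ('a \<Rightarrow> real ^ 'n::finite ^ 'n) \<Rightarrow>
    ('a \<Rightarrow> real) \<Rightarrow> bool" where
  "OA4_i M \<theta> B \<delta> \<longleftrightarrow>
     (\<forall>\<omega>\<in>space M. \<forall>i j. i \<noteq> j \<longrightarrow> (\<forall>t\<in>{0..2}. \<delta> \<omega> \<le> B (\<theta> t \<omega>) $ i $ j))"

definition OA4_ii :: "'a measure \<Rightarrow> (real \<Rightarrow> 'a \<Rightarrow> 'a) \<Rightarrow> ('a \<Rightarrow> real ^ 'n ^ 'n) \<Rightarrow>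
    ('a \<Rightarrow> real ^ 'n::finite ^ 'n) \<Rightarrow> ('a \<Rightarrow> real) \<Rightarrow> bool" where
  "OA4_ii M \<theta> A B \<delta> \<longleftrightarrow>
     integrable M (\<lambda>\<omega>. ln_plus (ln (beta_up4 \<theta> A B \<omega> / beta_low4 \<theta> A \<delta> \<omega>)))"

definition OA4_iii :: "'a measure \<Rightarrow> (real \<Rightarrow> 'a \<Rightarrow> 'a) \<Rightarrow> ('a \<Rightarrow> real ^ 'n::finite ^ 'n) \<Rightarrow>
    ('a \<Rightarrow> real) \<Rightarrow> bool" where
  "OA4_iii M \<theta> A \<delta> \<longleftrightarrow> integrable M (\<lambda>\<omega>. ln_minus (beta_low4 \<theta> A \<delta> \<omega>))"

definition OA3_i_ii where
  "OA3_i_ii M \<theta> A B \<longleftrightarrow>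
     (\<exists>\<delta>. positive_measurable M \<delta> \<and> OA3_i M \<theta> B \<delta> \<and> OA3_ii M \<theta> A B \<delta>)"

definition OA3_i_iii where
  "OA3_i_iii M \<theta> A B \<longleftrightarrow>
     (\<exists>\<delta>. positive_measurable M \<delta> \<and> OA3_i M \<theta> B \<delta> \<and> OA3_ii M \<theta> A B \<delta> \<and> OA3_iii M \<theta> A \<delta>)"

definition OA4_i_ii where
  "OA4_i_ii M \<theta> A B \<longleftrightarrow>
     (\<exists>\<delta>. positive_measurable M \<delta> \<and> OA4_i M \<theta> B \<delta> \<and> OA4_ii M \<theta> A B \<delta>)"

definition OA4_i_iii where
  "OA4_i_iii M \<theta> A B \<longleftrightarrow>
     (\<exists>\<delta>. positive_measurable M \<delta> \<and> OA4_i M \<theta> B \<delta> \<and> OA4_ii M \<theta> A B \<delta> \<and> OA4_iii M \<theta> A \<delta>)"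


section \<open>Generalized principal Floquet subspaces\<close>

text \<open>The solution operators need not be injective, so a nonzero initial function may be mapped to
  \<open>0\<close>; its growth rate is then \<open>-\<infinity>\<close>. The library's \<^term>\<open>ln (0::real)\<close> is a junk value.\<close>

definition ereal_ln :: "real \<Rightarrow> ereal" where
  "ereal_ln x = (if x = 0 then -\<infinity> else ereal (ln x))"

definition growth_rate :: "(real \<Rightarrow> 'n::finite phase) \<Rightarrow> real \<Rightarrow> ereal" where
  "growth_rate v t = ereal (1 / t) * ereal_ln (norm (v t))"

text \<open>\<open>E\<close> is the family indexed by \<open>\<Omega>'\<close>, \<open>w\<close> its generator, and \<open>\<Lambda>\<close> its generalized principal
  Lyapunov exponent. Each \<open>E \<omega>\<close> is one-dimensional because \<open>w \<omega> \<noteq> 0\<close>.\<close>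

definition gen_principal_Floquet ::
  "'a measure \<Rightarrow> (real \<Rightarrow> 'a \<Rightarrow> 'a) \<Rightarrow> ('a \<Rightarrow> real \<Rightarrow> 'n phase \<Rightarrow> 'n::finite phase) \<Rightarrow>
    'a set \<Rightarrow> ('a \<Rightarrow> 'n phase set) \<Rightarrow> ('a \<Rightarrow> 'n phase) \<Rightarrow> ereal \<Rightarrow> bool" where
  "gen_principal_Floquet M \<theta> U \<Omega>' E w \<Lambda> \<longleftrightarrow>
     \<Omega>' \<in> sets M \<and> invariant_set \<theta> \<Omega>' \<and> measure M \<Omega>' = 1 \<and>
     w \<in> restrict_space M \<Omega>' \<rightarrow>\<^sub>M borel \<and>
     (\<forall>\<omega>\<in>\<Omega>'. w \<omega> \<in> phase_cone - {0} \<and> E \<omega> = span {w \<omega>}) \<and>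
     (\<forall>\<omega>\<in>\<Omega>'. \<forall>t>0. U \<omega> t ` E \<omega> = E (\<theta> t \<omega>)) \<and>
     \<Lambda> < \<infinity> \<and>
     (\<forall>\<omega>\<in>\<Omega>'. (growth_rate (\<lambda>t. U \<omega> t (w \<omega>)) \<longlongrightarrow> \<Lambda>) at_top) \<and>
     (\<forall>\<omega>\<in>\<Omega>'. \<forall>u. u \<noteq> 0 \<longrightarrow> Limsup at_top (growth_rate (\<lambda>t. U \<omega> t u)) \<le> \<Lambda>)"

end

theory Submission
  imports Defs
begin

text \<open>The solution operators are positive linear maps. Over the time \<open>N + 2\<close> the path condition in (i)
  makes \<open>U\<^sub>\<omega>\<close> focusing: every nonnegative initial function is mapped between \<open>\<alpha> e\<close> and
  \<open>\<kappa>(\<omega>) \<alpha> e\<close>, where \<open>e\<close> is the constant function \<open>1\<close> and \<open>\<alpha>\<close> depends on the initial function.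
  A focusing map contracts projective distances by the factor \<open>1 - 1/\<kappa>(\<omega>)\<close>. As \<open>\<kappa>\<close> is finite and
  the flow preserves the measure, almost every backward orbit returns infinitely often to a set on
  which \<open>\<kappa>\<close> is bounded, so that the directions of \<open>U(n) e\<close> started at \<open>\<theta>\<^bsub>-n\<^esub>\<omega>\<close> converge
  to a strictly positive \<open>w(\<omega>)\<close>, and these limits are carried into each other by the flow.

  The logarithm of \<open>\<parallel>U\<^sub>\<omega>(t) w(\<omega>)\<parallel>\<close> is an additive cocycle. By (OA2) its difference to the integral of
  the positive parts of the coefficients is bounded on one side, and the ergodic theorem in the form of
  the maximal inequality gives the exponent, possibly \<open>-\<infinity>\<close>. An arbitrary \<open>u\<close> lies between multiples
  of \<open>\<plusminus>w(\<omega>)\<close>, hence grows no faster. Finally \<open>e\<close> grows at least like the exponential of the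
  integral of a diagonal entry, whose negative part is controlled by (iii) and (OA2).\<close>

section \<open>Linear cooperative delay systems\<close>

text \<open>Focusing holds because the upper and the lower estimate pass through the same quantity:
  the sum over \<open>i\<close> of \<open>u\<^sub>i(0)\<close> and of the delayed inflow into
  component \<open>i\<close> during \<open>[0,1]\<close>. Their quotient therefore does not depend
  on the initial function. Pulling back from the past keeps the fibre over \<omega> fixed, so the
  contractions act on one nested family of cones and yield a limit direction there.

  The obstacle for the exponent is that (OA2) bounds the coefficients only from above, so the
  logarithmic growth over unit time may have a negative part of infinite integral. It is subtracted
  from the integral of an upper rate; the difference is bounded below, and the maximal inequality
  itself decides whether its mean is finite.

  For finiteness, the lower constant in (iii) is at most a positive power of \<open>a_low\<close>
  times \<delta>, and \<delta> lies below an entry of \<open>B\<close>. Hence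
  \<open>- ln a_low\<close> is at most the negative logarithm in (iii) plus the maximal entry of
  \<open>B\<close>. Since the exponent is one constant, a single orbit with a finite lower limit of
  averages decides, and Fatou's lemma supplies it.\<close>

definition absum :: "real ^ 'n ^ 'm \<Rightarrow> real" where
  "absum A = (\<Sum>i\<in>UNIV. \<Sum>j\<in>UNIV. \<bar>A $ i $ j\<bar>)"

lemma absum_nonneg: "0 \<le> absum A"
  unfolding absum_def by (intro sum_nonneg) auto

lemma norm_matrix_vector_le_absum: "norm (A *v x) \<le> absum A * norm x"
  for A :: "real ^ 'n::finite ^ 'm::finite"
proof -
  have "norm (A *v x) \<le> onorm ((*v) A) * norm x"
    by (rule onorm) (simp add: matrix_vector_mul_bounded_linear)
  also have "\<dots> \<le> absum A * norm x"
    unfolding absum_def by (intro mult_right_mono onorm_le_matrix_component_sum) auto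
  finally show ?thesis .
qed

lemma continuous_on_absum:
  assumes "continuous_on S a" shows "continuous_on S (\<lambda>t. absum (a t))"
  unfolding absum_def by (intro continuous_intros assms)

lemma continuous_on_matrix_vector_mult:
  fixes a :: "'b::topological_space \<Rightarrow> real ^ 'n ^ 'm"
  assumes "continuous_on S a" "continuous_on S p"
  shows "continuous_on S (\<lambda>t. a t *v p t)"
  unfolding matrix_vector_mult_def by (intro continuous_intros assms)

section \<open>Existence by Picard iteration\<close>

text \<open>The coefficients are bare functions of time instead of
  \<open>A (\<theta> t \<omega>)\<close>, so that the cocycle identity becomes a shift of
  \<open>a\<close> and \<open>b\<close>.\<close>

definition delay_sol ::
  "(real \<Rightarrow> real ^ 'n ^ 'n) \<Rightarrow> (real \<Rightarrow> real ^ 'n ^ 'n) \<Rightarrow> 'n::finite phase \<Rightarrow> (real \<Rightarrow> real ^ 'n) \<Rightarrow> bool"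
  where "delay_sol a b x u \<longleftrightarrow>
     (\<forall>\<tau>. u (lag_time \<tau>) = apply_bcontfun x \<tau>) \<and>
     (\<forall>t\<ge>0. (u has_vector_derivative (a t *v u t + b t *v u (t - 1))) (at t within {0..}))"

lemma lag_timeE:
  assumes "-1 \<le> t" "t \<le> 0" obtains \<tau> where "t = lag_time \<tau>"
  using assms Lag_inverse[of t] by (metis atLeastAtMost_iff)

lemma lag_time_bounds: "-1 \<le> lag_time \<tau>" "lag_time \<tau> \<le> 0"
  using lag_time[of \<tau>] by auto

text \<open>Clamping makes the initial function continuous on the whole line and constant to the
  right of \<open>0\<close>. Then \<open>lag_extend x t\<close> plus an integral from
  \<open>0\<close> describes the solution before and after \<open>0\<close> alike.\<close>

definition lag_extend :: "'n::finite phase \<Rightarrow> real \<Rightarrow> real ^ 'n" where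
  "lag_extend x t = apply_bcontfun x (Lag (max (-1) (min 0 t)))"

lemma lag_extend_lag_time [simp]: "lag_extend x (lag_time \<tau>) = apply_bcontfun x \<tau>"
  using lag_time_bounds[of \<tau>] by (simp add: lag_extend_def lag_time_inverse)

lemma lag_extend_const: "0 \<le> t \<Longrightarrow> lag_extend x t = lag_extend x 0"
  by (simp add: lag_extend_def)

lemma continuous_on_lag_extend: "continuous_on S (lag_extend x)"
proof -
  have "continuous_on UNIV (\<lambda>t. Lag (max (-1) (min 0 t)))"
    unfolding continuous_on_iff
  proof clarify
    fix t e :: real assume "0 < e"
    then show "\<exists>d>0. \<forall>s\<in>UNIV. dist s t < d \<longrightarrow> dist (Lag (max (-1) (min 0 s))) (Lag (max (-1) (min 0 t))) < e"
      by (intro exI[of _ e]) (auto simp: dist_lag_def Lag_inverse dist_real_def max_def min_def)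
  qed
  then have "continuous_on UNIV (\<lambda>t. apply_bcontfun x (Lag (max (-1) (min 0 t))))"
    by (intro continuous_on_compose2[OF continuous_on_apply_bcontfun]) auto
  then show ?thesis unfolding lag_extend_def by (rule continuous_on_subset) auto
qed

text \<open>For \<open>t < 0\<close> the interval \<open>{0..t}\<close> is empty, so the iterates keep the initial function there.\<close>

primrec picard :: "(real \<Rightarrow> real ^ 'n ^ 'n) \<Rightarrow> (real \<Rightarrow> real ^ 'n ^ 'n) \<Rightarrow> 'n::finite phase \<Rightarrow>
    nat \<Rightarrow> real \<Rightarrow> real ^ 'n" where
  "picard a b x 0 t = lag_extend x t"
| "picard a b x (Suc n) t = lag_extend x t +
     integral {0..t} (\<lambda>s. a s *v picard a b x n s + b s *v picard a b x n (s - 1))"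

text \<open>For negative \<open>t\<close> the interval is empty and the integral is
  \<open>0\<close>. Writing it with \<open>max 0 t\<close> lets continuity on each
  \<open>{0..T}\<close> be pulled back to open sets reaching across \<open>0\<close>, which together
  with \<open>{..<0}\<close> cover the line.\<close>

lemma continuous_on_integral_upper:
  fixes f :: "real \<Rightarrow> 'b::banach"
  assumes "continuous_on UNIV f"
  shows "continuous_on UNIV (\<lambda>t. integral {0..t} f)"
proof -
  have 1: "continuous_on {0..T} (\<lambda>t. integral {0..t} f)" for T
    by (intro indefinite_integral_continuous_1 integrable_continuous_real
        continuous_on_subset[OF assms]) auto
  have 2: "continuous_on {-1<..<T} (\<lambda>t. integral {0..max 0 t} f)" if "0 < T" for T
    by (rule continuous_on_compose2[OF 1[of T]]) (use that in \<open>auto intro!: continuous_intros\<close>)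
  have "continuous_on UNIV (\<lambda>t. integral {0..max 0 t} f)"
  proof -
    have "continuous_on (\<Union>T\<in>{0<..}. {-1<..<T::real}) (\<lambda>t. integral {0..max 0 t} f)"
      using 2 by (intro continuous_on_open_UN) auto
    moreover have "continuous_on {..<0} (\<lambda>t. integral {0..max 0 t} f)"
      by (rule continuous_on_eq[of _ "\<lambda>_. 0"]) auto
    ultimately have "continuous_on ((\<Union>T\<in>{0<..}. {-1<..<T::real}) \<union> {..<0}) (\<lambda>t. integral {0..max 0 t} f)"
      by (intro continuous_on_open_Un) auto
    moreover have "t \<in> (\<Union>T\<in>{0<..}. {-1<..<T::real}) \<union> {..<0}" for t
      by (cases "t < 0") (auto intro!: bexI[of _ "t+1"])
    ultimately show ?thesis by (metis UNIV_eq_I)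
  qed
  moreover have "integral {0..max 0 t} f = integral {0..t} f" for t
    by (cases "t < 0") (auto simp: max_def)
  ultimately show ?thesis by simp
qed

lemma continuous_picard:
  assumes "continuous_on UNIV a" "continuous_on UNIV b"
  shows "continuous_on UNIV (picard a b x n)"
proof (induction n)
  case 0
  have "picard a b x 0 = lag_extend x" by auto
  then show ?case by (simp add: continuous_on_lag_extend)
next
  case (Suc n)
  have s: "continuous_on UNIV (\<lambda>s. picard a b x n (s - 1))"
    by (rule continuous_on_compose2[OF Suc]) (auto intro!: continuous_intros)
  have "continuous_on UNIV (\<lambda>t. lag_extend x t +
     integral {0..t} (\<lambda>s. a s *v picard a b x n s + b s *v picard a b x n (s - 1)))"
    by (intro continuous_on_add continuous_on_lag_extend continuous_on_integral_upper
        continuous_on_matrix_vector_mult assms s Suc)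
  then show ?case by simp
qed

lemma continuous_on_delay_rhs:
  fixes a b :: "real \<Rightarrow> real ^ 'n ^ 'n"
  assumes "continuous_on UNIV a" "continuous_on UNIV b" "continuous_on UNIV u"
  shows "continuous_on S (\<lambda>s. a s *v u s + b s *v u (s - 1))"
proof -
  have s: "continuous_on UNIV (\<lambda>s. u (s - 1))"
    by (rule continuous_on_compose2[OF assms(3)]) (intro continuous_intros, auto)
  have "continuous_on UNIV (\<lambda>s. a s *v u s + b s *v u (s - 1))"
    by (intro continuous_on_add continuous_on_matrix_vector_mult assms s)
  then show ?thesis by (rule continuous_on_subset) auto
qed

lemma has_integral_exp_scaled:
  fixes L :: real
  assumes "0 < L" "0 \<le> t"
  shows "((\<lambda>s. exp (L * s)) has_integral (exp (L * t) - 1) / L) {0..t}"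
proof -
  have "((\<lambda>s. exp (L * s)) has_integral exp (L * t) / L - exp (L * 0) / L) {0..t}"
    using assms
    by (intro fundamental_theorem_of_calculus)
       (auto intro!: derivative_eq_intros simp flip: has_real_derivative_iff_has_vector_derivative)
  then show ?thesis by (simp add: diff_divide_distrib)
qed

text \<open>In the norm weighted by \<open>exp (- 4 K t)\<close> the Picard operator is a contraction with
  factor \<open>1/2\<close>.\<close>

lemma picard_step_bound:
  assumes a: "continuous_on UNIV a" and b: "continuous_on UNIV b" and K: "0 < K" and T: "0 \<le> T"
    and Ka: "\<And>t. t \<in> {0..T} \<Longrightarrow> absum (a t) \<le> K" and Kb: "\<And>t. t \<in> {0..T} \<Longrightarrow> absum (b t) \<le> K"
    and C: "\<And>t. t \<in> {0..T} \<Longrightarrow> norm (picard a b x 1 t - picard a b x 0 t) \<le> C"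
    and "t \<le> T"
  shows "norm (picard a b x (Suc n) t - picard a b x n t) \<le> C / 2 ^ n * exp (4 * K * max 0 t)"
  using \<open>t \<le> T\<close>
proof (induction n arbitrary: t)
  have C0: "0 \<le> C" using order_trans[OF norm_ge_zero C[of T]] T by auto
  case 0
  show ?case
  proof (cases "0 \<le> t")
    case True
    then have "norm (picard a b x 1 t - picard a b x 0 t) \<le> C * 1" using C 0 by auto
    also have "\<dots> \<le> C * exp (4 * K * max 0 t)"
      by (rule mult_left_mono) (use K C0 in auto)
    finally show ?thesis by simp
  qed (use C0 in auto)
next
  have C0: "0 \<le> C" using order_trans[OF norm_ge_zero C[of T]] T by auto
  case (Suc n)
  show ?case
  proof (cases "0 \<le> t")
    case True
    let ?p = "picard a b x"
    let ?F = "\<lambda>n s. a s *v ?p n s + b s *v ?p n (s - 1)"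
    have Fc: "continuous_on {0..t} (?F m)" for m
      by (rule continuous_on_delay_rhs[OF a b continuous_picard[OF a b]])
    have int: "?F m integrable_on {0..t}" for m
      by (rule integrable_continuous_real[OF Fc])
    have "?p (Suc (Suc n)) t - ?p (Suc n) t = integral {0..t} (\<lambda>s. ?F (Suc n) s - ?F n s)"
      using integral_diff[OF int int, of "Suc n" n] by simp
    then have "norm (?p (Suc (Suc n)) t - ?p (Suc n) t)
        = norm (integral {0..t} (\<lambda>s. ?F (Suc n) s - ?F n s))" by (rule arg_cong)
    also have "\<dots> \<le> integral {0..t} (\<lambda>s. K * C / 2 ^ n * 2 * exp (4 * K * s))"
    proof (rule integral_norm_bound_integral)
      show "(\<lambda>s. ?F (Suc n) s - ?F n s) integrable_on {0..t}" by (intro integrable_diff int)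
      show "(\<lambda>s. K * C / 2 ^ n * 2 * exp (4 * K * s)) integrable_on {0..t}"
        by (intro integrable_continuous_real continuous_intros)
      fix s assume s: "s \<in> {0..t}"
      let ?E = "C / 2 ^ n * exp (4 * K * s)"
      have "norm (?F (Suc n) s - ?F n s) = norm (a s *v (?p (Suc n) s - ?p n s) + b s *v (?p (Suc n) (s-1) - ?p n (s-1)))"
        by (simp add: matrix_vector_mult_diff_distrib add_diff_add del: picard.simps)
      also have "\<dots> \<le> absum (a s) * norm (?p (Suc n) s - ?p n s)
          + absum (b s) * norm (?p (Suc n) (s-1) - ?p n (s-1))"
        by (intro norm_triangle_mono norm_matrix_vector_le_absum)
      \<comment> \<open>The current and the delayed term each give \<open>K * ?E\<close>, and
        integrating \<open>exp (4 * K * s)\<close> divides by \<open>4 * K\<close>; this is the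
        factor \<open>1/2\<close>.\<close>
      also have "\<dots> \<le> K * ?E + K * ?E"
      proof (intro add_mono mult_mono Ka Kb)
        show "norm (?p (Suc n) s - ?p n s) \<le> ?E"
          using Suc.IH[of s] s Suc.prems by simp
        \<comment> \<open>The delayed time may be negative; the weight with \<open>max 0\<close> is
          monotone, so its value at \<open>s - 1\<close> is at most the one at
          \<open>s\<close>.\<close>
        have "norm (?p (Suc n) (s-1) - ?p n (s-1)) \<le> C / 2 ^ n * exp (4 * K * max 0 (s-1))"
          using Suc.IH[of "s-1"] s Suc.prems by simp
        also have "\<dots> \<le> ?E" using s K C0 by (intro mult_left_mono) auto
        finally show "norm (?p (Suc n) (s-1) - ?p n (s-1)) \<le> ?E" .
      qed (use s Suc.prems K in auto)
      finally show "norm (?F (Suc n) s - ?F n s) \<le> K * C / 2 ^ n * 2 * exp (4 * K * s)"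
        by (simp del: picard.simps add: mult_ac)
    qed
    also have "\<dots> = K * C / 2 ^ n * 2 * ((exp (4 * K * t) - 1) / (4 * K))"
    proof (rule integral_unique)
      have "((\<lambda>s. exp (4 * K * s)) has_integral (exp (4 * K * t) - 1) / (4 * K)) {0..t}"
        by (rule has_integral_exp_scaled) (use K True in simp_all)
      then show "((\<lambda>s. K * C / 2 ^ n * 2 * exp (4 * K * s)) has_integral
          K * C / 2 ^ n * 2 * ((exp (4 * K * t) - 1) / (4 * K))) {0..t}"
        by (rule has_integral_mult_right)
    qed
    also have "\<dots> \<le> K * C / 2 ^ n * 2 * (exp (4 * K * t) / (4 * K))"
      using K C0 by (intro mult_left_mono divide_right_mono) auto
    also have "\<dots> = C / 2 ^ Suc n * exp (4 * K * max 0 t)"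
      using K True by simp
    finally show ?thesis .
  qed (use C0 in auto)
qed

text \<open>The increments are dominated by a geometric series, so the telescoping series converges
  uniformly. The sets \<open>{..T}\<close> extend to the left without bound because the delayed
  argument \<open>s - 1\<close> leaves \<open>{0..T}\<close>.\<close>

lemma picard_converges:
  assumes a: "continuous_on UNIV a" and b: "continuous_on UNIV b"
  obtains u where "\<And>T. uniform_limit {..T} (picard a b x) u sequentially"
proof -
  let ?p = "picard a b x"
  define u where "u t = lag_extend x t + (\<Sum>n. ?p (Suc n) t - ?p n t)" for t
  have "uniform_limit {..T} ?p u sequentially" if T: "0 \<le> T" for T
  proof -
    have ex: "\<exists>K>0. \<forall>t\<in>{0..T}. g t \<le> K" if "continuous_on UNIV g" for g :: "real \<Rightarrow> real"
    proof -
      have "bounded (g ` {0..T})"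
        by (intro compact_imp_bounded compact_continuous_image continuous_on_subset[OF that]) auto
      then obtain K where "\<forall>y\<in>g ` {0..T}. norm y \<le> K" "K > 0" using bounded_pos by metis
      then show ?thesis by (intro exI[of _ K]) auto
    qed
    obtain K1 where K1: "K1 > 0" "\<forall>t\<in>{0..T}. absum (a t) \<le> K1"
      using ex[OF continuous_on_absum[OF a]] by auto
    obtain K2 where K2: "K2 > 0" "\<forall>t\<in>{0..T}. absum (b t) \<le> K2"
      using ex[OF continuous_on_absum[OF b]] by auto
    define K where "K = max K1 K2"
    have "continuous_on UNIV (\<lambda>t. norm (?p 1 t - ?p 0 t))"
      by (intro continuous_on_norm continuous_on_diff continuous_picard a b)
    from ex[OF this] obtain C where C: "\<forall>t\<in>{0..T}. norm (?p 1 t - ?p 0 t) \<le> C" "C > 0"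
      by blast
    have st: "norm (?p (Suc n) t - ?p n t) \<le> C * exp (4 * K * T) * (1/2) ^ n" if "t \<in> {..T}" for n t
    proof -
      have "norm (?p (Suc n) t - ?p n t) \<le> C / 2 ^ n * exp (4 * K * max 0 t)"
      proof (rule picard_step_bound[OF a b _ T])
        show "0 < K" using K1 K2 by (auto simp: K_def)
        show "\<And>t. t \<in> {0..T} \<Longrightarrow> absum (a t) \<le> K" "\<And>t. t \<in> {0..T} \<Longrightarrow> absum (b t) \<le> K"
          using K1 K2 by (auto simp: K_def le_max_iff_disj)
      qed (use that C in auto)
      also have "\<dots> \<le> C / 2 ^ n * exp (4 * K * T)"
      proof (rule mult_left_mono)
        have "0 < K" using K1 by (auto simp: K_def)
        then have "4 * K * max 0 t \<le> 4 * K * T" using that T by (intro mult_left_mono) auto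
        then show "exp (4 * K * max 0 t) \<le> exp (4 * K * T)" by simp
      qed (use C in auto)
      finally show ?thesis by (simp add: power_divide)
    qed
    have "uniform_limit {..T} (\<lambda>n t. \<Sum>i<n. ?p (Suc i) t - ?p i t)
            (\<lambda>t. suminf (\<lambda>i. ?p (Suc i) t - ?p i t)) sequentially"
      by (rule Weierstrass_m_test[OF st]) (auto intro!: summable_mult summable_geometric)
    then have "uniform_limit {..T} (\<lambda>n t. lag_extend x t + (\<Sum>i<n. ?p (Suc i) t - ?p i t))
            (\<lambda>t. lag_extend x t + suminf (\<lambda>i. ?p (Suc i) t - ?p i t)) sequentially"
      by (intro uniform_limit_add uniform_limit_const) auto
    moreover have "lag_extend x t + (\<Sum>i<n. ?p (Suc i) t - ?p i t) = ?p n t" for n t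
      by (subst sum_lessThan_telescope) simp
    ultimately show ?thesis unfolding u_def by (simp del: picard.simps)
  qed
  then have "uniform_limit {..T} ?p u sequentially" for T
    by (rule uniform_limit_on_subset[where J = "{..max 0 T}"]) auto
  then show thesis by (rule that)
qed

lemma has_vector_derivative_integral_upper:
  fixes f :: "real \<Rightarrow> 'b::banach"
  assumes "continuous_on UNIV f" "0 \<le> t"
  shows "((\<lambda>t. integral {0..t} f) has_vector_derivative f t) (at t within {0..})"
proof -
  have "((\<lambda>t. integral {0..t} f) has_vector_derivative f t) (at t within {0..t+1})"
    by (rule integral_has_vector_derivative) (use assms in \<open>auto intro: continuous_on_subset\<close>)
  moreover have "at t within {0..t+1} = at t within {0..}"
    by (rule at_within_nhd[of _ "{..<t+1}"]) auto
  ultimately show ?thesis by simp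
qed

text \<open>Uniform convergence passes through the integral and gives the integral equation, which
  is then differentiated. Pointwise convergence is kept as a conclusion because it later transfers
  measurability in \<omega> from the iterates to the solution.\<close>

lemma picard_limit:
  assumes a: "continuous_on UNIV a" and b: "continuous_on UNIV b"
  obtains u where "continuous_on UNIV u" "delay_sol a b x u" "\<And>t. (\<lambda>n. picard a b x n t) \<longlonglongrightarrow> u t"
    "\<And>t. t \<ge> 0 \<Longrightarrow> u t = lag_extend x 0 + integral {0..t} (\<lambda>s. a s *v u s + b s *v u (s - 1))"
proof -
  obtain u where u: "\<And>T. uniform_limit {..T} (picard a b x) u sequentially"
    using picard_converges[OF a b] by metis
  have lim: "(\<lambda>n. picard a b x n t) \<longlonglongrightarrow> u t" for t
    using tendsto_uniform_limitI[OF u[of t]] by simp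
  have cont: "continuous_on UNIV u"
  proof -
    have "continuous_on {..T} u" for T
      by (rule uniform_limit_theorem[OF _ u])
         (auto intro!: always_eventually continuous_on_subset[OF continuous_picard[OF a b]])
    then have "continuous_on {..<T} u" for T by (rule continuous_on_subset[of "{..T}"]) auto
    then have "continuous_on (\<Union>T\<in>UNIV. {..<T::real}) u" by (intro continuous_on_open_UN) auto
    moreover have "(\<Union>T\<in>UNIV. {..<T::real}) = UNIV"
      using gt_ex by blast
    ultimately show ?thesis by simp
  qed
  let ?F = "\<lambda>u s. a s *v u s + b s *v u (s - 1)"
  have eq: "u t = lag_extend x t + integral {0..t} (?F u)" for t
  proof -
    have u1: "uniform_limit {0..t} (\<lambda>n s. picard a b x n (s - 1)) (\<lambda>s. u (s - 1)) sequentially"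
      by (rule uniform_limit_compose'[OF u[of t], where h = "\<lambda>s. s - 1"]) auto
    have u0: "uniform_limit {0..t} (picard a b x) u sequentially"
      by (rule uniform_limit_on_subset[OF u[of t]]) auto
    have mv: "uniform_limit {0..t} (\<lambda>n s. c s *v q n s) (\<lambda>s. c s *v v s) sequentially"
      if c: "continuous_on UNIV c" and q: "uniform_limit {0..t} q v sequentially"
      for c :: "real \<Rightarrow> real^'a^'a" and q v
    proof (rule uniform_limitI)
      fix e :: real assume "e > 0"
      have "bounded ((\<lambda>s. absum (c s)) ` {0..t})"
        by (intro compact_imp_bounded compact_continuous_image
             continuous_on_subset[OF continuous_on_absum[OF c]]) auto
      then obtain K where K: "K > 0" "\<forall>s\<in>{0..t}. absum (c s) \<le> K"
        unfolding bounded_pos by (metis abs_le_D1 imageI real_norm_def)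
      have "\<forall>\<^sub>F n in sequentially. \<forall>s\<in>{0..t}. dist (q n s) (v s) < e / K"
        using q \<open>e > 0\<close> K by (auto simp: uniform_limit_iff)
      then show "\<forall>\<^sub>F n in sequentially. \<forall>s\<in>{0..t}. dist (c s *v q n s) (c s *v v s) < e"
      proof (rule eventually_mono, intro ballI)
        fix n s assume *: "\<forall>s\<in>{0..t}. dist (q n s) (v s) < e / K" and s: "s \<in> {0..t}"
        have "norm (c s *v (q n s - v s)) \<le> absum (c s) * norm (q n s - v s)"
          by (rule norm_matrix_vector_le_absum)
        also have "\<dots> \<le> K * norm (q n s - v s)" using K s by (intro mult_right_mono) auto
        also have "\<dots> < K * (e / K)" using * s K by (intro mult_strict_left_mono) (auto simp: dist_norm)
        finally show "dist (c s *v q n s) (c s *v v s) < e"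
          using K by (simp add: dist_norm matrix_vector_mult_diff_distrib)
      qed
    qed
    have uF: "uniform_limit {0..t} (\<lambda>n. ?F (picard a b x n)) (?F u) sequentially"
      by (intro uniform_limit_add mv a b u0 u1)
    obtain I J where IJ: "\<And>n. (?F (picard a b x n) has_integral I n) {0..t}"
        "(?F u has_integral J) {0..t}" "I \<longlonglongrightarrow> J"
      by (rule uniform_limit_integral[OF uF])
         (auto intro!: continuous_on_delay_rhs continuous_picard a b)
    have "(\<lambda>n. picard a b x (Suc n) t) \<longlonglongrightarrow> lag_extend x t + integral {0..t} (?F u)"
      using tendsto_add[OF tendsto_const IJ(3)] integral_unique[OF IJ(1)] integral_unique[OF IJ(2)]
      by simp
    moreover have "(\<lambda>n. picard a b x (Suc n) t) \<longlonglongrightarrow> u t" using lim LIMSEQ_Suc by blast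
    ultimately show ?thesis using LIMSEQ_unique by blast
  qed
  have "delay_sol a b x u"
    unfolding delay_sol_def
  proof safe
    fix \<tau> show "u (lag_time \<tau>) = apply_bcontfun x \<tau>"
    proof (cases "lag_time \<tau> = 0")
      case False
      then show ?thesis
        using lag_time_bounds[of \<tau>] by (subst eq) auto
    next
      case True
      then have "u (lag_time \<tau>) = lag_extend x (lag_time \<tau>)" by (subst eq) simp
      then show ?thesis by simp
    qed
  next
    fix t :: real assume t: "0 \<le> t"
    have "((\<lambda>t. lag_extend x 0 + integral {0..t} (?F u)) has_vector_derivative 0 + ?F u t) (at t within {0..})"
      by (intro has_vector_derivative_add has_vector_derivative_const
          has_vector_derivative_integral_upper continuous_on_delay_rhs a b cont t)
    then have "((\<lambda>t. lag_extend x 0 + integral {0..t} (?F u)) has_vector_derivative ?F u t) (at t within {0..})"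
      by simp
    then show "(u has_vector_derivative ?F u t) (at t within {0..})"
    proof (rule has_vector_derivative_transform[rotated 2])
      fix s :: real assume "s \<in> {0..}"
      then show "u s = lag_extend x 0 + integral {0..s} (?F u)"
        using eq[of s] lag_extend_const[of s x] by (simp only: atLeast_iff)
    qed (use t in simp)
  qed
  moreover have "u t = lag_extend x 0 + integral {0..t} (?F u)" if "t \<ge> 0" for t
    using eq[of t] lag_extend_const[OF that, of x] by argo
  ultimately show thesis using that cont lim by blast
qed

section \<open>Components, continuity and linearity of solutions\<close>

lemma delay_sol_component:
  assumes "delay_sol a b x u" "0 \<le> t"
  shows "((\<lambda>t. u t $ i) has_real_derivative
    (\<Sum>j\<in>UNIV. a t $ i $ j * u t $ j) + (\<Sum>j\<in>UNIV. b t $ i $ j * u (t - 1) $ j)) (at t within {0..})"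
proof -
  have "(u has_vector_derivative (a t *v u t + b t *v u (t - 1))) (at t within {0..})"
    using assms by (simp add: delay_sol_def)
  from bounded_linear.has_vector_derivative[OF bounded_linear_vec_nth this, of i]
  show ?thesis
    by (simp add: has_real_derivative_iff_has_vector_derivative matrix_vector_mult_def)
qed

lemma delay_sol_history:
  assumes "delay_sol a b x u" "-1 \<le> t" "t \<le> 0"
  shows "u t = lag_extend x t"
  using assms lag_timeE[of t] by (metis delay_sol_def lag_extend_lag_time)

lemma delay_sol_continuous:
  assumes "delay_sol a b x u"
  shows "continuous_on {-1..} u"
proof -
  have "continuous_on {0..} u"
    using assms unfolding delay_sol_def continuous_on_eq_continuous_within
    by (auto intro: has_vector_derivative_continuous)
  moreover have "continuous_on {-1..0} u"
    by (rule continuous_on_eq[OF continuous_on_lag_extend[of _ x]])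
       (use delay_sol_history[OF assms] in auto)
  ultimately have "continuous_on ({-1..0} \<union> {0..}) u"
    by (intro continuous_on_closed_Un) auto
  moreover have "{-1..0} \<union> {0..} = {-1::real..}" by auto
  ultimately show ?thesis by simp
qed

lemma delay_sol_lincomb:
  assumes "delay_sol a b x u" "delay_sol a b y v"
  shows "delay_sol a b (r *\<^sub>R x + s *\<^sub>R y) (\<lambda>t. r *\<^sub>R u t + s *\<^sub>R v t)"
  unfolding delay_sol_def
proof safe
  fix t :: real assume t: "0 \<le> t"
  have "((\<lambda>t. r *\<^sub>R u t + s *\<^sub>R v t) has_vector_derivative
      (r *\<^sub>R (a t *v u t + b t *v u (t - 1)) + s *\<^sub>R (a t *v v t + b t *v v (t - 1)))) (at t within {0..})"
    using assms t unfolding delay_sol_def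
    by (intro has_vector_derivative_add bounded_linear.has_vector_derivative[OF bounded_linear_scaleR_right]) auto
  then show "((\<lambda>t. r *\<^sub>R u t + s *\<^sub>R v t) has_vector_derivative
      (a t *v (r *\<^sub>R u t + s *\<^sub>R v t) + b t *v (r *\<^sub>R u (t - 1) + s *\<^sub>R v (t - 1)))) (at t within {0..})"
    by (simp add: matrix_vector_right_distrib matrix_vector_mult_scaleR scaleR_add_right add_ac)
qed (use assms in \<open>auto simp: delay_sol_def\<close>)

lemma lag_shift_ge: "0 \<le> t \<Longrightarrow> -1 \<le> t + lag_time \<tau>"
  using lag_time_bounds[of \<tau>] by linarith

section \<open>Solution operators and the order of the phase space\<close>

text \<open>The same description as in \<open>delay_solution\<close>, so that the identification
  with \<open>delay_semiflow\<close> is a matter of unfolding.\<close>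

definition traj :: "(real \<Rightarrow> real ^ 'n ^ 'n) \<Rightarrow> (real \<Rightarrow> real ^ 'n ^ 'n) \<Rightarrow> 'n::finite phase \<Rightarrow> real \<Rightarrow> real ^ 'n"
  where "traj a b x = (THE u. delay_sol a b x u \<and> (\<forall>t < -1. u t = 0))"

definition flow :: "(real \<Rightarrow> real ^ 'n ^ 'n) \<Rightarrow> (real \<Rightarrow> real ^ 'n ^ 'n) \<Rightarrow> real \<Rightarrow> 'n::finite phase \<Rightarrow> 'n phase"
  where "flow a b t x = segment (traj a b x) t"

lemma delay_semiflow_eq_flow:
  "delay_semiflow \<theta> A B \<omega> t x = flow (\<lambda>t. A (\<theta> t \<omega>)) (\<lambda>t. B (\<theta> t \<omega>)) t x"
  by (simp add: delay_semiflow_def flow_def traj_def delay_solution_def delay_sol_def solves_delay_def)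

definition phase_le :: "'n::finite phase \<Rightarrow> 'n phase \<Rightarrow> bool" (infix "\<preceq>" 50) where
  "x \<preceq> y \<longleftrightarrow> (\<forall>\<tau> i. apply_bcontfun x \<tau> $ i \<le> apply_bcontfun y \<tau> $ i)"

text \<open>An order unit: by \<open>abs_phase_le_norm\<close> every \<open>x\<close> lies between
  \<open>- norm x *\<^sub>R one_phase\<close> and \<open>norm x *\<^sub>R one_phase\<close>.\<close>

definition one_phase :: "'n::finite phase" where
  "one_phase = const_bcontfun (\<chi> i. 1)"

lemma one_phase_apply [simp]: "apply_bcontfun one_phase \<tau> $ i = 1"
  by (simp add: one_phase_def const_bcontfun.rep_eq)

lemma phase_cone_iff: "x \<in> phase_cone \<longleftrightarrow> 0 \<preceq> x"
  by (simp add: phase_cone_def phase_le_def)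

lemma phase_le_trans [trans]: "x \<preceq> y \<Longrightarrow> y \<preceq> z \<Longrightarrow> x \<preceq> z"
  unfolding phase_le_def by (meson order_trans)

lemma phase_le_diff: "x \<preceq> y \<longleftrightarrow> 0 \<preceq> y - x"
  by (simp add: phase_le_def)

lemma phase_le_scaleR: "x \<preceq> y \<Longrightarrow> 0 \<le> r \<Longrightarrow> r *\<^sub>R x \<preceq> r *\<^sub>R y"
  by (simp add: phase_le_def mult_left_mono)

lemma phase_le_scaleR_left: "0 \<preceq> x \<Longrightarrow> r \<le> s \<Longrightarrow> r *\<^sub>R x \<preceq> s *\<^sub>R x"
  by (simp add: phase_le_def mult_right_mono)

lemma norm_phase_mono:
  assumes "\<And>\<tau> i. \<bar>apply_bcontfun x \<tau> $ i\<bar> \<le> apply_bcontfun y \<tau> $ i"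
  shows "norm x \<le> norm (y :: 'n::finite phase)"
proof (rule norm_bound)
  fix \<tau>
  have "norm (apply_bcontfun x \<tau>) \<le> norm (apply_bcontfun y \<tau>)"
    by (rule norm_le_componentwise_cart) (metis assms abs_ge_self order_trans real_norm_def)
  also have "\<dots> \<le> norm y" by (rule norm_bounded)
  finally show "norm (apply_bcontfun x \<tau>) \<le> norm y" .
qed

lemma abs_phase_le_norm: "\<bar>apply_bcontfun x \<tau> $ i\<bar> \<le> norm (x :: 'n::finite phase)"
  using component_le_norm_cart[of "apply_bcontfun x \<tau>" i] norm_bounded[of x \<tau>] by simp

section \<open>Comparison principle, uniqueness, cocycle identity\<close>

locale coop_delay =
  fixes a b :: "real \<Rightarrow> real ^ 'n::finite ^ 'n"
  assumes cont_a: "continuous_on UNIV a" and cont_b: "continuous_on UNIV b"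
    and a_offdiag: "\<And>t i j. i \<noteq> j \<Longrightarrow> 0 \<le> a t $ i $ j"
    and b_nonneg: "\<And>t i j. 0 \<le> b t $ i $ j"
begin

text \<open>At a positive maximum over time and index of \<open>- u\<^sub>j(t) exp (- K t)\<close>, with \<open>K\<close> above all row
  sums, the derivative would be negative.\<close>

lemma delay_sol_nonneg:
  assumes u: "delay_sol a b x u" and x: "0 \<preceq> x" and "-1 \<le> t"
  shows "0 \<le> u t $ i"
proof (rule ccontr)
  assume neg: "\<not> 0 \<le> u t $ i"
  have hist: "0 \<le> u s $ j" if "-1 \<le> s" "s \<le> 0" for s j
    using delay_sol_history[OF u that] x by (simp add: lag_extend_def phase_le_def)
  then have t: "0 < t" using neg \<open>-1 \<le> t\<close> by force
  have "bounded ((\<lambda>s. absum (a s) + absum (b s)) ` {0..t})"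
    by (intro compact_imp_bounded compact_continuous_image continuous_on_add continuous_on_absum
        continuous_on_subset[OF cont_a] continuous_on_subset[OF cont_b]) auto
  then obtain K0 where K0: "\<forall>s\<in>{0..t}. norm (absum (a s) + absum (b s)) \<le> K0"
    unfolding bounded_iff by blast
  \<comment> \<open>The added \<open>1\<close> makes the bound strict, which the sign of the
    derivative at the maximum requires.\<close>
  define K where "K = K0 + 1"
  have K: "absum (a s) + absum (b s) < K" if "s \<in> {0..t}" for s
    using K0 that unfolding K_def by force
  define f where "f j s = - u s $ j * exp (- K * s)" for j s
  have fc: "continuous_on {0..t} (f j)" for j
    unfolding f_def
    by (intro continuous_intros continuous_on_subset[OF delay_sol_continuous[OF u]]) auto
  have "\<exists>s\<in>{0..t}. \<forall>r\<in>{0..t}. f j r \<le> f j s" for j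
    by (intro continuous_attains_sup fc) (use t in auto)
  then obtain s where s: "s j \<in> {0..t}" "\<And>r. r \<in> {0..t} \<Longrightarrow> f j r \<le> f j (s j)" for j
    by metis
  have "Max (range (\<lambda>k. f k (s k))) \<in> range (\<lambda>k. f k (s k))" by (rule Max_in) auto
  then obtain j where j: "Max (range (\<lambda>k. f k (s k))) = f j (s j)"
    unfolding image_iff by blast
  have j: "f k (s k) \<le> f j (s j)" for k
    unfolding j[symmetric] by (rule Max_ge) auto
  define q m where "q = s j" and "m = f j q"
  have q: "q \<in> {0..t}" using s q_def by auto
  have max: "f k r \<le> m" if "r \<in> {0..t}" for k r
    using s(2)[OF that] j[of k] unfolding m_def q_def by (rule order_trans)
  have "0 < f i t" using neg by (simp add: f_def mult_neg_pos)
  also have "\<dots> \<le> m" using t by (intro max) auto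
  finally have m: "0 < m" .
  have q0: "0 < q"
  proof (rule ccontr)
    assume "\<not> 0 < q" then have "q = 0" using q by auto
    then have "m \<le> 0" using hist[of 0 j] by (simp add: m_def f_def)
    then show False using m by simp
  qed
  define m' where "m' = m * exp (K * q)"
  have m': "0 < m'" using m by (simp add: m'_def)
  have K0: "0 < K" using K[OF q] absum_nonneg[of "a q"] absum_nonneg[of "b q"] by linarith
  \<comment> \<open>The weight \<open>exp (K * r)\<close> increases, so the bound at
    \<open>q\<close> holds at every earlier time, the delayed time \<open>q - 1\<close> included; on
    the initial interval \<open>u\<close> is nonnegative and \<open>m'\<close> is positive.\<close>
  have le: "- u r $ k \<le> m'" if "-1 \<le> r" "r \<le> q" for r k
  proof (cases "r \<le> 0")
    case True then show ?thesis using hist[of r k] that m' by auto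
  next
    case False
    then have "f k r \<le> m" using that q by (intro max) auto
    then have "- u r $ k \<le> m * exp (K * r)"
      by (simp add: f_def exp_minus field_simps)
    also have "\<dots> \<le> m'" unfolding m'_def using that K0 m by simp
    finally show ?thesis .
  qed
  have uq: "- u q $ j = m'"
    unfolding m'_def m_def f_def by (simp add: exp_minus field_simps)
  define D where "D = (\<Sum>k\<in>UNIV. a q $ j $ k * u q $ k) + (\<Sum>k\<in>UNIV. b q $ j $ k * u (q - 1) $ k)"
  have "(f j has_real_derivative (- D * exp (- K * q) + K * u q $ j * exp (- K * q))) (at q within {0..})"
    unfolding f_def
    by (rule derivative_eq_intros delay_sol_component[OF u] refl | use q D_def in simp)+
  moreover have "- D * exp (- K * q) + K * u q $ j * exp (- K * q) < 0"
  proof -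
    have A: "- (a q $ j $ k * u q $ k) \<le> \<bar>a q $ j $ k\<bar> * m'" for k
    proof (cases "k = j")
      case True
      have "- (a q $ j $ k * u q $ k) = a q $ j $ j * m'" using True by (simp flip: uq)
      also have "\<dots> \<le> \<bar>a q $ j $ k\<bar> * m'" using m' True by (intro mult_right_mono) auto
      finally show ?thesis .
    next
      case False
      then have "a q $ j $ k * (- u q $ k) \<le> a q $ j $ k * m'"
        using le[of q k] q a_offdiag[of j k q] by (intro mult_left_mono) auto
      then show ?thesis using False a_offdiag[of j k q] by simp
    qed
    have B: "- (b q $ j $ k * u (q - 1) $ k) \<le> \<bar>b q $ j $ k\<bar> * m'" for k
    proof -
      have "b q $ j $ k * (- u (q-1) $ k) \<le> b q $ j $ k * m'"
        using le[of "q-1" k] q b_nonneg[where t=q] by (intro mult_left_mono) auto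
      then show ?thesis using b_nonneg[of q j k] by simp
    qed
    have "- D = (\<Sum>k\<in>UNIV. - (a q $ j $ k * u q $ k)) + (\<Sum>k\<in>UNIV. - (b q $ j $ k * u (q - 1) $ k))"
      by (simp add: D_def sum_negf)
    also have "\<dots> \<le> (\<Sum>k\<in>UNIV. \<bar>a q $ j $ k\<bar> * m') + (\<Sum>k\<in>UNIV. \<bar>b q $ j $ k\<bar> * m')"
      by (intro add_mono sum_mono A B)
    also have "\<dots> = ((\<Sum>k\<in>UNIV. \<bar>a q $ j $ k\<bar>) + (\<Sum>k\<in>UNIV. \<bar>b q $ j $ k\<bar>)) * m'"
      by (simp add: sum_distrib_right distrib_right)
    also have "\<dots> \<le> (absum (a q) + absum (b q)) * m'"
    proof (rule mult_right_mono)
      have "(\<Sum>k\<in>UNIV. \<bar>a q $ j $ k\<bar>) \<le> absum (a q)" "(\<Sum>k\<in>UNIV. \<bar>b q $ j $ k\<bar>) \<le> absum (b q)"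
        unfolding absum_def by (intro member_le_sum sum_nonneg; simp)+
      then show "(\<Sum>k\<in>UNIV. \<bar>a q $ j $ k\<bar>) + (\<Sum>k\<in>UNIV. \<bar>b q $ j $ k\<bar>) \<le> absum (a q) + absum (b q)"
        by simp
    qed (use m' in simp)
    also have "\<dots> < K * m'" using K[OF q] m' by simp
    finally have "- D < K * m'" .
    moreover have "u q $ j = - m'" using uq by simp
    ultimately have "- D + K * u q $ j < 0" by simp
    then have "(- D + K * u q $ j) * exp (- K * q) < 0" by (intro mult_neg_pos) auto
    then show ?thesis by (simp add: algebra_simps)
  qed
  ultimately obtain d where d: "d > 0" "\<And>h. h > 0 \<Longrightarrow> q - h \<in> {0..} \<Longrightarrow> h < d \<Longrightarrow> f j q < f j (q - h)"
    using has_real_derivative_neg_dec_left by metis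
  \<comment> \<open>The shift \<open>min (d/2) q\<close> is smaller than \<open>d\<close> and does
    not lead left of \<open>0\<close>, so the larger value found there contradicts the maximality of
    \<open>m\<close>.\<close>
  have "f j q < f j (q - min (d/2) q)"
    using d(1) q0 by (intro d(2)) auto
  moreover have "f j (q - min (d/2) q) \<le> m" using d(1) q q0 by (intro max) auto
  ultimately show False by (simp add: m_def)
qed

lemma delay_sol_mono:
  assumes "delay_sol a b x u" "delay_sol a b y v" "x \<preceq> y" "-1 \<le> t"
  shows "u t $ i \<le> v t $ i"
  using delay_sol_nonneg[OF delay_sol_lincomb[OF assms(2,1), of 1 "-1"] _ assms(4)] assms(3)
    phase_le_diff[of x y] by simp

text \<open>Uniqueness is the comparison principle applied in both directions.\<close>

lemma delay_sol_unique:
  assumes "delay_sol a b x u" "delay_sol a b x v" "-1 \<le> t"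
  shows "u t = v t"
  unfolding vec_eq_iff
  using delay_sol_mono[OF assms(1,2) _ assms(3)] delay_sol_mono[OF assms(2,1) _ assms(3)]
  by (auto simp: phase_le_def intro: antisym)

lemma ex_delay_sol: "\<exists>u. delay_sol a b x u"
  using picard_limit[OF cont_a cont_b] by metis

text \<open>Values left of \<open>-1\<close> do not enter the equation, so a solution may be set to
  \<open>0\<close> there, as the description in \<open>traj\<close> demands.\<close>

lemma delay_sol_cong:
  assumes u: "delay_sol a b x u" and eq: "\<And>t. -1 \<le> t \<Longrightarrow> u t = v t"
  shows "delay_sol a b x v"
  unfolding delay_sol_def
proof safe
  fix \<tau> show "v (lag_time \<tau>) = apply_bcontfun x \<tau>"
    using u eq[of "lag_time \<tau>"] lag_time_bounds[of \<tau>] by (simp add: delay_sol_def)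
next
  fix t :: real assume t: "0 \<le> t"
  then have "(u has_vector_derivative (a t *v u t + b t *v u (t - 1))) (at t within {0..})"
    using u by (simp add: delay_sol_def)
  then have "(u has_vector_derivative (a t *v v t + b t *v v (t - 1))) (at t within {0..})"
    using t eq[of t] eq[of "t-1"] by simp
  then show "(v has_vector_derivative (a t *v v t + b t *v v (t - 1))) (at t within {0..})"
    by (rule has_vector_derivative_transform[rotated 2]) (use t eq in auto)
qed

lemma traj_sol: "delay_sol a b x (traj a b x)"
proof -
  obtain u where u: "delay_sol a b x u" using ex_delay_sol by auto
  let ?v = "\<lambda>t. if t < -1 then 0 else u t"
  have v: "delay_sol a b x ?v" by (rule delay_sol_cong[OF u]) auto
  have "delay_sol a b x (traj a b x) \<and> (\<forall>t < -1. traj a b x t = 0)"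
    unfolding traj_def
  proof (rule theI[where P = "\<lambda>u. delay_sol a b x u \<and> (\<forall>t < -1. u t = 0)" and a = ?v])
    show "delay_sol a b x ?v \<and> (\<forall>t < -1. ?v t = 0)" using v by auto
    fix w assume w: "delay_sol a b x w \<and> (\<forall>t < -1. w t = 0)"
    show "w = ?v"
    proof
      fix t show "w t = ?v t"
        using w delay_sol_unique[of x w ?v t] v by (cases "t < -1") auto
    qed
  qed
  then show ?thesis by simp
qed

lemma traj_eqI: "delay_sol a b x u \<Longrightarrow> -1 \<le> t \<Longrightarrow> traj a b x t = u t"
  using delay_sol_unique traj_sol by blast

lemma continuous_traj: "continuous_on {-1..} (traj a b x)"
  by (rule delay_sol_continuous[OF traj_sol])

lemma flow_apply:
  assumes "0 \<le> t"
  shows "apply_bcontfun (flow a b t x) \<tau> = traj a b x (t + lag_time \<tau>)"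
proof -
  have "continuous_on {-1..0} (\<lambda>\<tau>. traj a b x (t + \<tau>))"
    by (rule continuous_on_compose2[OF continuous_traj]) (use assms in \<open>auto intro!: continuous_intros\<close>)
  from lag_restriction_bcontfun[OF this] show ?thesis
    by (simp add: flow_def segment_def Bcontfun_inverse)
qed

lemma traj_lag: "traj a b x (lag_time \<tau>) = apply_bcontfun x \<tau>"
  using traj_sol unfolding delay_sol_def by blast

lemma flow_zero: "flow a b 0 x = x"
  by (rule bcontfun_eqI) (simp add: flow_apply traj_lag)

lemma traj_lincomb: "-1 \<le> t \<Longrightarrow> traj a b (r *\<^sub>R x + s *\<^sub>R y) t = r *\<^sub>R traj a b x t + s *\<^sub>R traj a b y t"
  by (rule traj_eqI[OF delay_sol_lincomb[OF traj_sol traj_sol]])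

lemma linear_flow: assumes "0 \<le> t" shows "linear (flow a b t)"
proof -
  have *: "flow a b t (r *\<^sub>R x + s *\<^sub>R y) = r *\<^sub>R flow a b t x + s *\<^sub>R flow a b t y" for r s x y
    using assms lag_shift_ge[OF assms]
    by (intro bcontfun_eqI) (simp add: flow_apply traj_lincomb)
  show ?thesis
    using *[of 1 _ 1] *[of _ _ 0 0] by (intro linearI) auto
qed

lemma flow_mono: "x \<preceq> y \<Longrightarrow> 0 \<le> t \<Longrightarrow> flow a b t x \<preceq> flow a b t y"
  unfolding phase_le_def[of "flow a b t x"]
  using delay_sol_mono[OF traj_sol traj_sol] lag_shift_ge by (simp add: flow_apply)

lemma coop_delay_shift: "coop_delay (\<lambda>t. a (t + s)) (\<lambda>t. b (t + s))"
proof
  have "continuous_on UNIV (\<lambda>t::real. t + s)" by (intro continuous_intros)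
  then show "continuous_on UNIV (\<lambda>t. a (t + s))" "continuous_on UNIV (\<lambda>t. b (t + s))"
    using continuous_on_compose2[OF cont_a] continuous_on_compose2[OF cont_b] by auto
qed (auto intro: a_offdiag b_nonneg)

text \<open>The shifted solution solves the shifted equation with the segment at time
  \<open>s\<close> as initial function; uniqueness identifies the two.\<close>

lemma traj_shift:
  assumes "0 \<le> s" "-1 \<le> t"
  shows "traj (\<lambda>t. a (t + s)) (\<lambda>t. b (t + s)) (flow a b s x) t = traj a b x (t + s)"
proof -
  interpret sh: coop_delay "\<lambda>t. a (t + s)" "\<lambda>t. b (t + s)" by (rule coop_delay_shift)
  have "delay_sol (\<lambda>t. a (t + s)) (\<lambda>t. b (t + s)) (flow a b s x) (\<lambda>t. traj a b x (t + s))"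
    unfolding delay_sol_def
  proof safe
    fix \<tau> show "traj a b x (lag_time \<tau> + s) = apply_bcontfun (flow a b s x) \<tau>"
      using assms by (simp add: flow_apply add.commute)
  next
    fix t :: real assume t: "0 \<le> t"
    have "(traj a b x has_vector_derivative a (t + s) *v traj a b x (t + s) + b (t + s) *v traj a b x (t + s - 1))
         (at (t + s) within {0..})"
      using traj_sol[of x] assms t unfolding delay_sol_def by simp
    then have 1: "(traj a b x has_vector_derivative a (t + s) *v traj a b x (t + s) + b (t + s) *v traj a b x (t + s - 1))
         (at (t + s) within (\<lambda>t. t + s) ` {0..})"
      by (rule has_vector_derivative_within_subset) (use assms in auto)
    have 2: "((\<lambda>t. t + s) has_vector_derivative 1) (at t within {0..})"
      by (auto intro!: derivative_eq_intros)
    from vector_diff_chain_within[OF 2 1]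
    show "((\<lambda>t. traj a b x (t + s)) has_vector_derivative
        a (t + s) *v traj a b x (t + s) + b (t + s) *v traj a b x (t - 1 + s)) (at t within {0..})"
      by (simp add: o_def add.commute add_diff_eq diff_add_eq)
  qed
  then show ?thesis by (rule sh.traj_eqI) (use assms in simp)
qed

lemma flow_cocycle:
  assumes "0 \<le> s" "0 \<le> t"
  shows "flow a b (t + s) x = flow (\<lambda>t. a (t + s)) (\<lambda>t. b (t + s)) t (flow a b s x)"
proof -
  interpret sh: coop_delay "\<lambda>t. a (t + s)" "\<lambda>t. b (t + s)" by (rule coop_delay_shift)
  show ?thesis
  proof (rule bcontfun_eqI)
    fix \<tau>
    show "apply_bcontfun (flow a b (t + s) x) \<tau> =
        apply_bcontfun (flow (\<lambda>t. a (t + s)) (\<lambda>t. b (t + s)) t (flow a b s x)) \<tau>"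
      using assms lag_time_bounds[of \<tau>] by (simp add: flow_apply sh.flow_apply traj_shift add_ac)
  qed
qed

end

section \<open>Growth estimates from above and from below\<close>

lemma integral_exp_primitive:
  fixes g :: "real \<Rightarrow> real"
  assumes "continuous_on {t0..q} g" "t0 \<le> q"
  shows "((\<lambda>s. g s * m * exp (integral {t0..s} g)) has_integral
     m * exp (integral {t0..q} g) - m) {t0..q}"
proof -
  have "((\<lambda>s. g s * m * exp (integral {t0..s} g)) has_integral
     m * exp (integral {t0..q} g) - m * exp (integral {t0..t0} g)) {t0..q}"
  proof (rule fundamental_theorem_of_calculus[OF assms(2)])
    fix s assume "s \<in> {t0..q}"
    with assms have "((\<lambda>s. integral {t0..s} g) has_real_derivative g s) (at s within {t0..q})"
      unfolding has_real_derivative_iff_has_vector_derivative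
      by (intro integral_has_vector_derivative)
    then show "((\<lambda>s. m * exp (integral {t0..s} g)) has_vector_derivative
        g s * m * exp (integral {t0..s} g)) (at s within {t0..q})"
      unfolding has_real_derivative_iff_has_vector_derivative[symmetric]
      by (auto intro!: derivative_eq_intros)
  qed
  then show ?thesis by simp
qed

text \<open>A Gronwall inequality in which the integrand is only controlled through the running
  maximum of \<open>f\<close>; this form absorbs delayed terms.\<close>

lemma gronwall_max:
  fixes f F g :: "real \<Rightarrow> real"
  assumes f: "continuous_on {t0..T} f" and F: "continuous_on {t0..T} F"
    and g: "continuous_on {t0..T} g" and c: "0 \<le> c"
    and fF: "\<And>t. t \<in> {t0..T} \<Longrightarrow> f t \<le> c + integral {t0..t} F"
    and Fg: "\<And>m s. s \<in> {t0..T} \<Longrightarrow> c < m \<Longrightarrow>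
      (\<And>r. r \<in> {t0..T} \<Longrightarrow> f r \<le> m * exp (integral {t0..r} g)) \<Longrightarrow>
      F s \<le> g s * m * exp (integral {t0..s} g)"
    and t: "t \<in> {t0..T}"
  shows "f t \<le> c * exp (integral {t0..t} g)"
proof -
  let ?G = "\<lambda>r. integral {t0..r} g"
  have Gc: "continuous_on {t0..T} ?G"
    by (intro indefinite_integral_continuous_1 integrable_continuous_real g)
  have "continuous_on {t0..T} (\<lambda>r. f r * exp (- ?G r))"
    by (intro continuous_intros f Gc)
  then have "\<exists>q\<in>{t0..T}. \<forall>r\<in>{t0..T}. f r * exp (- ?G r) \<le> f q * exp (- ?G q)"
    by (intro continuous_attains_sup) (use t in auto)
  then obtain q where q: "q \<in> {t0..T}"
    and max: "\<And>r. r \<in> {t0..T} \<Longrightarrow> f r * exp (- ?G r) \<le> f q * exp (- ?G q)"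
    by blast
  \<comment> \<open>If this maximum of the weighted function exceeded \<open>c\<close>, the integral
    inequality at its location \<open>q\<close> would give
    \<open>f q \<le> c + m * exp (?G q) - m\<close>, which is less than
    \<open>m * exp (?G q) = f q\<close>.\<close>
  define m where "m = f q * exp (- ?G q)"
  have le: "f r \<le> m * exp (?G r)" if "r \<in> {t0..T}" for r
    using max[OF that] by (simp add: m_def exp_minus field_simps)
  have "m \<le> c"
  proof (rule ccontr)
    assume "\<not> m \<le> c"
    then have m: "c < m" by simp
    have "f q \<le> c + integral {t0..q} F" by (rule fF[OF q])
    also have "integral {t0..q} F \<le> m * exp (?G q) - m"
    proof (rule has_integral_le)
      show "(F has_integral integral {t0..q} F) {t0..q}"
        by (intro integrable_integral integrable_continuous_real continuous_on_subset[OF F]) (use q in auto)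
      show "((\<lambda>s. g s * m * exp (?G s)) has_integral m * exp (?G q) - m) {t0..q}"
        by (intro integral_exp_primitive continuous_on_subset[OF g]) (use q in auto)
      show "F s \<le> g s * m * exp (?G s)" if "s \<in> {t0..q}" for s
        by (rule Fg) (use that q m le in auto)
    qed
    finally have "f q < m * exp (?G q)" using m by simp
    moreover have "f q = m * exp (?G q)" by (simp add: m_def exp_minus field_simps)
    ultimately show False by simp
  qed
  have "f t \<le> m * exp (?G t)" by (rule le[OF t])
  also have "\<dots> \<le> c * exp (?G t)" using \<open>m \<le> c\<close> by simp
  finally show ?thesis .
qed

text \<open>Growth rate of the component sum of a nonnegative solution. Negative diagonal entries of
  \<open>A\<close> are cut off, which leaves a quantity that (OA2) makes integrable.\<close>

definition up_rate :: "real ^ 'n::finite ^ 'n \<Rightarrow> real ^ 'n ^ 'n \<Rightarrow> real" where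
  "up_rate A B = (\<Sum>i\<in>UNIV. \<Sum>j\<in>UNIV. max 0 (A $ i $ j)) + (\<Sum>i\<in>UNIV. \<Sum>j\<in>UNIV. B $ i $ j)"

text \<open>Serves the estimates from below, where strongly negative diagonal entries count; it
  enters only through integrals over bounded time intervals, finite for every \<omega>.\<close>

definition abs_rate :: "real ^ 'n::finite ^ 'n \<Rightarrow> real ^ 'n ^ 'n \<Rightarrow> real" where
  "abs_rate A B = absum A + absum B"

definition path_condition :: "real \<Rightarrow> (real \<Rightarrow> real ^ 'n::finite ^ 'n) \<Rightarrow> bool" where
  "path_condition \<delta> b \<longleftrightarrow> (\<forall>i. \<exists>j::nat \<Rightarrow> 'n. j 0 = i \<and> j ` {0..CARD('n) - 1} = UNIV \<and>
     (\<forall>t\<in>{0..real CARD('n) + 2}. \<forall>l\<in>{0..CARD('n) - 2}. \<delta> \<le> b t $ j (l + 1) $ j l))"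

text \<open>Quotient of the two bounds in \<open>focusing\<close>: \<open>\<Phi> * exp h\<close>
  from above and \<open>exp (- h) * (\<Phi> / N) * p ^ N\<close> from below, where
  \<open>p = min 1 (exp (- h) * \<delta> / N)\<close>.\<close>

definition focus_const :: "nat \<Rightarrow> real \<Rightarrow> real \<Rightarrow> real" where
  "focus_const N h \<delta> = exp (2 * h) * N * (max 1 (N * exp h / \<delta>)) ^ N"

lemma up_rate_le_abs_rate: "up_rate A B \<le> abs_rate A B"
  unfolding up_rate_def abs_rate_def absum_def by (intro add_mono sum_mono) auto

lemma abs_rate_nonneg: "0 \<le> abs_rate A B"
  by (simp add: abs_rate_def absum_nonneg)

context coop_delay begin

lemma continuous_up_rate: "continuous_on S (\<lambda>t. up_rate (a t) (b t))"
  unfolding up_rate_def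
  by (intro continuous_intros continuous_on_subset[OF cont_a] continuous_on_subset[OF cont_b]) auto

lemma continuous_abs_rate: "continuous_on S (\<lambda>t. abs_rate (a t) (b t))"
  unfolding abs_rate_def
  by (intro continuous_intros continuous_on_absum continuous_on_subset[OF cont_a] continuous_on_subset[OF cont_b]) auto

lemma up_rate_nonneg: "0 \<le> up_rate (a t) (b t)"
  unfolding up_rate_def by (intro add_nonneg_nonneg sum_nonneg b_nonneg) auto

lemma traj_nonneg: "0 \<preceq> x \<Longrightarrow> -1 \<le> t \<Longrightarrow> 0 \<le> traj a b x t $ i"
  by (rule delay_sol_nonneg[OF traj_sol])

lemma continuous_traj_component: "-1 \<le> s \<Longrightarrow> continuous_on {s..t} (\<lambda>t. traj a b x t $ i)"
  by (intro continuous_intros continuous_on_subset[OF continuous_traj]) auto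

lemma continuous_traj_component_delayed: "0 \<le> s \<Longrightarrow> continuous_on {s..t} (\<lambda>t. traj a b x (t - 1) $ i)"
  by (rule continuous_on_compose2[OF continuous_traj_component[of "-1" "t - 1"]])
     (auto intro!: continuous_intros)

lemmas continuous_parts = continuous_on_subset[OF cont_a] continuous_on_subset[OF cont_b]
  continuous_traj_component continuous_traj_component_delayed

lemma traj_sum_derivative:
  assumes "0 \<le> t"
  shows "((\<lambda>t. \<Sum>i\<in>UNIV. traj a b x t $ i) has_real_derivative
     (\<Sum>i\<in>UNIV. \<Sum>j\<in>UNIV. a t $ i $ j * traj a b x t $ j) +
     (\<Sum>i\<in>UNIV. \<Sum>j\<in>UNIV. b t $ i $ j * traj a b x (t - 1) $ j)) (at t within {0..})"
  unfolding sum.distrib[symmetric, of "\<lambda>i. \<Sum>j\<in>UNIV. a t $ i $ j * traj a b x t $ j"]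
  by (intro DERIV_sum delay_sol_component[OF traj_sol assms])

lemma traj_sum_integral:
  assumes "0 \<le> s" "s \<le> t"
  shows "((\<lambda>r. (\<Sum>i\<in>UNIV. \<Sum>j\<in>UNIV. a r $ i $ j * traj a b x r $ j) +
     (\<Sum>i\<in>UNIV. \<Sum>j\<in>UNIV. b r $ i $ j * traj a b x (r - 1) $ j)) has_integral
     (\<Sum>i\<in>UNIV. traj a b x t $ i) - (\<Sum>i\<in>UNIV. traj a b x s $ i)) {s..t}"
  by (rule fundamental_theorem_of_calculus[OF assms(2)])
     (use assms in \<open>auto simp flip: has_real_derivative_iff_has_vector_derivative
        intro!: DERIV_subset[OF traj_sum_derivative]\<close>)

lemma traj_component_le_sum:
  "0 \<preceq> x \<Longrightarrow> -1 \<le> t \<Longrightarrow> traj a b x t $ i \<le> (\<Sum>i\<in>UNIV. traj a b x t $ i)"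
  by (rule member_le_sum) (auto intro: traj_nonneg)

lemma a_part_le:
  assumes "\<And>j. 0 \<le> v $ j" "\<And>j. v $ j \<le> m"
  shows "(\<Sum>i\<in>UNIV. \<Sum>j\<in>UNIV. a t $ i $ j * v $ j) \<le> (\<Sum>i\<in>UNIV. \<Sum>j\<in>UNIV. max 0 (a t $ i $ j)) * m"
  unfolding sum_distrib_right
proof (intro sum_mono)
  fix i j
  have "a t $ i $ j * v $ j \<le> max 0 (a t $ i $ j) * v $ j" using assms by (intro mult_right_mono) auto
  also have "\<dots> \<le> max 0 (a t $ i $ j) * m" using assms by (intro mult_left_mono) auto
  finally show "a t $ i $ j * v $ j \<le> max 0 (a t $ i $ j) * m" .
qed

lemma b_part_le:
  assumes "\<And>j. v $ j \<le> m"
  shows "(\<Sum>i\<in>UNIV. \<Sum>j\<in>UNIV. b t $ i $ j * v $ j) \<le> (\<Sum>i\<in>UNIV. \<Sum>j\<in>UNIV. b t $ i $ j) * m"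
  unfolding sum_distrib_right by (intro sum_mono mult_left_mono assms b_nonneg)

text \<open>Each component is at most the sum because the solution is nonnegative, and the
  increasing weight at time \<open>s\<close> dominates the delayed values, including those before
  \<open>t0\<close>, which \<open>M\<close> bounds. So \<open>gronwall_max\<close> applies with the
  rate \<open>up_rate\<close>.\<close>

lemma traj_sum_upper:
  assumes x: "0 \<preceq> x" and t0: "0 \<le> t0" "t0 \<le> t"
    and M: "\<And>s. t0 - 1 \<le> s \<Longrightarrow> s \<le> t0 \<Longrightarrow> (\<Sum>i\<in>UNIV. traj a b x s $ i) \<le> M"
  shows "(\<Sum>i\<in>UNIV. traj a b x t $ i) \<le> M * exp (integral {t0..t} (\<lambda>s. up_rate (a s) (b s)))"
proof (rule gronwall_max[where T = t and F = "\<lambda>r. (\<Sum>i\<in>UNIV. \<Sum>j\<in>UNIV. a r $ i $ j * traj a b x r $ j) +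
     (\<Sum>i\<in>UNIV. \<Sum>j\<in>UNIV. b r $ i $ j * traj a b x (r - 1) $ j)"])
  let ?S = "\<lambda>s. \<Sum>i\<in>UNIV. traj a b x s $ i" and ?g = "\<lambda>s. up_rate (a s) (b s)"
  let ?F = "\<lambda>r. (\<Sum>i\<in>UNIV. \<Sum>j\<in>UNIV. a r $ i $ j * traj a b x r $ j) +
     (\<Sum>i\<in>UNIV. \<Sum>j\<in>UNIV. b r $ i $ j * traj a b x (r - 1) $ j)"
  have "0 \<le> ?S t0" using t0 by (intro sum_nonneg traj_nonneg x) auto
  then show M0: "0 \<le> M" using M[of t0] by simp
  show "continuous_on {t0..t} ?S" "continuous_on {t0..t} ?F"
    by (intro continuous_intros continuous_parts; use t0 in auto)+
  show "continuous_on {t0..t} ?g" by (rule continuous_up_rate)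
  show "?S s \<le> M + integral {t0..s} ?F" if "s \<in> {t0..t}" for s
    using integral_unique[OF traj_sum_integral[of t0 s x]] that M[of t0] t0 by simp
  fix m s assume s: "s \<in> {t0..t}" and m: "M < m"
    and le: "\<And>r. r \<in> {t0..t} \<Longrightarrow> ?S r \<le> m * exp (integral {t0..r} ?g)"
  let ?m = "m * exp (integral {t0..s} ?g)"
  have mono: "integral {t0..r} ?g \<le> integral {t0..s} ?g" if "r \<in> {t0..s}" for r
    using that
    by (intro integral_subset_le integrable_continuous_real continuous_up_rate) (auto simp: up_rate_nonneg)
  have S: "?S r \<le> ?m" if "t0 - 1 \<le> r" "r \<le> s" for r
  proof (cases "t0 \<le> r")
    case True
    then have "?S r \<le> m * exp (integral {t0..r} ?g)" using that s by (intro le) auto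
    also have "\<dots> \<le> ?m" using mono[of r] True that m M0 by (intro mult_left_mono) auto
    finally show ?thesis .
  next
    case False
    then have "?S r \<le> m * 1" using M[of r] that m by auto
    also have "\<dots> \<le> ?m" using mono[of t0] s m M0 by (intro mult_left_mono) auto
    finally show ?thesis .
  qed
  have comp: "traj a b x r $ j \<le> ?m" if "t0 - 1 \<le> r" "r \<le> s" for r j
    using traj_component_le_sum[OF x, of r j] S[OF that] that t0 by auto
  have "?F s \<le> (\<Sum>i\<in>UNIV. \<Sum>j\<in>UNIV. max 0 (a s $ i $ j)) * ?m + (\<Sum>i\<in>UNIV. \<Sum>j\<in>UNIV. b s $ i $ j) * ?m"
    using s t0 by (intro add_mono a_part_le b_part_le traj_nonneg[OF x] comp) auto
  also have "\<dots> = ?g s * m * exp (integral {t0..s} ?g)"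
    by (simp add: up_rate_def algebra_simps)
  finally show "?F s \<le> ?g s * m * exp (integral {t0..s} ?g)" .
qed (use t0 in auto)

text \<open>Multiplying by \<open>exp (- \<integral> c)\<close> with \<open>c \<le> a\<^sub>i\<^sub>i\<close> leaves only nonnegative terms in the derivative
  of the \<open>i\<close>-th component.\<close>

lemma traj_weighted_lower:
  assumes x: "0 \<preceq> x" and st: "0 \<le> s" "s \<le> t"
    and c: "continuous_on UNIV c" "\<And>r. r \<in> {0..t} \<Longrightarrow> c r \<le> a r $ i $ i"
  defines "W \<equiv> \<lambda>r. exp (- integral {0..r} c)"
  shows "W s * traj a b x s $ i + integral {s..t} (\<lambda>r. W r * (\<Sum>j\<in>UNIV. b r $ i $ j * traj a b x (r - 1) $ j))
     \<le> W t * traj a b x t $ i"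
proof -
  let ?u = "traj a b x"
  let ?B = "\<lambda>r. \<Sum>j\<in>UNIV. b r $ i $ j * ?u (r - 1) $ j"
  let ?D = "\<lambda>r. (\<Sum>j\<in>UNIV. a r $ i $ j * ?u r $ j) + ?B r"
  let ?E = "\<lambda>r. W r * ?D r - c r * W r * ?u r $ i"
  have ic: "continuous_on {s..t} (\<lambda>r. integral {0..r} c)"
    by (rule continuous_on_subset[OF continuous_on_integral_upper[OF c(1)]]) auto
  have Wc: "continuous_on {s..t} W" unfolding W_def by (intro continuous_intros ic)
  have E: "(?E has_integral W t * ?u t $ i - W s * ?u s $ i) {s..t}"
  proof (rule fundamental_theorem_of_calculus[OF st(2)])
    fix r assume r: "r \<in> {s..t}"
    then have r0: "0 \<le> r" using st by auto
    have "((\<lambda>r. integral {0..r} c) has_real_derivative c r) (at r within {0..})"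
      unfolding has_real_derivative_iff_has_vector_derivative
      by (rule has_vector_derivative_integral_upper[OF c(1) r0])
    then have "((\<lambda>r. W r * ?u r $ i) has_real_derivative ?E r) (at r within {0..})"
      unfolding W_def
      by (auto intro!: derivative_eq_intros delay_sol_component[OF traj_sol] r0 simp: algebra_simps)
    then show "((\<lambda>r. W r * ?u r $ i) has_vector_derivative ?E r) (at r within {s..t})"
      unfolding has_real_derivative_iff_has_vector_derivative
      by (rule has_vector_derivative_within_subset) (use st in auto)
  qed
  have "integral {s..t} (\<lambda>r. W r * ?B r) \<le> W t * ?u t $ i - W s * ?u s $ i"
  proof (rule has_integral_le[OF integrable_integral E])
    show "(\<lambda>r. W r * ?B r) integrable_on {s..t}"
      by (intro integrable_continuous_real continuous_intros Wc continuous_parts) (use st in auto)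
    fix r assume r: "r \<in> {s..t}"
    have "c r * ?u r $ i \<le> a r $ i $ i * ?u r $ i"
      using r st by (intro mult_right_mono c traj_nonneg x) auto
    also have "\<dots> \<le> (\<Sum>j\<in>UNIV. a r $ i $ j * ?u r $ j)"
    proof -
      have "0 \<le> (\<Sum>j\<in>UNIV - {i}. a r $ i $ j * ?u r $ j)"
        using r st by (intro sum_nonneg mult_nonneg_nonneg a_offdiag traj_nonneg x) auto
      then show ?thesis by (subst sum.remove[of _ i]) auto
    qed
    finally have "W r * (c r * ?u r $ i) \<le> W r * (\<Sum>j\<in>UNIV. a r $ i $ j * ?u r $ j)"
      by (intro mult_left_mono) (auto simp: W_def)
    then show "W r * ?B r \<le> ?E r" by (simp add: algebra_simps)
  qed
  then show ?thesis by simp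
qed

lemma traj_lower:
  assumes x: "0 \<preceq> x" and st: "0 \<le> s" "s \<le> t" "t \<le> T"
  shows "traj a b x s $ i + integral {s..t} (\<lambda>r. \<Sum>j\<in>UNIV. b r $ i $ j * traj a b x (r - 1) $ j)
     \<le> exp (integral {0..T} (\<lambda>r. abs_rate (a r) (b r))) * traj a b x t $ i"
proof -
  let ?u = "traj a b x" and ?g = "\<lambda>r. abs_rate (a r) (b r)"
  let ?B = "\<lambda>r. \<Sum>j\<in>UNIV. b r $ i $ j * ?u (r - 1) $ j"
  define W where "W r = exp (- integral {0..r} (\<lambda>r. - ?g r))" for r
  have W_eq: "W r = exp (integral {0..r} ?g)" for r by (simp add: W_def)
  have ii: "?g integrable_on {0..r}" for r
    by (intro integrable_continuous_real continuous_abs_rate)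
  have W1: "1 \<le> W r" if "0 \<le> r" for r
    unfolding W_eq by (simp add: integral_nonneg ii abs_rate_nonneg)
  have Wc: "continuous_on {s..t} W"
    unfolding W_eq
    by (intro continuous_intros continuous_on_subset[OF continuous_on_integral_upper] continuous_abs_rate) auto
  have B0: "0 \<le> ?B r" if "0 \<le> r" for r
    using that by (intro sum_nonneg mult_nonneg_nonneg b_nonneg traj_nonneg x) auto
  have "?u s $ i + integral {s..t} ?B \<le> W s * ?u s $ i + integral {s..t} (\<lambda>r. W r * ?B r)"
  proof (rule add_mono)
    show "?u s $ i \<le> W s * ?u s $ i"
      using W1[OF st(1)] traj_nonneg[OF x, of s i] st mult_right_mono[of 1 "W s"] by auto
    show "integral {s..t} ?B \<le> integral {s..t} (\<lambda>r. W r * ?B r)"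
    proof (rule integral_le)
      show "?B integrable_on {s..t}"
        by (intro integrable_continuous_real continuous_intros continuous_parts) (use st in auto)
      show "(\<lambda>r. W r * ?B r) integrable_on {s..t}"
        by (intro integrable_continuous_real continuous_intros Wc continuous_parts) (use st in auto)
      show "?B r \<le> W r * ?B r" if "r \<in> {s..t}" for r
        using that st W1[of r] B0[of r] mult_right_mono[of 1 "W r" "?B r"] by auto
    qed
  qed
  also have "\<dots> \<le> W t * ?u t $ i"
    unfolding W_def
  proof (rule traj_weighted_lower[OF x st(1,2)])
    show "continuous_on UNIV (\<lambda>r. - ?g r)" by (intro continuous_intros continuous_abs_rate)
    fix r
    have "- a r $ i $ i \<le> \<bar>a r $ i $ i\<bar>" by simp
    also have "\<dots> \<le> (\<Sum>j\<in>UNIV. \<bar>a r $ i $ j\<bar>)" by (rule member_le_sum) auto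
    also have "\<dots> \<le> absum (a r)" unfolding absum_def by (rule member_le_sum) (auto intro: sum_nonneg)
    also have "\<dots> \<le> ?g r" by (simp add: abs_rate_def absum_nonneg)
    finally show "- ?g r \<le> a r $ i $ i" by simp
  qed
  also have "\<dots> \<le> exp (integral {0..T} ?g) * ?u t $ i"
  proof (rule mult_right_mono)
    show "W t \<le> exp (integral {0..T} ?g)"
      unfolding W_eq exp_le_cancel_iff
      by (rule integral_subset_le) (use st ii abs_rate_nonneg in auto)
    show "0 \<le> ?u t $ i" using st by (intro traj_nonneg x) auto
  qed
  finally show ?thesis .
qed

text \<open>Keeps \<open>one_phase\<close> in the interior of the cone. The constant
  \<open>exp (- ?H)\<close> also serves the part of the segment still inside the initial interval,
  because \<open>?H\<close> is nonnegative.\<close>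

lemma flow_one_ge:
  assumes "0 \<le> t"
  obtains \<alpha> where "0 < \<alpha>" "\<alpha> *\<^sub>R one_phase \<preceq> flow a b t one_phase"
proof
  let ?H = "integral {0..t} (\<lambda>r. abs_rate (a r) (b r))"
  have one: "0 \<preceq> (one_phase :: 'n phase)" by (simp add: phase_le_def)
  have H: "0 \<le> ?H"
    by (intro integral_nonneg integrable_continuous_real continuous_abs_rate abs_rate_nonneg)
  show "exp (- ?H) *\<^sub>R one_phase \<preceq> flow a b t one_phase"
    unfolding phase_le_def
  proof (intro allI)
    fix \<tau> i
    have "exp (- ?H) \<le> traj a b one_phase (t + lag_time \<tau>) $ i"
    proof (cases "t + lag_time \<tau> \<le> 0")
      case True
      then obtain \<sigma> where \<sigma>: "t + lag_time \<tau> = lag_time \<sigma>"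
        using lag_timeE lag_shift_ge[OF assms, of \<tau>] by metis
      show ?thesis unfolding \<sigma> traj_lag using H by simp
    next
      case False
      let ?r = "t + lag_time \<tau>"
      have "1 = traj a b one_phase 0 $ i"
        using lag_timeE[of 0] traj_lag by (metis atLeastAtMost_iff lag_time_bounds neg_le_0_iff_le one_phase_apply order_refl zero_le_one)
      also have "\<dots> \<le> traj a b one_phase 0 $ i +
          integral {0..?r} (\<lambda>r. \<Sum>j\<in>UNIV. b r $ i $ j * traj a b one_phase (r - 1) $ j)"
        by (simp, intro integral_nonneg integrable_continuous_real continuous_intros continuous_parts
            sum_nonneg mult_nonneg_nonneg b_nonneg traj_nonneg one) auto
      also have "\<dots> \<le> exp ?H * traj a b one_phase ?r $ i"
        by (rule traj_lower[OF one]) (use False lag_time_bounds[of \<tau>] in auto)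
      finally show ?thesis by (simp add: exp_minus field_simps)
    qed
    then show "apply_bcontfun (exp (- ?H) *\<^sub>R one_phase) \<tau> $ i \<le> apply_bcontfun (flow a b t one_phase) \<tau> $ i"
      using assms by (simp add: flow_apply)
  qed
qed simp

section \<open>Focusing over the time N + 2\<close>

text \<open>Both bounds are multiples of \<open>\<Phi>\<close>: Gronwall gives the upper one, and a
  summand of size at least \<open>\<Phi> / N\<close> starts the path that carries the lower one to
  all components.\<close>

lemma focusing:
  assumes x: "0 \<preceq> x" and \<delta>: "0 < \<delta>" and path: "path_condition \<delta> b" and N2: "CARD('n) \<ge> 2"
  defines "T \<equiv> real CARD('n) + 2"
  defines "\<kappa> \<equiv> focus_const CARD('n) (integral {0..T} (\<lambda>r. abs_rate (a r) (b r))) \<delta>"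
  obtains \<alpha> where "0 \<le> \<alpha>" "\<alpha> *\<^sub>R one_phase \<preceq> flow a b T x" "flow a b T x \<preceq> (\<kappa> * \<alpha>) *\<^sub>R one_phase"
proof -
  let ?u = "traj a b x" and ?N = "CARD('n)"
  let ?g = "\<lambda>r. up_rate (a r) (b r)"
  define H where "H = integral {0..T} (\<lambda>r. abs_rate (a r) (b r))"
  define B where "B i r = (\<Sum>j\<in>UNIV. b r $ i $ j * ?u (r - 1) $ j)" for i r
  \<comment> \<open>For \<open>r\<close> in \<open>[0,1]\<close> the time \<open>r - 1\<close> lies
    in the initial interval, so \<open>\<phi> i\<close> depends on the initial function
    alone.\<close>
  define \<phi> where "\<phi> i = ?u 0 $ i + integral {0..1} (B i)" for i
  have Bc: "continuous_on {s..t} (B i)" if "0 \<le> s" for s t i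
    unfolding B_def by (intro continuous_intros continuous_parts) (use that in auto)
  have Bi: "B i integrable_on {s..t}" if "0 \<le> s" for s t i
    by (intro integrable_continuous_real Bc that)
  have B0: "0 \<le> B i r" if "0 \<le> r" for i r
    unfolding B_def using that by (intro sum_nonneg mult_nonneg_nonneg b_nonneg traj_nonneg x) auto
  have \<phi>0: "0 \<le> \<phi> i" for i
    unfolding \<phi>_def by (intro add_nonneg_nonneg traj_nonneg x integral_nonneg Bi B0) auto
  have T: "T \<ge> 4" using N2 by (simp add: T_def)
  have H0: "0 \<le> H"
    unfolding H_def by (intro integral_nonneg integrable_continuous_real continuous_abs_rate abs_rate_nonneg)
  have gi: "?g integrable_on {s..t}" for s t by (intro integrable_continuous_real continuous_up_rate)
  have gH: "integral {0..t} ?g \<le> H" if "t \<le> T" for t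
  proof -
    have "integral {0..t} ?g \<le> integral {0..T} ?g"
      by (rule integral_subset_le) (use that gi up_rate_nonneg in auto)
    also have "\<dots> \<le> H" unfolding H_def
      by (intro integral_le gi integrable_continuous_real continuous_abs_rate up_rate_le_abs_rate)
    finally show ?thesis .
  qed
  define \<Phi> where "\<Phi> = (\<Sum>i\<in>UNIV. \<phi> i)"
  have \<Phi>0: "0 \<le> \<Phi>" unfolding \<Phi>_def by (intro sum_nonneg \<phi>0)
  \<comment> \<open>On \<open>[0,1]\<close> the delayed inflow is already counted in
    \<open>\<Phi>\<close>, so only the part with \<open>a\<close> remains under the
    integral.\<close>
  have up1: "(\<Sum>i\<in>UNIV. ?u t $ i) \<le> \<Phi> * exp (integral {0..t} ?g)" if t: "t \<in> {0..1}" for t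
  proof (rule gronwall_max[OF _ _ _ \<Phi>0 _ _ t, where F = "\<lambda>r. \<Sum>i\<in>UNIV. \<Sum>j\<in>UNIV. a r $ i $ j * ?u r $ j"])
    let ?F = "\<lambda>r. \<Sum>i\<in>UNIV. \<Sum>j\<in>UNIV. a r $ i $ j * ?u r $ j"
    show "continuous_on {0..1} (\<lambda>s. \<Sum>i\<in>UNIV. ?u s $ i)"
      by (intro continuous_intros continuous_parts) auto
    have Fc: "continuous_on {0..s} ?F" for s
      by (intro continuous_intros continuous_parts) auto
    then show "continuous_on {0..1} ?F" .
    show "continuous_on {0..1} ?g" by (rule continuous_up_rate)
    fix s :: real assume s: "s \<in> {0..1}"
    have "(\<Sum>i\<in>UNIV. ?u s $ i) = (\<Sum>i\<in>UNIV. ?u 0 $ i) + integral {0..s} (\<lambda>r. ?F r + (\<Sum>i\<in>UNIV. B i r))"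
      using integral_unique[OF traj_sum_integral[of 0 s x]] s by (simp add: B_def)
    also have "integral {0..s} (\<lambda>r. ?F r + (\<Sum>i\<in>UNIV. B i r)) =
        integral {0..s} ?F + (\<Sum>i\<in>UNIV. integral {0..s} (B i))"
      by (subst integral_add) (auto intro!: integrable_continuous_real[OF Fc] integrable_continuous_real continuous_on_sum Bc integral_sum Bi)
    also have "(\<Sum>i\<in>UNIV. integral {0..s} (B i)) \<le> (\<Sum>i\<in>UNIV. integral {0..1} (B i))"
      using s by (intro sum_mono integral_subset_le Bi) (auto intro: B0)
    finally show "(\<Sum>i\<in>UNIV. ?u s $ i) \<le> \<Phi> + integral {0..s} ?F"
      by (simp add: \<Phi>_def \<phi>_def sum.distrib)
  next
    fix m s :: real assume s: "s \<in> {0..1}"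
      and le: "\<And>r. r \<in> {0..1} \<Longrightarrow> (\<Sum>i\<in>UNIV. ?u r $ i) \<le> m * exp (integral {0..r} ?g)" and m: "\<Phi> < m"
    let ?m = "m * exp (integral {0..s} ?g)"
    have "(\<Sum>i\<in>UNIV. \<Sum>j\<in>UNIV. a s $ i $ j * ?u s $ j) \<le> (\<Sum>i\<in>UNIV. \<Sum>j\<in>UNIV. max 0 (a s $ i $ j)) * ?m"
      using s le[OF s] traj_component_le_sum[OF x, of s]
      by (intro a_part_le traj_nonneg x) (auto intro: order_trans)
    also have "\<dots> \<le> ?g s * ?m"
      unfolding up_rate_def using m \<Phi>0 by (intro mult_right_mono) (auto intro!: sum_nonneg b_nonneg)
    finally show "(\<Sum>i\<in>UNIV. \<Sum>j\<in>UNIV. a s $ i $ j * ?u s $ j) \<le> ?g s * m * exp (integral {0..s} ?g)"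
      by (simp add: mult_ac)
  qed
  have up: "?u t $ i \<le> \<Phi> * exp H" if t: "1 \<le> t" "t \<le> T" for t i
  proof -
    have "?u t $ i \<le> (\<Sum>i\<in>UNIV. ?u t $ i)" using t by (intro traj_component_le_sum x) auto
    also have "\<dots> \<le> \<Phi> * exp (integral {0..1} ?g) * exp (integral {1..t} ?g)"
    proof (rule traj_sum_upper[OF x])
      fix s :: real assume "1 - 1 \<le> s" "s \<le> 1"
      then have s: "s \<in> {0..1}" by auto
      have "(\<Sum>i\<in>UNIV. ?u s $ i) \<le> \<Phi> * exp (integral {0..s} ?g)" by (rule up1[OF s])
      also have "\<dots> \<le> \<Phi> * exp (integral {0..1} ?g)"
        using s by (intro mult_left_mono \<Phi>0) (auto intro!: integral_subset_le gi up_rate_nonneg)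
      finally show "(\<Sum>i\<in>UNIV. ?u s $ i) \<le> \<Phi> * exp (integral {0..1} ?g)" .
    qed (use t in auto)
    also have eq: "\<Phi> * exp (integral {0..1} ?g) * exp (integral {1..t} ?g) = \<Phi> * exp (integral {0..t} ?g)"
    proof -
      have "integral {0..1} ?g + integral {1..t} ?g = integral {0..t} ?g"
        by (rule Henstock_Kurzweil_Integration.integral_combine) (use t gi in auto)
      then have "exp (integral {0..1} ?g) * exp (integral {1..t} ?g) = exp (integral {0..t} ?g)"
        by (simp only: exp_add[symmetric])
      then show ?thesis by (simp only: mult.assoc)
    qed
    also have "\<Phi> * exp (integral {0..t} ?g) \<le> \<Phi> * exp H"
      by (rule mult_left_mono[OF _ \<Phi>0]) (simp only: exp_le_cancel_iff gH[OF t(2)])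
    finally show ?thesis .
  qed
  have low: "?u s $ i + integral {s..t} (B i) \<le> exp H * ?u t $ i" if "0 \<le> s" "s \<le> t" "t \<le> T" for s t i
    using traj_lower[OF x that] unfolding B_def H_def .
  have low': "exp (- H) * (?u s $ i + integral {s..t} (B i)) \<le> ?u t $ i" if "0 \<le> s" "s \<le> t" "t \<le> T" for s t i
    using low[OF that] by (simp add: exp_minus field_simps)
  obtain i where i: "\<Phi> / ?N \<le> \<phi> i"
  proof (rule exE)
    show "\<exists>i. \<Phi> / ?N \<le> \<phi> i"
    proof (rule ccontr)
      assume "\<not> (\<exists>i. \<Phi> / ?N \<le> \<phi> i)"
      then have "(\<Sum>i\<in>UNIV. \<phi> i) < (\<Sum>i\<in>(UNIV :: 'n set). \<Phi> / ?N)"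
        by (intro sum_strict_mono) (auto simp: not_le)
      then show False by (simp add: \<Phi>_def)
    qed
  qed
  obtain j :: "nat \<Rightarrow> 'n" where j: "j 0 = i" "j ` {0..?N - 1} = UNIV"
    "\<And>t l. t \<in> {0..T} \<Longrightarrow> l \<in> {0..?N - 2} \<Longrightarrow> \<delta> \<le> b t $ j (l + 1) $ j l"
  proof -
    obtain j :: "nat \<Rightarrow> 'n" where "j 0 = i \<and> j ` {0..?N - 1} = UNIV \<and>
     (\<forall>t\<in>{0..real ?N + 2}. \<forall>l\<in>{0..?N - 2}. \<delta> \<le> b t $ j (l + 1) $ j l)"
      using path unfolding path_condition_def by metis
    then show thesis by (intro that[of j]) (simp_all add: T_def)
  qed
  \<comment> \<open>Each path step needs the delay \<open>1\<close> and a window of length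
    \<open>\<eta>\<close> in which inflow accumulates. With \<open>\<eta> = 1 / N\<close> the
    \<open>N - 1\<close> steps end by time \<open>1 + (N - 1) * (1 + 1 / N)\<close>, which is at
    most \<open>N + 1 = T - 1\<close>, in time for the whole last segment.\<close>
  define \<eta> where "\<eta> = 1 / real ?N"
  have \<eta>: "0 < \<eta>" by (simp add: \<eta>_def)
  define q where "q = exp (- H) * \<delta> * \<eta>"
  have q: "0 < q" using \<delta> \<eta> by (simp add: q_def)
  define c where "c = exp (- H) * (\<Phi> / ?N)"
  have c: "0 \<le> c" using \<Phi>0 by (simp add: c_def)
  \<comment> \<open>The base case waits for the unit interval in which \<open>\<phi> i\<close> is
    collected. The bound persists up to \<open>T\<close>, so the inflow into the next component can
    be integrated over \<open>[t - \<eta>, t]\<close>.\<close>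
  have chain: "c * q ^ l \<le> ?u t $ j l" if "l \<le> ?N - 1" "1 + l * (1 + \<eta>) \<le> t" "t \<le> T" for l t
    using that
  proof (induction l arbitrary: t)
    case 0
    have "c \<le> exp (- H) * (?u 0 $ i + integral {0..t} (B i))"
      unfolding c_def
    proof (rule mult_left_mono)
      have "integral {0..1} (B i) \<le> integral {0..t} (B i)"
        using 0 by (intro integral_subset_le Bi) (auto intro: B0)
      then show "\<Phi> / ?N \<le> ?u 0 $ i + integral {0..t} (B i)" using i by (simp add: \<phi>_def)
    qed simp
    also have "\<dots> \<le> ?u t $ i" by (rule low') (use 0 in auto)
    finally show ?case by (simp add: j)
  next
    case (Suc l)
    let ?s = "t - \<eta>"
    have s: "1 + (1 + real l * (1 + \<eta>)) \<le> ?s" using Suc.prems by (simp add: algebra_simps)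
    have l0: "0 \<le> real l * (1 + \<eta>)" using \<eta> by simp
    have "c * q ^ Suc l = exp (- H) * (\<eta> * (\<delta> * (c * q ^ l)))" by (simp add: q_def)
    also have "\<dots> \<le> exp (- H) * (?u ?s $ j (Suc l) + integral {?s..t} (B (j (Suc l))))"
    proof (rule mult_left_mono)
      have "integral {?s..t} (\<lambda>_. \<delta> * (c * q ^ l)) \<le> integral {?s..t} (B (j (Suc l)))"
      proof (rule integral_le)
        show "B (j (Suc l)) integrable_on {?s..t}" using s l0 by (intro Bi) linarith
        fix r assume r: "r \<in> {?s..t}"
        have r1: "0 \<le> r" using r s l0 unfolding atLeastAtMost_iff by linarith
        have "\<delta> * (c * q ^ l) \<le> b r $ j (Suc l) $ j l * ?u (r - 1) $ j l"
        proof (rule mult_mono)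
          show "\<delta> \<le> b r $ j (Suc l) $ j l"
            using j(3)[of r l] r r1 Suc.prems by auto
          show "c * q ^ l \<le> ?u (r - 1) $ j l"
            using s r Suc.prems by (intro Suc.IH) auto
        qed (use b_nonneg c q in auto)
        also have "\<dots> \<le> B (j (Suc l)) r"
          unfolding B_def using r1
          by (intro member_le_sum) (auto intro!: mult_nonneg_nonneg b_nonneg traj_nonneg x)
        finally show "\<delta> * (c * q ^ l) \<le> B (j (Suc l)) r" .
      qed auto
      moreover have "0 \<le> ?u ?s $ j (Suc l)" using s l0 by (intro traj_nonneg x) linarith
      ultimately show "\<eta> * (\<delta> * (c * q ^ l)) \<le> ?u ?s $ j (Suc l) + integral {?s..t} (B (j (Suc l)))"
        using \<eta> by (simp add: mult_ac)
    qed simp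
    also have "\<dots> \<le> ?u t $ j (Suc l)"
      by (rule low') (use s l0 \<eta> Suc.prems(3) in linarith)+
    finally show ?case .
  qed
  \<comment> \<open>The number of steps to a component varies; truncation at \<open>1\<close> makes
    \<open>p ^ N\<close> a lower bound of \<open>q ^ l\<close> for every \<open>l\<close> that
    occurs, whether \<open>q\<close> is small or large.\<close>
  define p where "p = min 1 q"
  have p: "0 < p" "p \<le> 1" "p \<le> q" using q by (auto simp: p_def)
  have all: "c * p ^ ?N \<le> ?u t $ k" if t: "T - 1 \<le> t" "t \<le> T" for t k
  proof -
    have "k \<in> j ` {0..?N - 1}" using j(2) by simp
    then obtain l where l: "l \<le> ?N - 1" "k = j l" by auto
    have "p ^ ?N \<le> p ^ l" using l p by (intro power_decreasing) auto
    also have "\<dots> \<le> q ^ l" using p by (intro power_mono) auto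
    finally have "c * p ^ ?N \<le> c * q ^ l" using c by (rule mult_left_mono)
    also have "\<dots> \<le> ?u t $ j l"
    proof (rule chain[OF l(1)])
      have "real l * (1 + \<eta>) \<le> (real ?N - 1) * (1 + \<eta>)"
        using l(1) \<eta> N2 by (intro mult_right_mono) linarith+
      also have "\<dots> \<le> real ?N" using N2 by (simp add: \<eta>_def field_simps)
      finally show "1 + real l * (1 + \<eta>) \<le> t" using t by (simp add: T_def)
    qed (use t in auto)
    finally show ?thesis using l by simp
  qed
  define \<alpha> where "\<alpha> = c * p ^ ?N"
  have \<kappa>: "\<Phi> * exp H = \<kappa> * \<alpha>"
  proof -
    have "max 1 (?N * exp H / \<delta>) = 1 / p"
      using \<delta> by (auto simp: p_def q_def \<eta>_def exp_minus max_def min_def field_simps)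
    then have "\<kappa> = exp (2 * H) * ?N * (1 / p) ^ ?N" by (simp add: \<kappa>_def focus_const_def H_def)
    then show ?thesis using p
      by (simp add: \<alpha>_def c_def power_one_over exp_minus field_simps flip: exp_add)
  qed
  have Tl: "T + lag_time \<tau> \<le> T" "T - 1 \<le> T + lag_time \<tau>" for \<tau> using lag_time_bounds[of \<tau>] by auto
  show thesis
  proof (rule that[of \<alpha>])
    show "0 \<le> \<alpha>" using c p by (simp add: \<alpha>_def)
    show "\<alpha> *\<^sub>R one_phase \<preceq> flow a b T x"
      unfolding phase_le_def using all T Tl by (simp add: flow_apply \<alpha>_def)
    show "flow a b T x \<preceq> (\<kappa> * \<alpha>) *\<^sub>R one_phase"
      unfolding phase_le_def \<kappa>[symmetric]
    proof (intro allI)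
      fix \<tau> i
      show "apply_bcontfun (flow a b T x) \<tau> $ i \<le> apply_bcontfun ((\<Phi> * exp H) *\<^sub>R one_phase) \<tau> $ i"
        using up[of "T + lag_time \<tau>" i] T Tl[of \<tau>] by (simp add: flow_apply)
    qed
  qed
qed

section \<open>Norm bounds for the solution operators\<close>

text \<open>One factor \<open>N\<close> bounds the component sum of the initial function by its
  norm, the other leads from components back to the Euclidean norm.\<close>

lemma flow_norm_upper:
  assumes x: "0 \<preceq> x" and t: "0 \<le> t"
  shows "norm (flow a b t x) \<le> (real CARD('n))\<^sup>2 * exp (integral {0..t} (\<lambda>s. up_rate (a s) (b s))) * norm x"
proof -
  let ?g = "\<lambda>s. up_rate (a s) (b s)" and ?N = "real CARD('n)"
  let ?E = "exp (integral {0..t} ?g)"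
  have gi: "?g integrable_on {s..t}" for s t by (intro integrable_continuous_real continuous_up_rate)
  have hist: "(\<Sum>i\<in>UNIV. traj a b x s $ i) \<le> ?N * norm x" if s: "0 - 1 \<le> s" "s \<le> 0" for s
  proof -
    obtain \<sigma> where \<sigma>: "s = lag_time \<sigma>" using lag_timeE[of s] s by auto
    have "traj a b x s $ i \<le> norm x" for i
      using abs_phase_le_norm[of x \<sigma> i] unfolding \<sigma> traj_lag by simp
    then have "(\<Sum>i\<in>UNIV. traj a b x s $ i) \<le> (\<Sum>i\<in>(UNIV::'n set). norm x)" by (intro sum_mono)
    then show ?thesis by simp
  qed
  have comp: "traj a b x s $ i \<le> ?N * norm x * ?E" if s: "-1 \<le> s" "s \<le> t" for s i
  proof -
    have "traj a b x s $ i \<le> (\<Sum>i\<in>UNIV. traj a b x s $ i)" by (rule traj_component_le_sum[OF x s(1)])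
    also have "\<dots> \<le> ?N * norm x * ?E"
    proof (cases "0 \<le> s")
      case True
      have "(\<Sum>i\<in>UNIV. traj a b x s $ i) \<le> ?N * norm x * exp (integral {0..s} ?g)"
        by (rule traj_sum_upper[OF x _ True hist]) auto
      also have "\<dots> \<le> ?N * norm x * ?E"
        using s by (intro mult_left_mono) (auto intro!: integral_subset_le gi up_rate_nonneg)
      finally show ?thesis .
    next
      case False
      have "(\<Sum>i\<in>UNIV. traj a b x s $ i) \<le> ?N * norm x * 1" using hist[of s] s False by auto
      also have "\<dots> \<le> ?N * norm x * ?E"
        by (intro mult_left_mono) (auto intro!: integral_nonneg gi up_rate_nonneg)
      finally show ?thesis .
    qed
    finally show ?thesis .
  qed
  have nn: "0 \<le> traj a b x s $ i" if "-1 \<le> s" for s i using traj_nonneg[OF x that] .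
  show ?thesis
  proof (rule norm_bound)
    fix \<tau>
    let ?s = "t + lag_time \<tau>"
    have s: "-1 \<le> ?s" "?s \<le> t" using lag_shift_ge[OF t, of \<tau>] lag_time_bounds[of \<tau>] by auto
    have "norm (apply_bcontfun (flow a b t x) \<tau>) \<le> (\<Sum>i\<in>UNIV. \<bar>traj a b x ?s $ i\<bar>)"
      using norm_le_l1_cart[of "traj a b x ?s"] t by (simp add: flow_apply)
    also have "\<dots> \<le> (\<Sum>i\<in>(UNIV::'n set). ?N * norm x * ?E)"
      using comp[OF s] nn[OF s(1)] by (intro sum_mono) simp
    finally show "norm (apply_bcontfun (flow a b t x) \<tau>) \<le> ?N\<^sup>2 * ?E * norm x"
      by (simp add: power2_eq_square mult_ac)
  qed
qed

lemma flow_abs_le: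
  assumes "0 \<le> t" "- y \<preceq> x" "x \<preceq> y"
  shows "norm (flow a b t x) \<le> norm (flow a b t y)"
proof (rule norm_phase_mono)
  fix \<tau> i
  have "flow a b t (- y) = - flow a b t y" using linear_flow[OF assms(1)] by (rule linear_neg)
  then show "\<bar>apply_bcontfun (flow a b t x) \<tau> $ i\<bar> \<le> apply_bcontfun (flow a b t y) \<tau> $ i"
    using flow_mono[OF assms(2,1)] flow_mono[OF assms(3,1)]
    unfolding phase_le_def by (simp add: abs_le_iff minus_le_iff)
qed

text \<open>Positivity alone yields continuity: as \<open>one_phase\<close> is an order unit, the
  norm of its image bounds the operator.\<close>

lemma bounded_linear_flow:
  assumes "0 \<le> t" shows "bounded_linear (flow a b t)"
proof (rule bounded_linear.intro)
  show "linear (flow a b t)" by (rule linear_flow[OF assms])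
  show "bounded_linear_axioms (flow a b t)"
  proof (standard, intro exI allI)
    fix x
    have "norm (flow a b t x) \<le> norm (flow a b t (norm x *\<^sub>R one_phase))"
      using abs_phase_le_norm[of x] by (intro flow_abs_le assms) (auto simp: phase_le_def abs_le_iff minus_le_iff)
    also have "\<dots> = norm x * norm (flow a b t one_phase)"
      using linear_scale[OF linear_flow[OF assms]] by simp
    finally show "norm (flow a b t x) \<le> norm x * norm (flow a b t one_phase)" .
  qed
qed

end

section \<open>An ergodic theorem for additive cocycles bounded below\<close>

text \<open>Garsia's maximum of \<open>0\<close> and the first \<open>n\<close> Birkhoff sums, in
  recursive form; the recursion is exactly the relation between \<open>x\<close> and
  \<open>T x\<close> that the maximal inequality integrates.\<close>

primrec max_sum :: "('a \<Rightarrow> real) \<Rightarrow> ('a \<Rightarrow> 'a) \<Rightarrow> nat \<Rightarrow> 'a \<Rightarrow> real" where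
  "max_sum f T 0 x = 0"
| "max_sum f T (Suc n) x = max 0 (f x + max_sum f T n (T x))"

lemma max_sum_nonneg: "0 \<le> max_sum f T n x"
  by (cases n) auto

lemma max_sum_mono_Suc: "max_sum f T n x \<le> max_sum f T (Suc n) x"
proof (induction n arbitrary: x)
  case (Suc n)
  show ?case using Suc[of "T x"] by (subst (1 2) max_sum.simps(2)) (simp del: max_sum.simps)
qed simp

lemma max_sum_ge: "k \<le> n \<Longrightarrow> (\<Sum>i<k. f ((T ^^ i) x)) \<le> max_sum f T n x"
proof (induction n arbitrary: k x)
  case (Suc n)
  show ?case
  proof (cases k)
    case (Suc l)
    have "(\<Sum>i<Suc l. f ((T ^^ i) x)) = f x + (\<Sum>i<l. f ((T ^^ i) (T x)))"
      by (subst sum.lessThan_Suc_shift) (simp add: funpow_swap1)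
    also have "\<dots> \<le> f x + max_sum f T n (T x)"
      using Suc.IH[of l "T x"] Suc Suc.prems by simp
    finally show ?thesis using Suc by simp
  qed (simp add: max_sum_nonneg)
qed simp

text \<open>The negative part of \<open>f\<close> need not be integrable; the maximal ergodic theorem then shows that
  it is.\<close>

lemma maximal_ergodic:
  assumes T[measurable]: "T \<in> M \<rightarrow>\<^sub>M M" and pres: "distr M M T = M"
    and f[measurable]: "f \<in> borel_measurable M"
    and fin: "(\<integral>\<^sup>+x. ennreal (f x) \<partial>M) < \<infinity>"
    and pos: "AE x in M. \<exists>n. 0 < (\<Sum>i<n. f ((T ^^ i) x))"
  shows "(\<integral>\<^sup>+x. ennreal (- f x) \<partial>M) \<le> (\<integral>\<^sup>+x. ennreal (f x) \<partial>M)"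
proof -
  have m[measurable]: "max_sum f T n \<in> borel_measurable M" for n
    by (induction n) auto
  have T_int: "(\<integral>\<^sup>+x. ennreal (max_sum f T n (T x)) \<partial>M) = (\<integral>\<^sup>+x. ennreal (max_sum f T n x) \<partial>M)" for n
    using nn_integral_distr[OF T, of "\<lambda>x. ennreal (max_sum f T n x)"] by (simp add: pres)
  have fin_m: "(\<integral>\<^sup>+x. ennreal (max_sum f T n x) \<partial>M) < \<infinity>" for n
  proof (induction n)
    case (Suc n)
    have "(\<integral>\<^sup>+x. ennreal (max_sum f T (Suc n) x) \<partial>M)
        \<le> (\<integral>\<^sup>+x. ennreal (f x) + ennreal (max_sum f T n (T x)) \<partial>M)"
    proof (rule nn_integral_mono)
      fix x
      have "ennreal (max_sum f T (Suc n) x) \<le> ennreal (max 0 (f x) + max_sum f T n (T x))"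
        using max_sum_nonneg[of f T n "T x"] by (intro ennreal_leI) (auto simp: max_def)
      also have "\<dots> = ennreal (f x) + ennreal (max_sum f T n (T x))"
        by (subst ennreal_plus) (auto simp: max_sum_nonneg ennreal_max_0)
      finally show "ennreal (max_sum f T (Suc n) x) \<le> ennreal (f x) + ennreal (max_sum f T n (T x))" .
    qed
    also have "\<dots> = (\<integral>\<^sup>+x. ennreal (f x) \<partial>M) + (\<integral>\<^sup>+x. ennreal (max_sum f T n x) \<partial>M)"
      by (subst nn_integral_add) (auto simp: T_int)
    also have "\<dots> < \<infinity>" using fin Suc by simp
    finally show ?case .
  qed simp
  \<comment> \<open>These cut-offs increase to the full negative part, because almost everywhere
    some partial sum, and hence some \<open>max_sum\<close>, is positive.\<close>
  define g where "g n x = ennreal (- f x) * indicator {x. 0 < max_sum f T n x} x" for n x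
  have g[measurable]: "g n \<in> borel_measurable M" for n unfolding g_def by measurable
  have bound: "(\<integral>\<^sup>+x. g n x \<partial>M) \<le> (\<integral>\<^sup>+x. ennreal (f x) \<partial>M)" for n
  proof -
    \<comment> \<open>Where \<open>max_sum\<close> is positive it equals \<open>f x\<close> plus its
      predecessor at \<open>T x\<close>. The inequality is kept additive in \<open>ennreal\<close>:
      the integrals of \<open>max_sum\<close> at \<open>x\<close> and at \<open>T x\<close> are
      finite and equal by invariance, and they cancel after integration.\<close>
    have pt: "g n x + ennreal (max_sum f T n x) \<le> ennreal (f x) + ennreal (max_sum f T n (T x))" for x
    proof (cases "0 < max_sum f T n x")
      case True
      then obtain k where k: "n = Suc k" by (cases n) auto
      have eq: "max_sum f T n x = f x + max_sum f T k (T x)" using True k by auto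
      have "g n x + ennreal (max_sum f T n x) = ennreal (max 0 (- f x) + max_sum f T n x)"
        using True by (subst ennreal_plus) (auto simp: g_def max_sum_nonneg ennreal_max_0)
      also have "\<dots> \<le> ennreal (max 0 (f x) + max_sum f T n (T x))"
        using max_sum_mono_Suc[of f T k "T x"] by (intro ennreal_leI) (simp add: eq flip: k)
      also have "\<dots> = ennreal (f x) + ennreal (max_sum f T n (T x))"
        by (subst ennreal_plus) (auto simp: max_sum_nonneg ennreal_max_0)
      finally show ?thesis .
    next
      case False
      then have "max_sum f T n x = 0" using max_sum_nonneg[of f T n x] by simp
      then show ?thesis by (simp add: g_def)
    qed
    have "(\<integral>\<^sup>+x. g n x \<partial>M) + (\<integral>\<^sup>+x. ennreal (max_sum f T n x) \<partial>M) = (\<integral>\<^sup>+x. g n x + ennreal (max_sum f T n x) \<partial>M)"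
      by (rule nn_integral_add[symmetric]) auto
    also have "\<dots> \<le> (\<integral>\<^sup>+x. ennreal (f x) + ennreal (max_sum f T n (T x)) \<partial>M)"
      by (rule nn_integral_mono) (rule pt)
    also have "\<dots> = (\<integral>\<^sup>+x. ennreal (f x) \<partial>M) + (\<integral>\<^sup>+x. ennreal (max_sum f T n x) \<partial>M)"
      by (subst nn_integral_add) (auto simp: T_int)
    finally show ?thesis
      using fin_m[of n] by (auto simp: add.commute[of _ "\<integral>\<^sup>+x. ennreal (max_sum f T n x) \<partial>M"] ennreal_add_left_cancel_le less_top)
  qed
  have inc: "incseq g"
    unfolding incseq_Suc_iff le_fun_def
  proof (intro allI)
    fix n x
    show "g n x \<le> g (Suc n) x"
      unfolding g_def using max_sum_mono_Suc[of f T n x]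
      by (intro mult_left_mono) (auto split: split_indicator simp del: max_sum.simps)
  qed
  have "(\<integral>\<^sup>+x. ennreal (- f x) \<partial>M) = (\<integral>\<^sup>+x. (SUP n. g n x) \<partial>M)"
  proof (rule nn_integral_cong_AE, use pos in eventually_elim)
    case (elim x)
    then obtain n where "0 < (\<Sum>i<n. f ((T ^^ i) x))" by auto
    also have "\<dots> \<le> max_sum f T n x" by (rule max_sum_ge) simp
    finally have "g n x = ennreal (- f x)" by (simp add: g_def)
    moreover have "g k x \<le> ennreal (- f x)" for k by (auto simp: g_def split: split_indicator)
    ultimately show ?case
      by (intro antisym) (metis SUP_upper UNIV_I, intro SUP_least)
  qed
  also have "\<dots> = (SUP n. \<integral>\<^sup>+x. g n x \<partial>M)"
    by (rule nn_integral_monotone_convergence_SUP[OF inc]) simp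
  also have "\<dots> \<le> (\<integral>\<^sup>+x. ennreal (f x) \<partial>M)" by (rule SUP_least) (rule bound)
  finally show ?thesis .
qed

lemma integral_nonneg_of_parts:
  assumes "integrable M g" "(\<integral>\<^sup>+x. ennreal (- g x) \<partial>M) \<le> (\<integral>\<^sup>+x. ennreal (g x) \<partial>M)"
  shows "0 \<le> integral\<^sup>L M g"
proof -
  have "(\<integral>\<^sup>+x. ennreal (g x) \<partial>M) < top"
    using assms(1) by (simp add: real_integrable_def less_top)
  then have "enn2real (\<integral>\<^sup>+x. ennreal (- g x) \<partial>M) \<le> enn2real (\<integral>\<^sup>+x. ennreal (g x) \<partial>M)"
    by (intro enn2real_mono assms(2))
  then show ?thesis by (simp add: real_lebesgue_integral_def[OF assms(1)])
qed

section \<open>Zero-one alternative and convergence of averages\<close>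

context ergodic_mds begin

lemma flow_measurable [measurable]: "\<theta> t \<in> M \<rightarrow>\<^sub>M M"
  using measurable_compose[OF measurable_Pair1' joint_measurable, of t] by simp

lemma flow_space: "\<omega> \<in> space M \<Longrightarrow> \<theta> t \<omega> \<in> space M"
  using flow_measurable by (rule measurable_space)

lemma flow_inverse: "\<omega> \<in> space M \<Longrightarrow> \<theta> (- t) (\<theta> t \<omega>) = \<omega>"
  using flow_add[of \<omega> "-t" t] flow_zero by simp

lemma flow_iterate: "\<omega> \<in> space M \<Longrightarrow> (\<theta> 1 ^^ k) \<omega> = \<theta> (real k) \<omega>"
proof (induction k)
  case (Suc k)
  then show ?case using flow_add[of \<omega> 1 "real k"] by (simp add: add.commute)
qed (simp add: flow_zero)

lemma AE_flow:
  assumes "AE \<omega> in M. P \<omega>" shows "AE \<omega> in M. P (\<theta> t \<omega>)"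
  using assms by (intro AE_distrD[OF flow_measurable]) (simp only: preserves)

lemma nn_integral_flow:
  "f \<in> borel_measurable M \<Longrightarrow> (\<integral>\<^sup>+\<omega>. f (\<theta> t \<omega>) \<partial>M) = (\<integral>\<^sup>+\<omega>. f \<omega> \<partial>M)"
  using nn_integral_distr[OF flow_measurable, of f t] by (simp add: preserves)

lemma flow_integral_cocycle:
  fixes g :: "'a \<Rightarrow> real"
  assumes \<omega>: "\<omega> \<in> space M" and c: "continuous_on UNIV (\<lambda>r. g (\<theta> r \<omega>))" and st: "0 \<le> s" "0 \<le> t"
  shows "integral {0..s+t} (\<lambda>r. g (\<theta> r \<omega>)) =
    integral {0..s} (\<lambda>r. g (\<theta> r \<omega>)) + integral {0..t} (\<lambda>r. g (\<theta> r (\<theta> s \<omega>)))"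
proof -
  have i: "(\<lambda>r. g (\<theta> r \<omega>)) integrable_on {a..b}" for a b
    by (intro integrable_continuous_real continuous_on_subset[OF c]) auto
  have "integral {0..s+t} (\<lambda>r. g (\<theta> r \<omega>)) =
      integral {0..s} (\<lambda>r. g (\<theta> r \<omega>)) + integral {s..s+t} (\<lambda>r. g (\<theta> r \<omega>))"
    by (rule Henstock_Kurzweil_Integration.integral_combine[symmetric]) (use st i in auto)
  also have "integral {s..s+t} (\<lambda>r. g (\<theta> r \<omega>)) = integral {0..t} (\<lambda>r. g (\<theta> (r + s) \<omega>))"
    using integral_shift_Icc_real[of 0 t "\<lambda>r. g (\<theta> r \<omega>)" s] by (simp add: o_def add.commute)
  finally show ?thesis by (simp add: flow_add[OF \<omega>])
qed

lemma invariant_setI: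
  assumes "F \<subseteq> space M" "\<And>t \<omega>. \<omega> \<in> F \<Longrightarrow> \<theta> t \<omega> \<in> F"
  shows "invariant_set \<theta> F"
  unfolding invariant_set_def
proof (intro allI equalityI subsetI)
  fix t \<omega> assume "\<omega> \<in> F"
  then have "\<theta> (- t) \<omega> \<in> F" "\<theta> t (\<theta> (- t) \<omega>) = \<omega>"
    using assms flow_inverse[of \<omega> "- t"] by auto
  then show "\<omega> \<in> \<theta> t ` F" by (metis imageI)
qed (use assms in auto)

text \<open>The points where \<open>Q\<close> is unbounded above along the integers form an
  invariant set. If it is null, \<open>D\<close> carries the bound to real times; if it is full,
  almost every orbit has a positive partial sum and the maximal inequality applies to
  \<open>Q 1\<close>.\<close>

lemma cocycle_zero_one:
  fixes Q :: "real \<Rightarrow> 'a \<Rightarrow> real"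
  assumes \<Omega>0: "\<Omega>0 \<in> sets M" "prob \<Omega>0 = 1" and inv: "\<And>\<omega> t. \<omega> \<in> \<Omega>0 \<Longrightarrow> \<theta> t \<omega> \<in> \<Omega>0"
    and cocycle: "\<And>\<omega> s t. \<omega> \<in> \<Omega>0 \<Longrightarrow> 0 \<le> s \<Longrightarrow> 0 \<le> t \<Longrightarrow> Q (s + t) \<omega> = Q s \<omega> + Q t (\<theta> s \<omega>)"
    and D: "\<And>\<omega> t. \<omega> \<in> \<Omega>0 \<Longrightarrow> 0 \<le> t \<Longrightarrow> \<exists>n::nat. Q t \<omega> \<le> Q (real n) \<omega> + D"
    and meas[measurable]: "(\<lambda>\<omega>. indicator \<Omega>0 \<omega> * Q 1 \<omega>) \<in> borel_measurable M"
    and fin: "(\<integral>\<^sup>+\<omega>. ennreal (indicator \<Omega>0 \<omega> * Q 1 \<omega>) \<partial>M) < \<infinity>"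
  shows "(AE \<omega> in M. \<exists>B. \<forall>t\<ge>0. Q t \<omega> \<le> B) \<or>
    (\<integral>\<^sup>+\<omega>. ennreal (- (indicator \<Omega>0 \<omega> * Q 1 \<omega>)) \<partial>M) \<le> (\<integral>\<^sup>+\<omega>. ennreal (indicator \<Omega>0 \<omega> * Q 1 \<omega>) \<partial>M)"
proof -
  define f where "f \<omega> = indicator \<Omega>0 \<omega> * Q 1 \<omega>" for \<omega>
  have f[measurable]: "f \<in> borel_measurable M" unfolding f_def by (rule meas)
  note \<Omega>0(1)[measurable]
  have sp: "\<omega> \<in> space M" if "\<omega> \<in> \<Omega>0" for \<omega> using sets.sets_into_space[OF \<Omega>0(1)] that by auto
  have sum: "(\<Sum>k<n. f (\<theta> (real k) \<omega>)) = Q (real n) \<omega>" if \<omega>: "\<omega> \<in> \<Omega>0" for n \<omega>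
  proof (induction n)
    case 0 show ?case using cocycle[OF \<omega>, of 0 0] flow_zero[OF sp[OF \<omega>]] by simp
  next
    case (Suc n)
    then show ?case using cocycle[OF \<omega>, of "real n" 1] inv[OF \<omega>] by (simp add: f_def add.commute)
  qed
  define b where "b \<omega> \<longleftrightarrow> (\<exists>B. \<forall>n::nat. Q (real n) \<omega> \<le> B)" for \<omega>
  have b_shift: "b (\<theta> s \<omega>) \<longleftrightarrow> b \<omega>" if \<omega>: "\<omega> \<in> \<Omega>0" and s: "0 \<le> s" for \<omega> s
  proof
    assume "b \<omega>"
    then obtain B where B: "Q (real n) \<omega> \<le> B" for n unfolding b_def by auto
    have "Q (real n) (\<theta> s \<omega>) \<le> B + D - Q s \<omega>" for n
      using cocycle[OF \<omega> s, of "real n"] D[OF \<omega>, of "s + real n"] s B by (smt (verit) of_nat_0_le_iff)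
    then show "b (\<theta> s \<omega>)" unfolding b_def by blast
  next
    assume "b (\<theta> s \<omega>)"
    then obtain B where B: "Q (real n) (\<theta> s \<omega>) \<le> B" for n unfolding b_def by auto
    define k where "k = nat \<lceil>s\<rceil>"
    have "Q (real n) \<omega> \<le> max (Q s \<omega> + B + D) (Max ((\<lambda>n. Q (real n) \<omega>) ` {..k}))" for n
    proof (cases "n \<le> k")
      case True then show ?thesis by (intro max.coboundedI2 Max_ge) auto
    next
      case False
      then have "s \<le> real n" unfolding k_def by linarith
      then obtain m where "Q (real n - s) (\<theta> s \<omega>) \<le> Q (real m) (\<theta> s \<omega>) + D"
        using D[OF inv[OF \<omega>], of "real n - s" s] by auto
      moreover have "Q (real n) \<omega> = Q s \<omega> + Q (real n - s) (\<theta> s \<omega>)"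
        using cocycle[OF \<omega> s, of "real n - s"] \<open>s \<le> real n\<close> by simp
      ultimately show ?thesis using B[of m] by linarith
    qed
    then show "b \<omega>" unfolding b_def by blast
  qed
  have b_inv: "b (\<theta> s \<omega>) \<longleftrightarrow> b \<omega>" if \<omega>: "\<omega> \<in> \<Omega>0" for \<omega> s
  proof (cases "0 \<le> s")
    case False
    then show ?thesis using b_shift[OF inv[OF \<omega>, of s], of "- s"] flow_inverse[OF sp[OF \<omega>], of s] by simp
  qed (rule b_shift[OF \<omega>])
  define V where "V = {\<omega>\<in>\<Omega>0. \<not> b \<omega>}"
  \<comment> \<open>Measurability is known for \<open>Q 1\<close> only, so \<open>V\<close> is
    rewritten through partial sums of \<open>f\<close> along integer times.\<close>
  have "V = {\<omega>\<in>space M. \<omega> \<in> \<Omega>0 \<and> (\<forall>m::nat. \<exists>n::nat. real m < (\<Sum>k<n. f (\<theta> (real k) \<omega>)))}"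
  proof -
    have "b \<omega> \<longleftrightarrow> (\<exists>m::nat. \<forall>n::nat. Q (real n) \<omega> \<le> real m)" for \<omega>
      unfolding b_def by (meson order_trans real_arch_simple)
    then show ?thesis unfolding V_def using sum sp by (auto simp: not_le)
  qed
  also have "\<dots> \<in> sets M" by measurable
  finally have V: "V \<in> sets M" .
  have "invariant_set \<theta> V"
    by (rule invariant_setI) (auto simp: V_def sp inv b_inv)
  with V have "prob V = 0 \<or> prob V = 1" by (rule ergodic)
  then show ?thesis
  proof
    assume "prob V = 0"
    then have "AE \<omega> in M. \<omega> \<notin> V" using V by (simp add: prob_eq_0)
    moreover have "AE \<omega> in M. \<omega> \<in> \<Omega>0" using \<Omega>0 by (simp add: prob_eq_1)
    ultimately have "AE \<omega> in M. \<exists>B. \<forall>t\<ge>0. Q t \<omega> \<le> B"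
    proof eventually_elim
      case (elim \<omega>)
      then obtain B where B: "Q (real n) \<omega> \<le> B" for n by (auto simp: V_def b_def)
      have "Q t \<omega> \<le> B + D" if "0 \<le> t" for t
        using D[OF elim(2) that] B by (meson add_right_mono order_trans)
      then show ?case by blast
    qed
    then show ?thesis ..
  next
    assume "prob V = 1"
    then have "AE \<omega> in M. \<omega> \<in> V" using V by (simp add: prob_eq_1)
    then have "AE \<omega> in M. \<exists>n. 0 < (\<Sum>k<n. f ((\<theta> 1 ^^ k) \<omega>))"
    proof eventually_elim
      case (elim \<omega>)
      then have \<omega>: "\<omega> \<in> \<Omega>0" and "\<not> b \<omega>" by (auto simp: V_def)
      then obtain n :: nat where "0 < Q (real n) \<omega>" unfolding b_def by (meson not_le)
      then show ?case using sum[OF \<omega>, of n] sp[OF \<omega>] by (intro exI[of _ n]) (simp add: flow_iterate)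
    qed
    from maximal_ergodic[OF flow_measurable preserves f _ this] fin
    show ?thesis by (simp add: f_def)
  qed
qed

lemma eventually_average_less:
  fixes f :: "real \<Rightarrow> real"
  assumes "\<exists>B. \<forall>t\<ge>0. f t - a * t \<le> B" "a < l"
  shows "\<forall>\<^sub>F t in at_top. f t / t < l"
proof -
  obtain B where B: "\<And>t. 0 \<le> t \<Longrightarrow> f t - a * t \<le> B" using assms(1) by blast
  have "((\<lambda>t. B / t) \<longlongrightarrow> 0) at_top"
    by (intro tendsto_divide_0[OF tendsto_const] filterlim_at_top_imp_at_infinity filterlim_ident)
  then have "\<forall>\<^sub>F t in at_top. B / t < l - a" using assms(2) by (intro order_tendstoD) auto
  with eventually_gt_at_top[of 0] show ?thesis
  proof eventually_elim
    case (elim t)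
    have "f t / t \<le> (a * t + B) / t" using B[of t] elim by (intro divide_right_mono) auto
    also have "\<dots> = a + B / t" using elim by (simp add: field_simps)
    also have "\<dots> < l" using elim by simp
    finally show ?case .
  qed
qed

text \<open>\<open>cocycle_zero_one\<close> is applied to \<open>R t - a * t\<close> and to
  \<open>a * t - R t\<close>. If \<open>a\<close> lies strictly above, respectively below, the mean
  of \<open>R 1\<close>, the integral inequality is impossible and the difference is bounded above
  almost surely. The lower bound \<open>- C\<close> lets the neighbouring integers control real
  times.\<close>

theorem ergodic_cocycle:
  fixes R :: "real \<Rightarrow> 'a \<Rightarrow> real"
  assumes \<Omega>0: "\<Omega>0 \<in> sets M" "prob \<Omega>0 = 1" and inv: "\<And>\<omega> t. \<omega> \<in> \<Omega>0 \<Longrightarrow> \<theta> t \<omega> \<in> \<Omega>0"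
    and cocycle: "\<And>\<omega> s t. \<omega> \<in> \<Omega>0 \<Longrightarrow> 0 \<le> s \<Longrightarrow> 0 \<le> t \<Longrightarrow> R (s + t) \<omega> = R s \<omega> + R t (\<theta> s \<omega>)"
    and lower: "\<And>\<omega> t. \<omega> \<in> \<Omega>0 \<Longrightarrow> 0 \<le> t \<Longrightarrow> - C \<le> R t \<omega>"
    and meas[measurable]: "(\<lambda>\<omega>. indicator \<Omega>0 \<omega> * R 1 \<omega>) \<in> borel_measurable M"
  obtains c :: ereal where "-\<infinity> < c" "integrable M (\<lambda>\<omega>. indicator \<Omega>0 \<omega> * R 1 \<omega>) \<Longrightarrow> c < \<infinity>"
    "AE \<omega> in M. ((\<lambda>t. ereal (R t \<omega> / t)) \<longlongrightarrow> c) at_top"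
proof -
  note \<Omega>0(1)[measurable]
  define f where "f \<omega> = indicator \<Omega>0 \<omega> * R 1 \<omega>" for \<omega>
  have f[measurable]: "f \<in> borel_measurable M" unfolding f_def by (rule meas)
  have int_ind: "integrable M (indicator \<Omega>0 :: 'a \<Rightarrow> real)"
    by (rule integrable_real_indicator) (auto simp: less_top[symmetric])
  have C: "0 \<le> C"
  proof -
    obtain \<omega> where \<omega>: "\<omega> \<in> \<Omega>0" using \<Omega>0 by fastforce
    then have "\<omega> \<in> space M" using sets.sets_into_space[OF \<Omega>0(1)] by auto
    then show ?thesis using lower[OF \<omega>, of 0] cocycle[OF \<omega>, of 0 0] flow_zero by simp
  qed
  have ceil: "R t \<omega> \<le> R (real (nat \<lceil>t\<rceil>)) \<omega> + C" if \<omega>: "\<omega> \<in> \<Omega>0" and t: "0 \<le> t" for \<omega> t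
  proof -
    have "0 \<le> real (nat \<lceil>t\<rceil>) - t" by linarith
    then show ?thesis
      using cocycle[OF \<omega> t, of "real (nat \<lceil>t\<rceil>) - t"] lower[OF inv[OF \<omega>], of "real (nat \<lceil>t\<rceil>) - t" t] by simp
  qed
  have floor: "R (real (nat \<lfloor>t\<rfloor>)) \<omega> - C \<le> R t \<omega>" if \<omega>: "\<omega> \<in> \<Omega>0" and t: "0 \<le> t" for \<omega> t
  proof -
    have "0 \<le> t - real (nat \<lfloor>t\<rfloor>)" using t by linarith
    then show ?thesis
      using cocycle[OF \<omega>, of "real (nat \<lfloor>t\<rfloor>)" "t - real (nat \<lfloor>t\<rfloor>)"]
        lower[OF inv[OF \<omega>], of "t - real (nat \<lfloor>t\<rfloor>)" "real (nat \<lfloor>t\<rfloor>)"] by simp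
  qed
  have ab: "\<bar>a * x - a * y\<bar> \<le> \<bar>a\<bar>" if "\<bar>x - y\<bar> \<le> 1" for a x y :: real
  proof -
    have "\<bar>a * x - a * y\<bar> = \<bar>a\<bar> * \<bar>x - y\<bar>" by (simp add: abs_mult flip: right_diff_distrib)
    then show ?thesis using mult_left_mono[OF that, of "\<bar>a\<bar>"] by simp
  qed
  have aR: "a - R 1 \<omega> \<le> \<bar>a\<bar> + C" if "\<omega> \<in> \<Omega>0" for a \<omega>
    using lower[OF that, of 1] abs_ge_self[of a] by linarith
  have up: "(AE \<omega> in M. \<exists>B. \<forall>t\<ge>0. R t \<omega> - a * t \<le> B) \<or>
      (\<integral>\<^sup>+\<omega>. ennreal (- (f \<omega> - a * indicator \<Omega>0 \<omega>)) \<partial>M) \<le> (\<integral>\<^sup>+\<omega>. ennreal (f \<omega> - a * indicator \<Omega>0 \<omega>) \<partial>M)"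
    if int: "integrable M f" for a
  proof -
    define Q where "Q t \<omega> = R t \<omega> - a * t" for t \<omega>
    have Q1: "f \<omega> - a * indicator \<Omega>0 \<omega> = indicator \<Omega>0 \<omega> * Q 1 \<omega>" for \<omega>
      by (auto simp: Q_def f_def split: split_indicator)
    have intQ: "integrable M (\<lambda>\<omega>. indicator \<Omega>0 \<omega> * Q 1 \<omega>)" unfolding Q1[symmetric] using int int_ind by simp
    show ?thesis unfolding Q1 Q_def[symmetric]
    proof (rule cocycle_zero_one[OF \<Omega>0 inv])
      show "(\<integral>\<^sup>+\<omega>. ennreal (indicator \<Omega>0 \<omega> * Q 1 \<omega>) \<partial>M) < \<infinity>"
        using intQ by (simp add: real_integrable_def less_top)
      fix \<omega> t assume *: "\<omega> \<in> \<Omega>0" "0 \<le> (t::real)"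
      then have "\<bar>real (nat \<lceil>t\<rceil>) - t\<bar> \<le> 1" by linarith
      from ab[OF this, of a] have "Q t \<omega> \<le> Q (real (nat \<lceil>t\<rceil>)) \<omega> + (C + \<bar>a\<bar>)"
        using ceil[OF *] unfolding Q_def by linarith
      then show "\<exists>n::nat. Q t \<omega> \<le> Q (real n) \<omega> + (C + \<bar>a\<bar>)" by blast
    qed (use intQ cocycle in \<open>auto simp: Q_def algebra_simps\<close>)
  qed
  have le: "(\<integral>\<^sup>+\<omega>. ennreal (a * indicator \<Omega>0 \<omega> - f \<omega>) \<partial>M) < \<infinity>" for a
  proof -
    have "(\<integral>\<^sup>+\<omega>. ennreal (a * indicator \<Omega>0 \<omega> - f \<omega>) \<partial>M) \<le> (\<integral>\<^sup>+\<omega>. ennreal (\<bar>a\<bar> + C) \<partial>M)"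
      using aR C by (intro nn_integral_mono ennreal_leI) (auto simp: f_def split: split_indicator)
    also have "\<dots> < \<infinity>" by (simp add: emeasure_space_1)
    finally show ?thesis .
  qed
  have low: "(AE \<omega> in M. \<exists>B. \<forall>t\<ge>0. a * t - R t \<omega> \<le> B) \<or>
      (\<integral>\<^sup>+\<omega>. ennreal (- (a * indicator \<Omega>0 \<omega> - f \<omega>)) \<partial>M) \<le> (\<integral>\<^sup>+\<omega>. ennreal (a * indicator \<Omega>0 \<omega> - f \<omega>) \<partial>M)"
    for a
  proof -
    define Q where "Q t \<omega> = a * t - R t \<omega>" for t \<omega>
    have Q1: "a * indicator \<Omega>0 \<omega> - f \<omega> = indicator \<Omega>0 \<omega> * Q 1 \<omega>" for \<omega>
      by (auto simp: Q_def f_def split: split_indicator)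
    show ?thesis unfolding Q1 Q_def[symmetric]
    proof (rule cocycle_zero_one[OF \<Omega>0 inv])
      show "(\<integral>\<^sup>+\<omega>. ennreal (indicator \<Omega>0 \<omega> * Q 1 \<omega>) \<partial>M) < \<infinity>" using le[of a] unfolding Q1 .
      show "(\<lambda>\<omega>. indicator \<Omega>0 \<omega> * Q 1 \<omega>) \<in> borel_measurable M" unfolding Q1[symmetric] by measurable
      fix \<omega> t assume *: "\<omega> \<in> \<Omega>0" "0 \<le> (t::real)"
      then have "\<bar>real (nat \<lfloor>t\<rfloor>) - t\<bar> \<le> 1" by linarith
      from ab[OF this, of a] have "Q t \<omega> \<le> Q (real (nat \<lfloor>t\<rfloor>)) \<omega> + (C + \<bar>a\<bar>)"
        using floor[OF *] unfolding Q_def by linarith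
      then show "\<exists>n::nat. Q t \<omega> \<le> Q (real n) \<omega> + (C + \<bar>a\<bar>)" by blast
    qed (use cocycle in \<open>auto simp: Q_def algebra_simps\<close>)
  qed
  \<comment> \<open>Since \<open>R 1\<close> is at least \<open>- C\<close> on
    \<open>\<Omega>0\<close>, integrability can fail only through an infinite positive part, so
    \<open>\<infinity>\<close> is then the correct mean.\<close>
  define c :: ereal where "c = (if integrable M f then ereal (integral\<^sup>L M f) else \<infinity>)"
  have int1: "integral\<^sup>L M (\<lambda>\<omega>. a * indicator \<Omega>0 \<omega>) = a" for a :: real
    using \<Omega>0 sets.sets_into_space[OF \<Omega>0(1)] by (simp add: Int_absorb2)
  have AE_up: "AE \<omega> in M. \<exists>B. \<forall>t\<ge>0. R t \<omega> - a * t \<le> B" if a: "c < ereal a" for a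
  proof (rule ccontr)
    assume *: "\<not> ?thesis"
    have int: "integrable M f" and m: "integral\<^sup>L M f < a"
      using a by (auto simp: c_def split: if_splits)
    have "0 \<le> integral\<^sup>L M (\<lambda>\<omega>. f \<omega> - a * indicator \<Omega>0 \<omega>)"
      by (rule integral_nonneg_of_parts) (use up[OF int, of a] * int int_ind in auto)
    also have "\<dots> = integral\<^sup>L M f - a"
      using int int_ind int1[of a] by (subst Bochner_Integration.integral_diff) auto
    finally show False using m by simp
  qed
  have AE_low: "AE \<omega> in M. \<exists>B. \<forall>t\<ge>0. a * t - R t \<omega> \<le> B" if a: "ereal a < c" for a
  proof (rule ccontr)
    assume "\<not> ?thesis"
    with low[of a] have *: "(\<integral>\<^sup>+\<omega>. ennreal (- (a * indicator \<Omega>0 \<omega> - f \<omega>)) \<partial>M) \<le> (\<integral>\<^sup>+\<omega>. ennreal (a * indicator \<Omega>0 \<omega> - f \<omega>) \<partial>M)"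
      by blast
    \<comment> \<open>The inequality bounds the negative part of the difference by its finite
      positive part, so \<open>f\<close> turns out integrable even if \<open>c\<close> was set to
      \<open>\<infinity>\<close>.\<close>
    then have int_d: "integrable M (\<lambda>\<omega>. a * indicator \<Omega>0 \<omega> - f \<omega>)"
      using le[of a] by (auto simp: real_integrable_def less_top top_unique)
    have "integrable M (\<lambda>\<omega>. a * indicator \<Omega>0 \<omega> - (a * indicator \<Omega>0 \<omega> - f \<omega>))"
      by (rule Bochner_Integration.integrable_diff[OF _ int_d]) (use int_ind in simp)
    then have int: "integrable M f" by simp
    then have m: "a < integral\<^sup>L M f" using a by (simp add: c_def)
    have "0 \<le> integral\<^sup>L M (\<lambda>\<omega>. a * indicator \<Omega>0 \<omega> - f \<omega>)"
      by (rule integral_nonneg_of_parts[OF int_d *])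
    also have "\<dots> = a - integral\<^sup>L M f"
      using int int_ind int1[of a] by (subst Bochner_Integration.integral_diff) auto
    finally show False using m by simp
  qed
  \<comment> \<open>Countably many slopes leave a single null set, and the rationals are dense
    enough to enclose the limit.\<close>
  have "AE \<omega> in M. \<forall>a\<in>\<rat>. c < ereal a \<longrightarrow> (\<exists>B. \<forall>t\<ge>0. R t \<omega> - a * t \<le> B)"
    using AE_up by (subst AE_ball_countable) (auto simp: countable_rat)
  moreover have "AE \<omega> in M. \<forall>a\<in>\<rat>. ereal a < c \<longrightarrow> (\<exists>B. \<forall>t\<ge>0. a * t - R t \<omega> \<le> B)"
    using AE_low by (subst AE_ball_countable) (auto simp: countable_rat)
  ultimately have "AE \<omega> in M. ((\<lambda>t. ereal (R t \<omega> / t)) \<longlongrightarrow> c) at_top"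
  proof eventually_elim
    case (elim \<omega>)
    show ?case
    proof (rule order_tendstoI)
      fix l assume "l < c"
      then obtain l' where l': "l < ereal l'" "ereal l' < c" using ereal_dense2 by blast
      then obtain a where a: "ereal l' < ereal (real_of_rat a)" "ereal (real_of_rat a) < c"
        using ereal_dense3 by blast
      have "\<exists>B. \<forall>t\<ge>0. real_of_rat a * t - R t \<omega> \<le> B"
        using bspec[OF elim(2) Rats_of_rat, of a] a(2) by blast
      then have "\<exists>B. \<forall>t\<ge>0. - R t \<omega> - (- real_of_rat a) * t \<le> B" by (simp add: algebra_simps)
      then have "\<forall>\<^sub>F t in at_top. - R t \<omega> / t < - l'"
        by (rule eventually_average_less) (use a in simp)
      then show "\<forall>\<^sub>F t in at_top. l < ereal (R t \<omega> / t)"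
        by eventually_elim (use l' in \<open>auto intro: less_trans\<close>)
    next
      fix l assume "c < l"
      then obtain l' where l': "c < ereal l'" "ereal l' < l" using ereal_dense2 by blast
      then obtain a where a: "c < ereal (real_of_rat a)" "ereal (real_of_rat a) < ereal l'"
        using ereal_dense3 by blast
      have "\<exists>B. \<forall>t\<ge>0. R t \<omega> - real_of_rat a * t \<le> B"
        using bspec[OF elim(1) Rats_of_rat, of a] a(1) by blast
      then have "\<forall>\<^sub>F t in at_top. R t \<omega> / t < l'"
        by (rule eventually_average_less) (use a in simp)
      then show "\<forall>\<^sub>F t in at_top. ereal (R t \<omega> / t) < l"
        by eventually_elim (metis l'(2) less_ereal.simps(1) less_trans)
    qed
  qed
  moreover have "-\<infinity> < c" by (simp add: c_def)
  moreover have "c < \<infinity>" if "integrable M (\<lambda>\<omega>. indicator \<Omega>0 \<omega> * R 1 \<omega>)"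
    using that by (simp add: c_def f_def[abs_def])
  ultimately show thesis using that by blast
qed

end

section \<open>Measurability\<close>

lemma apply_bcontfun_sum: "apply_bcontfun (sum g S) \<tau> = (\<Sum>s\<in>S. apply_bcontfun (g s) \<tau>)"
  for g :: "'b \<Rightarrow> 'c::topological_space \<Rightarrow>\<^sub>C 'd::real_normed_vector"
  by (induction S rule: infinite_finite_induct) auto

definition bernstein_phase :: "nat \<Rightarrow> nat \<Rightarrow> 'n \<Rightarrow> 'n::finite phase" where
  "bernstein_phase m k i = Bcontfun (\<lambda>\<tau>. Bernstein m k (1 + lag_time \<tau>) *\<^sub>R axis i 1)"

lemma bernstein_phase_apply:
  "apply_bcontfun (bernstein_phase m k i) \<tau> = Bernstein m k (1 + lag_time \<tau>) *\<^sub>R axis i 1"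
proof -
  have "continuous_on {-1..0} (\<lambda>s. Bernstein m k (1 + s) *\<^sub>R (axis i 1 :: real ^ 'a))"
    unfolding Bernstein_def by (intro continuous_intros)
  from lag_restriction_bcontfun[OF this] show ?thesis
    by (simp add: bernstein_phase_def Bcontfun_inverse)
qed

text \<open>The phase space is not an instance of a second countable class; Bernstein polynomials write a
  phase-valued map as a limit of continuous images of its values at finitely many times.\<close>

lemma borel_measurable_phaseI:
  fixes f :: "'a \<Rightarrow> 'n::finite phase"
  assumes ev: "\<And>\<tau>. (\<lambda>\<omega>. apply_bcontfun (f \<omega>) \<tau>) \<in> borel_measurable M"
  shows "f \<in> borel_measurable M"
proof -
  define \<Psi> where "\<Psi> m c = (\<Sum>k\<le>m. \<Sum>i\<in>UNIV. (c k $ i) *\<^sub>R bernstein_phase m k i)"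
    for m and c :: "nat \<Rightarrow> real ^ 'n"
  define co where "co m \<omega> = (\<lambda>k. lag_extend (f \<omega>) (real k / real m - 1))" for m \<omega>
  have "continuous_on UNIV (\<Psi> m)" for m
    unfolding \<Psi>_def by (intro continuous_intros continuous_on_product_coordinates)
  then have \<Psi>: "\<Psi> m \<in> borel_measurable borel" for m by (rule borel_measurable_continuous_onI)
  have "co m \<in> borel_measurable M" for m
    unfolding co_def lag_extend_def by (intro measurable_coordinatewise_then_product ev)
  then have meas: "(\<lambda>\<omega>. \<Psi> m (co m \<omega>)) \<in> borel_measurable M" for m
    by (rule measurable_compose[OF _ \<Psi>])
  have lim: "(\<lambda>m. \<Psi> m (co m \<omega>)) \<longlonglongrightarrow> f \<omega>" for \<omega>
  proof (rule LIMSEQ_I)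
    fix r :: real assume "0 < r"
    \<comment> \<open>The errors of the \<open>N\<close> components add up to at most
      \<open>r / 2\<close>; the spare half keeps the supremum norm strictly below
      \<open>r\<close>.\<close>
    define e where "e = r / (2 * CARD('n))"
    have e: "0 < e" using \<open>0 < r\<close> by (simp add: e_def)
    define h where "h i x = lag_extend (f \<omega>) (x - 1) $ i" for i x
    have "continuous_on {0..1} (h i)" for i
      unfolding h_def
      by (intro continuous_intros continuous_on_compose2[OF continuous_on_lag_extend[of UNIV]]) auto
    from Bernstein_Weierstrass[OF this e]
    obtain K where K: "\<And>i n x. K i \<le> n \<Longrightarrow> x \<in> {0..1} \<Longrightarrow> \<bar>h i x - (\<Sum>k\<le>n. h i (real k / real n) * Bernstein n k x)\<bar> < e"
      by metis
    have "norm (\<Psi> m (co m \<omega>) - f \<omega>) < r" if m: "m \<ge> Max (range K)" for m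
    proof -
      have "norm (\<Psi> m (co m \<omega>) - f \<omega>) \<le> r / 2"
      proof (rule norm_bound)
        fix \<tau>
        let ?x = "1 + lag_time \<tau>"
        have x: "?x \<in> {0..1}" using lag_time_bounds[of \<tau>] by auto
        have comp: "apply_bcontfun (\<Psi> m (co m \<omega>)) \<tau> $ i = (\<Sum>k\<le>m. h i (real k / real m) * Bernstein m k ?x)" for i
        proof -
          have "apply_bcontfun (\<Psi> m (co m \<omega>)) \<tau> $ i
              = (\<Sum>k\<le>m. \<Sum>j\<in>UNIV. (co m \<omega> k $ j) * (Bernstein m k ?x * axis j 1 $ i))"
            by (simp add: \<Psi>_def apply_bcontfun_sum bernstein_phase_apply mult.assoc)
          also have "\<dots> = (\<Sum>k\<le>m. h i (real k / real m) * Bernstein m k ?x)"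
          proof (rule sum.cong[OF refl])
            fix k
            have "(\<Sum>j\<in>UNIV. (co m \<omega> k $ j) * (Bernstein m k ?x * axis j 1 $ i))
                = (\<Sum>j\<in>UNIV. if i = j then co m \<omega> k $ i * Bernstein m k ?x else 0)"
              by (rule sum.cong) (auto simp: axis_def)
            then show "(\<Sum>j\<in>UNIV. (co m \<omega> k $ j) * (Bernstein m k ?x * axis j 1 $ i))
                = h i (real k / real m) * Bernstein m k ?x"
              by (simp add: co_def h_def)
          qed
          finally show ?thesis .
        qed
        have fx: "apply_bcontfun (f \<omega>) \<tau> $ i = h i ?x" for i
          by (simp add: h_def)
        have "norm (apply_bcontfun (\<Psi> m (co m \<omega>) - f \<omega>) \<tau>)
            \<le> (\<Sum>i\<in>UNIV. \<bar>apply_bcontfun (\<Psi> m (co m \<omega>) - f \<omega>) \<tau> $ i\<bar>)"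
          by (rule norm_le_l1_cart)
        also have "\<dots> \<le> (\<Sum>i\<in>(UNIV :: 'n set). e)"
        proof (rule sum_mono)
          fix i
          have "K i \<le> m" using m by (meson Max_ge finite_imageI finite order_trans rangeI)
          from K[OF this x] show "\<bar>apply_bcontfun (\<Psi> m (co m \<omega>) - f \<omega>) \<tau> $ i\<bar> \<le> e"
            by (simp add: comp fx abs_minus_commute)
        qed
        also have "\<dots> = r / 2" by (simp add: e_def)
        finally show "norm (apply_bcontfun (\<Psi> m (co m \<omega>) - f \<omega>) \<tau>) \<le> r / 2" .
      qed
      also have "\<dots> < r" using \<open>0 < r\<close> by simp
      finally show ?thesis .
    qed
    then show "\<exists>no. \<forall>n\<ge>no. norm (\<Psi> n (co n \<omega>) - f \<omega>) < r" by blast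
  qed
  show ?thesis by (rule borel_measurable_LIMSEQ_metric[OF meas lim])
qed

lemma borel_measurable_phase_eval:
  fixes f :: "'a \<Rightarrow> 'n::finite phase"
  assumes "f \<in> borel_measurable M"
  shows "(\<lambda>\<omega>. apply_bcontfun (f \<omega>) \<tau>) \<in> borel_measurable M"
proof -
  have "bounded_linear (\<lambda>x :: 'n phase. apply_bcontfun x \<tau>)"
    by (rule bounded_linear_intro[where K = 1]) (auto simp: norm_bounded)
  then have "continuous_on UNIV (\<lambda>x :: 'n phase. apply_bcontfun x \<tau>)"
    by (simp add: linear_continuous_on)
  from measurable_compose[OF assms borel_measurable_continuous_onI[OF this]] show ?thesis .
qed

lemma borel_measurable_phase_norm:
  fixes f :: "'a \<Rightarrow> 'n::finite phase"
  assumes "f \<in> borel_measurable M"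
  shows "(\<lambda>\<omega>. norm (f \<omega>)) \<in> borel_measurable M"
proof -
  have "continuous_on UNIV (norm :: 'n phase \<Rightarrow> real)" by (intro continuous_intros)
  from measurable_compose[OF assms borel_measurable_continuous_onI[OF this]] show ?thesis .
qed

lemma borel_measurable_phase_scaleR:
  fixes f :: "'a \<Rightarrow> 'n::finite phase"
  assumes "f \<in> borel_measurable M" and [measurable]: "c \<in> borel_measurable M"
  shows "(\<lambda>\<omega>. c \<omega> *\<^sub>R f \<omega>) \<in> borel_measurable M"
proof (rule borel_measurable_phaseI)
  fix \<tau>
  note borel_measurable_phase_eval[OF assms(1), of \<tau>, measurable]
  show "(\<lambda>\<omega>. apply_bcontfun (c \<omega> *\<^sub>R f \<omega>) \<tau>) \<in> borel_measurable M" by simp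
qed

lemma borel_measurable_matrix_vector_mult:
  fixes f :: "'a \<Rightarrow> real ^ 'n ^ 'm"
  assumes "f \<in> borel_measurable M" "g \<in> borel_measurable M"
  shows "(\<lambda>x. f x *v g x) \<in> borel_measurable M"
proof (rule borel_measurable_continuous_Pair[OF assms])
  show "continuous_on UNIV (\<lambda>x :: (real^'n^'m) \<times> (real^'n). fst x *v snd x)"
    by (intro continuous_on_matrix_vector_mult continuous_intros)
qed

lemma integral_eq_lebesgue:
  fixes F :: "real \<Rightarrow> 'b::euclidean_space"
  assumes "continuous_on {s..t} F"
  shows "integral {s..t} F = (LINT r|lborel. indicator {s..t} r *\<^sub>R F r)"
  using set_borel_integral_eq_integral(2)[OF borel_integrable_atLeastAtMost'[OF assms]]
  by (simp add: set_lebesgue_integral_def)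

lemma (in coop_delay) picard_tendsto_traj:
  assumes "-1 \<le> t" shows "(\<lambda>n. picard a b x n t) \<longlonglongrightarrow> traj a b x t"
proof (rule picard_limit[OF cont_a cont_b, where x = x])
  fix u assume "delay_sol a b x u" "\<And>t. (\<lambda>n. picard a b x n t) \<longlonglongrightarrow> u t"
  then show ?thesis using traj_eqI[OF _ assms, of x u] by simp
qed

section \<open>The random system: measurability and integrability along the flow\<close>

locale delay_mds = ergodic_mds M \<theta> for M :: "'a measure" and \<theta> :: "real \<Rightarrow> 'a \<Rightarrow> 'a" +
  fixes A B :: "'a \<Rightarrow> real ^ 'n::finite ^ 'n"
  assumes N2: "CARD('n) \<ge> 2" and OA0: "OA0 M \<theta> A B" and OA1: "OA1 M A B" and OA2: "OA2 M A B"
begin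

lemma A_measurable [measurable]: "A \<in> borel_measurable M"
  and B_measurable [measurable]: "B \<in> borel_measurable M"
  using OA0 by (auto simp: OA0_def)

lemma coop_delay: "\<omega> \<in> space M \<Longrightarrow> coop_delay (\<lambda>t. A (\<theta> t \<omega>)) (\<lambda>t. B (\<theta> t \<omega>))"
  using OA0 OA1 flow_space by (auto simp: coop_delay_def OA0_def OA1_def)

lemma joint_flow_measurable: "f \<in> borel_measurable M \<Longrightarrow> (\<lambda>x. f (\<theta> (fst x) (snd x))) \<in> borel_measurable (borel \<Otimes>\<^sub>M M)"
  using measurable_compose[OF joint_measurable, of f] by (simp add: case_prod_beta')

text \<open>Joint measurability in time and \<omega> is the right induction statement, since the
  next iterate integrates over time. Continuity in time for each fixed \<omega> allows the Lebesgue
  integral to replace the gauge integral.\<close>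

lemma picard_measurable:
  "(\<lambda>x. picard (\<lambda>t. A (\<theta> t (snd x))) (\<lambda>t. B (\<theta> t (snd x))) v n (fst x)) \<in> borel_measurable (borel \<Otimes>\<^sub>M M)"
proof (induction n)
  case 0
  have "lag_extend v \<in> borel_measurable borel"
    by (rule borel_measurable_continuous_onI[OF continuous_on_lag_extend])
  then show ?case by simp
next
  case (Suc n)
  let ?p = "\<lambda>\<omega>. picard (\<lambda>t. A (\<theta> t \<omega>)) (\<lambda>t. B (\<theta> t \<omega>)) v n"
  let ?F = "\<lambda>\<omega> s. A (\<theta> s \<omega>) *v ?p \<omega> s + B (\<theta> s \<omega>) *v ?p \<omega> (s - 1)"
  have le[measurable]: "lag_extend v \<in> borel_measurable borel"
    by (rule borel_measurable_continuous_onI[OF continuous_on_lag_extend])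
  have sh: "(\<lambda>x :: real \<times> 'a. (fst x - 1, snd x)) \<in> borel \<Otimes>\<^sub>M M \<rightarrow>\<^sub>M borel \<Otimes>\<^sub>M M" by measurable
  have F: "(\<lambda>x. ?F (snd x) (fst x)) \<in> borel_measurable (borel \<Otimes>\<^sub>M M)"
    using measurable_compose[OF sh Suc]
    by (intro borel_measurable_add borel_measurable_matrix_vector_mult joint_flow_measurable Suc) auto
  have m: "(\<lambda>y :: (real \<times> 'a) \<times> real. (snd y, snd (fst y))) \<in> (borel \<Otimes>\<^sub>M M) \<Otimes>\<^sub>M lborel \<rightarrow>\<^sub>M borel \<Otimes>\<^sub>M M"
    by measurable
  have F': "(\<lambda>y :: (real \<times> 'a) \<times> real. ?F (snd (fst y)) (snd y)) \<in> borel_measurable ((borel \<Otimes>\<^sub>M M) \<Otimes>\<^sub>M lborel)"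
    using measurable_compose[OF m F] by simp
  have ind: "(\<lambda>y :: (real \<times> 'a) \<times> real. indicator {0..fst (fst y)} (snd y) :: real) \<in> borel_measurable ((borel \<Otimes>\<^sub>M M) \<Otimes>\<^sub>M lborel)"
    by (rule borel_measurable_indicator') (simp only: atLeastAtMost_iff, measurable)
  have "case_prod (\<lambda>x r. indicator {0..fst x} r *\<^sub>R ?F (snd x) r) \<in> borel_measurable ((borel \<Otimes>\<^sub>M M) \<Otimes>\<^sub>M lborel)"
    unfolding case_prod_beta' by (rule borel_measurable_scaleR[OF ind F'])
  note int = lborel.borel_measurable_lebesgue_integral[OF this]
  have "(\<lambda>x. lag_extend v (fst x) + (LINT r|lborel. indicator {0..fst x} r *\<^sub>R ?F (snd x) r))
      \<in> borel_measurable (borel \<Otimes>\<^sub>M M)"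
    by (rule borel_measurable_add[OF _ int]) measurable
  moreover have "picard (\<lambda>t. A (\<theta> t (snd x))) (\<lambda>t. B (\<theta> t (snd x))) v (Suc n) (fst x)
      = lag_extend v (fst x) + (LINT r|lborel. indicator {0..fst x} r *\<^sub>R ?F (snd x) r)"
    if "x \<in> space (borel \<Otimes>\<^sub>M M)" for x
  proof -
    have "snd x \<in> space M" using that by (auto simp: space_pair_measure)
    then interpret c: coop_delay "\<lambda>t. A (\<theta> t (snd x))" "\<lambda>t. B (\<theta> t (snd x))" by (rule coop_delay)
    have "continuous_on {0..fst x} (?F (snd x))"
      by (rule continuous_on_delay_rhs[OF c.cont_a c.cont_b continuous_picard[OF c.cont_a c.cont_b]])
    from integral_eq_lebesgue[OF this] show ?thesis by simp
  qed
  ultimately show ?case by (subst measurable_cong)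
qed

lemma traj_measurable:
  assumes "-1 \<le> t"
  shows "(\<lambda>\<omega>. traj (\<lambda>t. A (\<theta> t \<omega>)) (\<lambda>t. B (\<theta> t \<omega>)) v t) \<in> borel_measurable M"
proof (rule borel_measurable_LIMSEQ_metric)
  fix n
  have "(\<lambda>\<omega>. (t, \<omega>)) \<in> M \<rightarrow>\<^sub>M borel \<Otimes>\<^sub>M M" by measurable
  from measurable_compose[OF this picard_measurable[of v n]]
  show "(\<lambda>\<omega>. picard (\<lambda>t. A (\<theta> t \<omega>)) (\<lambda>t. B (\<theta> t \<omega>)) v n t) \<in> borel_measurable M" by simp
next
  fix \<omega> assume "\<omega> \<in> space M"
  then interpret c: coop_delay "\<lambda>t. A (\<theta> t \<omega>)" "\<lambda>t. B (\<theta> t \<omega>)" by (rule coop_delay)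
  show "(\<lambda>n. picard (\<lambda>t. A (\<theta> t \<omega>)) (\<lambda>t. B (\<theta> t \<omega>)) v n t) \<longlonglongrightarrow> traj (\<lambda>t. A (\<theta> t \<omega>)) (\<lambda>t. B (\<theta> t \<omega>)) v t"
    by (rule c.picard_tendsto_traj[OF assms])
qed

abbreviation U where "U \<equiv> delay_semiflow \<theta> A B"

lemma U_measurable:
  assumes t: "0 \<le> t" shows "(\<lambda>\<omega>. U \<omega> t v) \<in> borel_measurable M"
proof (rule borel_measurable_phaseI)
  fix \<tau>
  have "apply_bcontfun (U \<omega> t v) \<tau> = traj (\<lambda>t. A (\<theta> t \<omega>)) (\<lambda>t. B (\<theta> t \<omega>)) v (t + lag_time \<tau>)"
    if "\<omega> \<in> space M" for \<omega>
    using coop_delay.flow_apply[OF coop_delay[OF that] t] by (simp add: delay_semiflow_eq_flow)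
  then show "(\<lambda>\<omega>. apply_bcontfun (U \<omega> t v) \<tau>) \<in> borel_measurable M"
    using traj_measurable[OF lag_shift_ge[OF t]] by (subst measurable_cong) auto
qed

lemma U_cocycle:
  assumes \<omega>: "\<omega> \<in> space M" and st: "0 \<le> s" "0 \<le> t"
  shows "U \<omega> (t + s) x = U (\<theta> s \<omega>) t (U \<omega> s x)"
  using coop_delay.flow_cocycle[OF coop_delay[OF \<omega>] st] flow_add[OF \<omega>]
  by (simp add: delay_semiflow_eq_flow)

lemma U_linear: "\<omega> \<in> space M \<Longrightarrow> 0 \<le> t \<Longrightarrow> linear (U \<omega> t)"
  using coop_delay.linear_flow[OF coop_delay] by (simp add: delay_semiflow_eq_flow[abs_def])

lemma U_bounded_linear: "\<omega> \<in> space M \<Longrightarrow> 0 \<le> t \<Longrightarrow> bounded_linear (U \<omega> t)"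
  using coop_delay.bounded_linear_flow[OF coop_delay] by (simp add: delay_semiflow_eq_flow[abs_def])

lemma U_mono: "\<omega> \<in> space M \<Longrightarrow> 0 \<le> t \<Longrightarrow> x \<preceq> y \<Longrightarrow> U \<omega> t x \<preceq> U \<omega> t y"
  using coop_delay.flow_mono[OF coop_delay] by (simp add: delay_semiflow_eq_flow)

lemma U_zero: "\<omega> \<in> space M \<Longrightarrow> U \<omega> 0 x = x"
  using coop_delay.flow_zero[OF coop_delay] by (simp add: delay_semiflow_eq_flow)

lemma flow_integral_measurable:
  fixes g :: "'a \<Rightarrow> real"
  assumes g[measurable]: "g \<in> borel_measurable M"
    and c: "\<And>\<omega>. \<omega> \<in> space M \<Longrightarrow> continuous_on UNIV (\<lambda>t. g (\<theta> t \<omega>))"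
  shows "(\<lambda>\<omega>. integral {s..t} (\<lambda>r. g (\<theta> r \<omega>))) \<in> borel_measurable M"
proof -
  have m: "(\<lambda>y. (snd y, fst y)) \<in> M \<Otimes>\<^sub>M lborel \<rightarrow>\<^sub>M borel \<Otimes>\<^sub>M M" by measurable
  have "(\<lambda>y. g (\<theta> (snd y) (fst y))) \<in> borel_measurable (M \<Otimes>\<^sub>M lborel)"
    using measurable_compose[OF m joint_flow_measurable[OF g]] by simp
  then have "case_prod (\<lambda>\<omega> r. indicator {s..t} r *\<^sub>R g (\<theta> r \<omega>)) \<in> borel_measurable (M \<Otimes>\<^sub>M lborel)"
    unfolding case_prod_beta' by (rule borel_measurable_scaleR[rotated]) measurable
  from lborel.borel_measurable_lebesgue_integral[OF this]
  show ?thesis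
  proof (rule measurable_cong[THEN iffD1, rotated])
    fix \<omega> assume "\<omega> \<in> space M"
    then show "(LINT r|lborel. indicator {s..t} r *\<^sub>R g (\<theta> r \<omega>)) = integral {s..t} (\<lambda>r. g (\<theta> r \<omega>))"
      by (intro integral_eq_lebesgue[symmetric] continuous_on_subset[OF c]) auto
  qed
qed

text \<open>By Tonelli and invariance of the measure the expectation of the time integral equals
  that of \<open>g\<close>.\<close>

lemma flow_integral_integrable:
  fixes g :: "'a \<Rightarrow> real"
  assumes g: "integrable M g" and g0: "\<And>\<omega>. \<omega> \<in> space M \<Longrightarrow> 0 \<le> g \<omega>"
    and c: "\<And>\<omega>. \<omega> \<in> space M \<Longrightarrow> continuous_on UNIV (\<lambda>t. g (\<theta> t \<omega>))"
  shows "integrable M (\<lambda>\<omega>. integral {0..1} (\<lambda>r. g (\<theta> r \<omega>)))"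
proof (rule integrableI_nonneg)
  have gm[measurable]: "g \<in> borel_measurable M" using g by simp
  show "(\<lambda>\<omega>. integral {0..1} (\<lambda>r. g (\<theta> r \<omega>))) \<in> borel_measurable M"
    by (rule flow_integral_measurable[OF gm c])
  show "AE \<omega> in M. 0 \<le> integral {0..1} (\<lambda>r. g (\<theta> r \<omega>))"
    by (intro AE_I2 integral_nonneg integrable_continuous_real continuous_on_subset[OF c] g0 flow_space) auto
  interpret P: pair_sigma_finite lborel M ..
  have m: "(\<lambda>y. (fst y, snd y)) \<in> lborel \<Otimes>\<^sub>M M \<rightarrow>\<^sub>M borel \<Otimes>\<^sub>M M" by measurable
  have "(\<lambda>y. g (\<theta> (fst y) (snd y))) \<in> borel_measurable (lborel \<Otimes>\<^sub>M M)"
    using measurable_compose[OF m joint_flow_measurable[OF gm]] by simp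
  then have jm: "case_prod (\<lambda>r \<omega>. ennreal (indicator {0..1} r * g (\<theta> r \<omega>))) \<in> borel_measurable (lborel \<Otimes>\<^sub>M M)"
    unfolding case_prod_beta'
    by (rule measurable_compose[OF borel_measurable_times[rotated] measurable_ennreal]) measurable
  have "(\<integral>\<^sup>+\<omega>. ennreal (integral {0..1} (\<lambda>r. g (\<theta> r \<omega>))) \<partial>M)
      = (\<integral>\<^sup>+\<omega>. (\<integral>\<^sup>+r. ennreal (indicator {0..1} r * g (\<theta> r \<omega>)) \<partial>lborel) \<partial>M)"
  proof (rule nn_integral_cong)
    fix \<omega> assume \<omega>: "\<omega> \<in> space M"
    have cc: "continuous_on {0..1} (\<lambda>r. g (\<theta> r \<omega>))" by (rule continuous_on_subset[OF c[OF \<omega>]]) auto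
    have "integrable lborel (\<lambda>r. indicator {0..1::real} r *\<^sub>R g (\<theta> r \<omega>))"
      using borel_integrable_atLeastAtMost'[OF cc] by (simp add: set_integrable_def)
    from nn_integral_eq_integral[OF this]
    show "ennreal (integral {0..1} (\<lambda>r. g (\<theta> r \<omega>))) = (\<integral>\<^sup>+r. ennreal (indicator {0..1} r * g (\<theta> r \<omega>)) \<partial>lborel)"
      using g0[OF flow_space[OF \<omega>]] by (simp add: integral_eq_lebesgue[OF cc])
  qed
  also have "\<dots> = (\<integral>\<^sup>+r. (\<integral>\<^sup>+\<omega>. ennreal (indicator {0..1} r * g (\<theta> r \<omega>)) \<partial>M) \<partial>lborel)"
    by (rule P.Fubini'[OF jm])
  also have "\<dots> = (\<integral>\<^sup>+r. (\<integral>\<^sup>+\<omega>. ennreal (g \<omega>) \<partial>M) * indicator {0..1::real} r \<partial>lborel)"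
  proof (rule nn_integral_cong)
    fix r :: real
    show "(\<integral>\<^sup>+\<omega>. ennreal (indicator {0..1} r * g (\<theta> r \<omega>)) \<partial>M) = (\<integral>\<^sup>+\<omega>. ennreal (g \<omega>) \<partial>M) * indicator {0..1} r"
      using nn_integral_flow[of "\<lambda>\<omega>. ennreal (g \<omega>)" r] by (simp split: split_indicator)
  qed
  also have "\<dots> = (\<integral>\<^sup>+\<omega>. ennreal (g \<omega>) \<partial>M)" by (subst nn_integral_cmult_indicator) auto
  also have "\<dots> < \<infinity>" using g by (simp add: real_integrable_def less_top)
  finally show "(\<integral>\<^sup>+\<omega>. ennreal (integral {0..1} (\<lambda>r. g (\<theta> r \<omega>))) \<partial>M) < \<infinity>" .
qed

definition g_up where "g_up \<omega> = up_rate (A \<omega>) (B \<omega>)"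

definition g_abs where "g_abs \<omega> = abs_rate (A \<omega>) (B \<omega>)"

lemma g_up_nonneg: "\<omega> \<in> space M \<Longrightarrow> 0 \<le> g_up \<omega>"
  using coop_delay.up_rate_nonneg[OF coop_delay, of \<omega> 0] by (simp add: g_up_def flow_zero)

lemma entry_measurable [measurable]:
  "(\<lambda>\<omega>. A \<omega> $ i $ j) \<in> borel_measurable M" "(\<lambda>\<omega>. B \<omega> $ i $ j) \<in> borel_measurable M"
proof -
  have "continuous_on UNIV (\<lambda>m :: real ^ 'n ^ 'n. m $ i $ j)" by (intro continuous_intros)
  then have "(\<lambda>m :: real ^ 'n ^ 'n. m $ i $ j) \<in> borel_measurable borel"
    by (rule borel_measurable_continuous_onI)
  then show "(\<lambda>\<omega>. A \<omega> $ i $ j) \<in> borel_measurable M" "(\<lambda>\<omega>. B \<omega> $ i $ j) \<in> borel_measurable M"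
    by (rule measurable_compose[rotated]; measurable)+
qed

lemma g_up_measurable [measurable]: "g_up \<in> borel_measurable M"
  and g_abs_measurable [measurable]: "g_abs \<in> borel_measurable M"
  unfolding g_up_def g_abs_def up_rate_def abs_rate_def absum_def by measurable

lemma g_up_continuous: "\<omega> \<in> space M \<Longrightarrow> continuous_on UNIV (\<lambda>t. g_up (\<theta> t \<omega>))"
  and g_abs_continuous: "\<omega> \<in> space M \<Longrightarrow> continuous_on UNIV (\<lambda>t. g_abs (\<theta> t \<omega>))"
  using coop_delay.continuous_up_rate[OF coop_delay] coop_delay.continuous_abs_rate[OF coop_delay]
  by (auto simp: g_up_def g_abs_def)

text \<open>(OA2) speaks of the maximal entries, not of their positive parts. As \<open>N\<close> is
  at least \<open>2\<close> there is an off-diagonal entry, which is nonnegative; so the maximum of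
  \<open>A\<close> is nonnegative and dominates the positive parts.\<close>

lemma g_up_integrable: "integrable M g_up"
proof (rule Bochner_Integration.integrable_bound)
  let ?a = "\<lambda>\<omega>. MAX (i, j). A \<omega> $ i $ j" and ?b = "\<lambda>\<omega>. MAX (i, j). B \<omega> $ i $ j"
  let ?h = "\<lambda>\<omega>. (real CARD('n))\<^sup>2 * (?a \<omega> + ?b \<omega>)"
  show "integrable M ?h" using OA2 by (auto simp: OA2_def)
  show "AE \<omega> in M. norm (g_up \<omega>) \<le> norm (?h \<omega>)"
  proof (rule AE_I2)
    fix \<omega> assume \<omega>: "\<omega> \<in> space M"
    have a: "A \<omega> $ i $ j \<le> ?a \<omega>" for i j by (rule Max_ge) auto
    have b: "B \<omega> $ i $ j \<le> ?b \<omega>" for i j by (rule Max_ge) auto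
    obtain i j :: 'n where ij: "i \<noteq> j" using N2 by (metis card_2_iff' ex_card UNIV_I)
    then have a0: "0 \<le> ?a \<omega>" using OA1 \<omega> a[of i j] unfolding OA1_def by (meson order_trans)
    have "g_up \<omega> \<le> (\<Sum>i\<in>(UNIV::'n set). \<Sum>j\<in>(UNIV::'n set). ?a \<omega>) + (\<Sum>i\<in>(UNIV::'n set). \<Sum>j\<in>(UNIV::'n set). ?b \<omega>)"
      unfolding g_up_def up_rate_def using a b a0 by (intro add_mono sum_mono) auto
    also have "\<dots> = ?h \<omega>" by (simp add: power2_eq_square algebra_simps)
    finally show "norm (g_up \<omega>) \<le> norm (?h \<omega>)" using g_up_nonneg[OF \<omega>] by simp
  qed
qed measurable

lemma U_norm_upper:
  assumes "\<omega> \<in> space M" "0 \<preceq> x" "0 \<le> t"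
  shows "norm (U \<omega> t x) \<le> (real CARD('n))\<^sup>2 * exp (integral {0..t} (\<lambda>s. g_up (\<theta> s \<omega>))) * norm x"
  using coop_delay.flow_norm_upper[OF coop_delay[OF assms(1)] assms(2,3)]
  by (simp add: delay_semiflow_eq_flow g_up_def)

end

section \<open>Projective contraction\<close>

text \<open>\<open>prox r x y\<close> bounds the Hilbert projective distance of \<open>x\<close> and \<open>y\<close> by \<open>ln (1 + r)\<close>.\<close>

definition prox :: "real \<Rightarrow> 'n::finite phase \<Rightarrow> 'n phase \<Rightarrow> bool" where
  "prox r x y \<longleftrightarrow> (\<exists>m>0. m *\<^sub>R y \<preceq> x \<and> x \<preceq> (m * (1 + r)) *\<^sub>R y)"

text \<open>Interior points of the cone, expressed through the order unit.\<close>

definition strictly_pos :: "'n::finite phase \<Rightarrow> bool" where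
  "strictly_pos x \<longleftrightarrow> (\<exists>\<alpha>>0. \<alpha> *\<^sub>R one_phase \<preceq> x)"

lemma one_phase_nonneg: "0 \<preceq> one_phase"
  by (simp add: phase_le_def)

lemma strictly_pos_one: "strictly_pos one_phase"
  unfolding strictly_pos_def by (rule exI[of _ 1]) (simp add: phase_le_def)

lemma strictly_pos_nonneg: "strictly_pos x \<Longrightarrow> 0 \<preceq> x"
  unfolding strictly_pos_def phase_le_def by (auto intro: order_trans[OF less_imp_le])

lemma norm_phase_le: "0 \<preceq> x \<Longrightarrow> x \<preceq> y \<Longrightarrow> norm x \<le> norm y"
  by (rule norm_phase_mono) (simp add: phase_le_def)

lemma strictly_pos_norm: assumes "strictly_pos (x :: 'n::finite phase)" shows "0 < norm x"
proof -
  obtain \<alpha> where \<alpha>: "0 < \<alpha>" "\<alpha> *\<^sub>R one_phase \<preceq> x" using assms by (auto simp: strictly_pos_def)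
  have "0 < apply_bcontfun x (Lag 0) $ (undefined :: 'n)"
    using \<alpha> unfolding phase_le_def by (auto intro: less_le_trans)
  then show ?thesis using abs_phase_le_norm[of x "Lag 0" undefined] by linarith
qed

lemma prox_mono:
  assumes "prox r x y" "r \<le> r'" "0 \<preceq> y" shows "prox r' x y"
proof -
  obtain m where m: "m > 0" "m *\<^sub>R y \<preceq> x" "x \<preceq> (m * (1 + r)) *\<^sub>R y"
    using assms(1) by (auto simp: prox_def)
  have "(m * (1 + r)) *\<^sub>R y \<preceq> (m * (1 + r')) *\<^sub>R y"
    using m assms by (intro phase_le_scaleR_left) auto
  with m show ?thesis unfolding prox_def by (blast intro: phase_le_trans)
qed

text \<open>The upper half of \<open>prox\<close> bounds \<open>norm x\<close> by
  \<open>m * (1 + r) * norm y\<close>; dividing the lower half by it cancels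
  \<open>m\<close>.\<close>

lemma normalize_lower:
  assumes p: "prox r x y" and r: "0 \<le> r" and x: "strictly_pos x" and y: "strictly_pos y"
  shows "(1 / (1 + r)) *\<^sub>R (y /\<^sub>R norm y) \<preceq> x /\<^sub>R norm x"
proof -
  obtain m where m: "m > 0" "m *\<^sub>R y \<preceq> x" "x \<preceq> (m * (1 + r)) *\<^sub>R y"
    using p by (auto simp: prox_def)
  have nx: "0 < norm x" and ny: "0 < norm y" using strictly_pos_norm x y by auto
  have "norm x \<le> norm ((m * (1 + r)) *\<^sub>R y)" by (rule norm_phase_le[OF strictly_pos_nonneg[OF x] m(3)])
  then have 2: "norm x \<le> m * (1 + r) * norm y" using m r by simp
  have "(1 / (1 + r)) *\<^sub>R (y /\<^sub>R norm y) = (inverse (m * (1 + r) * norm y)) *\<^sub>R (m *\<^sub>R y)"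
    using m by (simp add: divide_inverse mult_ac)
  also have "\<dots> \<preceq> inverse (norm x) *\<^sub>R (m *\<^sub>R y)"
    using 2 nx m strictly_pos_nonneg[OF y]
    by (intro phase_le_scaleR_left le_imp_inverse_le) (auto intro!: phase_le_scaleR[of 0, simplified])
  also have "\<dots> \<preceq> x /\<^sub>R norm x" using nx by (intro phase_le_scaleR m) auto
  finally show ?thesis .
qed

text \<open>Passage from projective to norm distance: after normalization the quotient of the two
  functions lies between \<open>1 / (1 + r)\<close> and \<open>1 + r\<close> pointwise, and the norm
  is monotone on the cone.\<close>

lemma normalize_close:
  assumes p: "prox r x y" and r: "0 \<le> r" and x: "strictly_pos x" and y: "strictly_pos y"
  shows "norm (x /\<^sub>R norm x - y /\<^sub>R norm y) \<le> r"
proof -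
  obtain m where m: "m > 0" "m *\<^sub>R y \<preceq> x" "x \<preceq> (m * (1 + r)) *\<^sub>R y"
    using p by (auto simp: prox_def)
  note y0 = strictly_pos_nonneg[OF y] and x0 = strictly_pos_nonneg[OF x]
  have nx: "0 < norm x" and ny: "0 < norm y" using strictly_pos_norm x y by auto
  have "0 \<preceq> m *\<^sub>R y" using phase_le_scaleR[OF y0, of m] m by simp
  from norm_phase_le[OF this m(2)] have 1: "m * norm y \<le> norm x" using m by simp
  have "norm (x /\<^sub>R norm x - y /\<^sub>R norm y) \<le> norm (r *\<^sub>R (y /\<^sub>R norm y))"
  proof (rule norm_phase_mono)
    fix \<tau> i
    define X Y where "X = apply_bcontfun x \<tau> $ i" and "Y = apply_bcontfun y \<tau> $ i"
    have XY: "m * Y \<le> X" "X \<le> m * (1 + r) * Y" "0 \<le> Y" "0 \<le> X"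
      using m y0 x0 unfolding phase_le_def X_def Y_def by auto
    have "X / norm x \<le> (m * (1 + r) * Y) / (m * norm y)"
      using XY m r ny 1 by (intro frac_le) auto
    then have up: "X / norm x \<le> (1 + r) * (Y / norm y)" using m by simp
    have "Y / norm y / (1 + r) \<le> X / norm x"
      using normalize_lower[OF p r x y]
      unfolding phase_le_def X_def Y_def by (simp add: divide_inverse mult_ac)
    \<comment> \<open>Makes the lower deviation symmetric to the upper one, so that both are at most
      \<open>r\<close> times the normalized \<open>y\<close>.\<close>
    moreover have "(1 - r) * Z \<le> Z / (1 + r)" if "0 \<le> Z" for Z
    proof -
      have "(1 - r) * (1 + r) \<le> 1" using r by (simp add: algebra_simps)
      then have "(1 - r) * (1 + r) * Z \<le> 1 * Z"
        using that by (rule mult_right_mono)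
      then show ?thesis using r by (subst pos_le_divide_eq) (simp_all add: mult_ac)
    qed
    then have "(1 - r) * (Y / norm y) \<le> Y / norm y / (1 + r)"
      by this (use XY in simp)
    ultimately have low: "(1 - r) * (Y / norm y) \<le> X / norm x" by (rule order_trans[rotated])
    have "\<bar>V - Z\<bar> \<le> r * Z" if "(1 - r) * Z \<le> V" "V \<le> (1 + r) * Z" for V Z
      using that by (auto simp: abs_le_iff algebra_simps)
    from this[OF low up] have "\<bar>X / norm x - Y / norm y\<bar> \<le> r * (Y / norm y)" .
    then show "\<bar>apply_bcontfun (x /\<^sub>R norm x - y /\<^sub>R norm y) \<tau> $ i\<bar> \<le> apply_bcontfun (r *\<^sub>R (y /\<^sub>R norm y)) \<tau> $ i"
      by (simp add: X_def Y_def divide_inverse mult_ac)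
  qed
  also have "\<dots> = r" using r ny by simp
  finally show ?thesis .
qed

lemma focus_const_ge_1: "0 < N \<Longrightarrow> 0 \<le> h \<Longrightarrow> 1 \<le> focus_const N h \<delta>"
  unfolding focus_const_def by (intro mult_ge1_I one_le_power) auto

section \<open>One focusing step as a projective contraction\<close>

locale focusing_mds = delay_mds M \<theta> A B
  for M :: "'a measure" and \<theta> and A B :: "'a \<Rightarrow> real ^ 'n::finite ^ 'n" +
  fixes \<delta> :: "'a \<Rightarrow> real"
  assumes \<delta>_pos: "positive_measurable M \<delta>" and OA3_i: "OA3_i M \<theta> B \<delta>"
begin

definition T :: real where "T = real CARD('n) + 2"

definition \<kappa> :: "'a \<Rightarrow> real" where
  "\<kappa> \<omega> = focus_const CARD('n) (integral {0..T} (\<lambda>r. g_abs (\<theta> r \<omega>))) (\<delta> \<omega>)"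

lemma T_pos: "0 < T" by (simp add: T_def)

lemma \<kappa>_ge_1: assumes "\<omega> \<in> space M" shows "1 \<le> \<kappa> \<omega>"
  unfolding \<kappa>_def
  by (intro focus_const_ge_1 integral_nonneg integrable_continuous_real
      continuous_on_subset[OF g_abs_continuous[OF assms]]) (auto simp: g_abs_def abs_rate_nonneg)

lemma \<kappa>_measurable [measurable]: "\<kappa> \<in> borel_measurable M"
proof -
  have [measurable]: "\<delta> \<in> borel_measurable M" using \<delta>_pos by (simp add: positive_measurable_def)
  note flow_integral_measurable[OF g_abs_measurable g_abs_continuous, measurable]
  show ?thesis unfolding \<kappa>_def focus_const_def by measurable
qed

lemma U_focusing:
  assumes "\<omega> \<in> space M" "0 \<preceq> x"
  obtains \<alpha> where "0 \<le> \<alpha>" "\<alpha> *\<^sub>R one_phase \<preceq> U \<omega> T x" "U \<omega> T x \<preceq> (\<kappa> \<omega> * \<alpha>) *\<^sub>R one_phase"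
proof -
  have \<delta>: "0 < \<delta> \<omega>" using assms \<delta>_pos by (simp add: positive_measurable_def)
  have p: "path_condition (\<delta> \<omega>) (\<lambda>t. B (\<theta> t \<omega>))"
    using OA3_i assms(1) unfolding OA3_i_def path_condition_def by blast
  from coop_delay.focusing[OF coop_delay[OF assms(1)] assms(2) \<delta> p N2]
  show thesis using that
    unfolding delay_semiflow_eq_flow \<kappa>_def T_def g_abs_def by blast
qed

lemma U_one_ge:
  assumes "\<omega> \<in> space M" "0 \<le> t" shows "strictly_pos (U \<omega> t one_phase)"
  using coop_delay.flow_one_ge[OF coop_delay[OF assms(1)] assms(2)]
  unfolding strictly_pos_def delay_semiflow_eq_flow by blast

lemma U_scaleR: "\<omega> \<in> space M \<Longrightarrow> 0 \<le> t \<Longrightarrow> U \<omega> t (c *\<^sub>R x) = c *\<^sub>R U \<omega> t x"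
  by (rule linear_scale[OF U_linear])

lemma U_nonneg: "\<omega> \<in> space M \<Longrightarrow> 0 \<le> t \<Longrightarrow> 0 \<preceq> x \<Longrightarrow> 0 \<preceq> U \<omega> t x"
  using U_mono[of \<omega> t 0 x] linear_0[OF U_linear] by simp

lemma U_strictly_pos:
  assumes \<omega>: "\<omega> \<in> space M" and t: "0 \<le> t" and x: "strictly_pos x"
  shows "strictly_pos (U \<omega> t x)"
proof -
  obtain \<alpha> where \<alpha>: "0 < \<alpha>" "\<alpha> *\<^sub>R one_phase \<preceq> x" using x by (auto simp: strictly_pos_def)
  obtain \<beta> where \<beta>: "0 < \<beta>" "\<beta> *\<^sub>R one_phase \<preceq> U \<omega> t one_phase"
    using U_one_ge[OF \<omega> t] by (auto simp: strictly_pos_def)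
  have "(\<alpha> * \<beta>) *\<^sub>R one_phase \<preceq> \<alpha> *\<^sub>R U \<omega> t one_phase"
    using phase_le_scaleR[OF \<beta>(2), of \<alpha>] \<alpha> by simp
  also have "\<dots> \<preceq> U \<omega> t x" using U_mono[OF \<omega> t \<alpha>(2)] U_scaleR[OF \<omega> t] by simp
  finally show ?thesis using \<alpha> \<beta> unfolding strictly_pos_def by (intro exI[of _ "\<alpha> * \<beta>"]) simp
qed

lemma prox_U:
  assumes \<omega>: "\<omega> \<in> space M" and t: "0 \<le> t" and "prox r x y"
  shows "prox r (U \<omega> t x) (U \<omega> t y)"
proof -
  obtain m where m: "m > 0" "m *\<^sub>R y \<preceq> x" "x \<preceq> (m * (1 + r)) *\<^sub>R y"
    using assms(3) by (auto simp: prox_def)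
  show ?thesis unfolding prox_def
    using m(1) U_mono[OF \<omega> t m(2)] U_mono[OF \<omega> t m(3)] U_scaleR[OF \<omega> t] by auto
qed

text \<open>Both images lie within the factor \<open>\<kappa> \<omega>\<close> of multiples of
  \<open>one_phase\<close>, hence within its square of each other, whatever \<open>x\<close> and
  \<open>y\<close> were. This is the finite initial distance from which contraction starts.\<close>

lemma prox_first:
  assumes \<omega>: "\<omega> \<in> space M" and x: "strictly_pos x" and y: "strictly_pos y"
  shows "prox ((\<kappa> \<omega>)\<^sup>2 - 1) (U \<omega> T x) (U \<omega> T y)"
proof -
  have T0: "0 \<le> T" using T_pos by simp
  have k: "1 \<le> \<kappa> \<omega>" by (rule \<kappa>_ge_1[OF \<omega>])
  have foc: "\<exists>\<alpha>>0. \<alpha> *\<^sub>R one_phase \<preceq> U \<omega> T z \<and> U \<omega> T z \<preceq> (\<kappa> \<omega> * \<alpha>) *\<^sub>R one_phase" if z: "strictly_pos z" for z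
  proof -
    obtain \<alpha> where \<alpha>: "0 \<le> \<alpha>" "\<alpha> *\<^sub>R one_phase \<preceq> U \<omega> T z" "U \<omega> T z \<preceq> (\<kappa> \<omega> * \<alpha>) *\<^sub>R one_phase"
      using U_focusing[OF \<omega> strictly_pos_nonneg[OF z]] by blast
    \<comment> \<open>With \<open>\<alpha> = 0\<close> the image would vanish, but strict positivity
      is preserved by the flow.\<close>
    moreover have "\<alpha> \<noteq> 0"
    proof
      assume "\<alpha> = 0"
      then have "norm (U \<omega> T z) \<le> norm (0 :: 'n phase)"
        using \<alpha> by (intro norm_phase_le) auto
      then show False using strictly_pos_norm[OF U_strictly_pos[OF \<omega> T0 z]] by simp
    qed
    ultimately show ?thesis by (intro exI[of _ \<alpha>]) auto
  qed
  obtain \<alpha> where \<alpha>: "0 < \<alpha>" "\<alpha> *\<^sub>R one_phase \<preceq> U \<omega> T x" "U \<omega> T x \<preceq> (\<kappa> \<omega> * \<alpha>) *\<^sub>R one_phase"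
    using foc[OF x] by blast
  obtain \<beta> where \<beta>: "0 < \<beta>" "\<beta> *\<^sub>R one_phase \<preceq> U \<omega> T y" "U \<omega> T y \<preceq> (\<kappa> \<omega> * \<beta>) *\<^sub>R one_phase"
    using foc[OF y] by blast
  define m where "m = \<alpha> / (\<kappa> \<omega> * \<beta>)"
  have m: "0 < m" using \<alpha> \<beta> k by (simp add: m_def)
  have "m *\<^sub>R U \<omega> T y \<preceq> (m * (\<kappa> \<omega> * \<beta>)) *\<^sub>R one_phase"
    using phase_le_scaleR[OF \<beta>(3), of m] m by simp
  also have "m * (\<kappa> \<omega> * \<beta>) = \<alpha>" using \<beta> k by (simp add: m_def)
  also note \<alpha>(2)
  finally have 1: "m *\<^sub>R U \<omega> T y \<preceq> U \<omega> T x" .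
  note \<alpha>(3)
  also have "(\<kappa> \<omega> * \<alpha>) *\<^sub>R (one_phase :: 'n phase) = (\<kappa> \<omega> * \<alpha> / \<beta>) *\<^sub>R (\<beta> *\<^sub>R one_phase)"
    using \<beta> by simp
  also have "\<dots> \<preceq> (\<kappa> \<omega> * \<alpha> / \<beta>) *\<^sub>R U \<omega> T y"
    using \<alpha> \<beta> k by (intro phase_le_scaleR) auto
  also have "\<kappa> \<omega> * \<alpha> / \<beta> = m * (1 + ((\<kappa> \<omega>)\<^sup>2 - 1))"
    using k by (simp add: m_def power2_eq_square)
  finally show ?thesis unfolding prox_def using m 1 by blast
qed

text \<open>The differences \<open>?P\<close> and \<open>?Q\<close> are nonnegative with sum
  \<open>(m * r) *\<^sub>R y\<close>. Focusing leaves at least \<open>\<alpha>\<close> and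
  \<open>\<beta>\<close> multiples of \<open>one_phase\<close> below their images, and
  \<open>one_phase\<close> in turn dominates \<open>b *\<^sub>R U \<omega> T y\<close>. So the lower
  scalar rises by \<open>\<alpha> * b\<close>, the upper one falls by \<open>\<beta> * b\<close>,
  and the gap \<open>m * r\<close> shrinks by its part \<open>1 / \<kappa> \<omega>\<close>.\<close>

lemma prox_contract:
  assumes \<omega>: "\<omega> \<in> space M" and r: "0 \<le> r" and p: "prox r x y" and y: "0 \<preceq> y"
  shows "prox ((1 - 1 / \<kappa> \<omega>) * r) (U \<omega> T x) (U \<omega> T y)"
proof -
  have T0: "0 \<le> T" using T_pos by simp
  have k: "1 \<le> \<kappa> \<omega>" by (rule \<kappa>_ge_1[OF \<omega>])
  obtain m where m: "m > 0" "m *\<^sub>R y \<preceq> x" "x \<preceq> (m * (1 + r)) *\<^sub>R y"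
    using p by (auto simp: prox_def)
  let ?P = "x - m *\<^sub>R y" and ?Q = "(m * (1 + r)) *\<^sub>R y - x"
  have P: "0 \<preceq> ?P" and Q: "0 \<preceq> ?Q" using m phase_le_diff by blast+
  obtain \<alpha> where \<alpha>: "0 \<le> \<alpha>" "\<alpha> *\<^sub>R one_phase \<preceq> U \<omega> T ?P" "U \<omega> T ?P \<preceq> (\<kappa> \<omega> * \<alpha>) *\<^sub>R one_phase"
    using U_focusing[OF \<omega> P] by blast
  obtain \<beta> where \<beta>: "0 \<le> \<beta>" "\<beta> *\<^sub>R one_phase \<preceq> U \<omega> T ?Q" "U \<omega> T ?Q \<preceq> (\<kappa> \<omega> * \<beta>) *\<^sub>R one_phase"
    using U_focusing[OF \<omega> Q] by blast
  note lin = linear_diff[OF U_linear[OF \<omega> T0]] U_scaleR[OF \<omega> T0]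
  define s where "s = \<alpha> + \<beta>"
  \<comment> \<open>The largest value that \<open>m * r * Y \<le> \<kappa> \<omega> * s\<close>
    allows in \<open>b * Y \<le> 1\<close>. If \<open>s = 0\<close>, the images of \<open>?P\<close>
    and \<open>?Q\<close> both vanish and nothing has to be gained.\<close>
  define b where "b = (if s = 0 then 0 else m * r / (\<kappa> \<omega> * s))"
  define m' where "m' = m + \<alpha> * b"
  have b: "0 \<le> b" using m r k \<alpha> \<beta> by (simp add: b_def s_def)
  have m': "m \<le> m'" using b \<alpha> by (simp add: m'_def)
  show ?thesis unfolding prox_def
  proof (intro exI[of _ m'] conjI)
    show "0 < m'" using m m' by simp
    have pt: "m' * Y \<le> X \<and> X \<le> m' * (1 + (1 - 1 / \<kappa> \<omega>) * r) * Y"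
      if "\<alpha> \<le> X - m * Y" "X - m * Y \<le> \<kappa> \<omega> * \<alpha>" "\<beta> \<le> m * (1 + r) * Y - X"
        "m * (1 + r) * Y - X \<le> \<kappa> \<omega> * \<beta>" "0 \<le> Y" for X Y :: real
    proof -
      have bY: "b * Y \<le> 1"
      proof (cases "s = 0")
        case False
        then have s: "0 < s" using \<alpha> \<beta> by (simp add: s_def)
        have "m * r * Y = (X - m * Y) + (m * (1 + r) * Y - X)" by (simp add: algebra_simps)
        also have "\<dots> \<le> \<kappa> \<omega> * \<alpha> + \<kappa> \<omega> * \<beta>" using that by linarith
        also have "\<dots> = \<kappa> \<omega> * s" by (simp add: s_def algebra_simps)
        finally show ?thesis using False s k by (simp add: b_def field_simps)
      qed (simp add: b_def)
      have sb: "s * b * Y = m * r / \<kappa> \<omega> * Y"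
      proof (cases "s = 0")
        case True
        then have "\<alpha> = 0" "\<beta> = 0" using \<alpha> \<beta> by (auto simp: s_def)
        then have "X - m * Y = 0" "m * (1 + r) * Y - X = 0" using that by auto
        then have "m * r * Y = 0" by (simp add: algebra_simps)
        then show ?thesis using True by auto
      qed (use k in \<open>simp add: b_def\<close>)
      have "\<alpha> * (b * Y) \<le> \<alpha> * 1" "\<beta> * (b * Y) \<le> \<beta> * 1"
        using bY \<alpha> \<beta> by (intro mult_left_mono; simp)+
      then have 1: "m' * Y \<le> X" and 2: "X \<le> m * (1 + r) * Y - \<beta> * b * Y"
        using that by (auto simp: m'_def algebra_simps)
      have "m * (1 + r) * Y - \<beta> * b * Y = m' * Y + m * r * Y - s * b * Y"
        by (simp add: m'_def s_def algebra_simps)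
      also have "\<dots> = m' * Y + m * ((1 - 1 / \<kappa> \<omega>) * r * Y)"
        unfolding sb using k by (simp add: algebra_simps)
      \<comment> \<open>\<open>prox\<close> measures the gap relative to the lower scalar, and that
        has grown from \<open>m\<close> to \<open>m'\<close>.\<close>
      also have "\<dots> \<le> m' * Y + m' * ((1 - 1 / \<kappa> \<omega>) * r * Y)"
        using m' k r that by (intro add_left_mono mult_right_mono mult_nonneg_nonneg) auto
      finally show ?thesis using 1 2 by (simp add: algebra_simps)
    qed
    have U_y: "0 \<preceq> U \<omega> T y" by (rule U_nonneg[OF \<omega> T0 y])
    have pt': "m' * (apply_bcontfun (U \<omega> T y) \<tau> $ i) \<le> apply_bcontfun (U \<omega> T x) \<tau> $ i \<and>
      apply_bcontfun (U \<omega> T x) \<tau> $ i \<le> m' * (1 + (1 - 1 / \<kappa> \<omega>) * r) * (apply_bcontfun (U \<omega> T y) \<tau> $ i)" for \<tau> i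
      using \<alpha>(2,3) \<beta>(2,3) U_y by (intro pt) (auto simp: phase_le_def lin)
    show "m' *\<^sub>R U \<omega> T y \<preceq> U \<omega> T x" "U \<omega> T x \<preceq> (m' * (1 + (1 - 1 / \<kappa> \<omega>) * r)) *\<^sub>R U \<omega> T y"
      using pt' by (auto simp: phase_le_def)
  qed
qed

section \<open>Pullback contraction along backward orbits\<close>

lemma flow_neg_add: "\<omega> \<in> space M \<Longrightarrow> \<theta> s (\<theta> t \<omega>) = \<theta> (s + t) \<omega>"
  by (simp add: flow_add)

lemma U_pullback:
  assumes \<omega>: "\<omega> \<in> space M" and st: "0 \<le> s" "s \<le> t"
  shows "U (\<theta> (- t) \<omega>) t x = U (\<theta> (- s) \<omega>) s (U (\<theta> (- t) \<omega>) (t - s) x)"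
  using U_cocycle[OF flow_space[OF \<omega>], of "t - s" s "- t" x] st
  by (simp add: flow_neg_add[OF \<omega>])

text \<open>Uniform over all strictly positive starting functions and over real times, so that
  images under earlier parts of the evolution may be inserted for \<open>x\<close> and
  \<open>y\<close>.\<close>

definition good :: "'a \<Rightarrow> bool" where
  "good \<omega> \<longleftrightarrow> (\<forall>\<epsilon>>0. \<exists>t0\<ge>0. \<forall>t\<ge>t0. \<forall>x y. strictly_pos x \<longrightarrow> strictly_pos y \<longrightarrow>
     prox \<epsilon> (U (\<theta> (- t) \<omega>) t x) (U (\<theta> (- t) \<omega>) t y))"

text \<open>Each visit of the backward orbit to \<open>{\<kappa> \<le> K}\<close> contracts by the factor \<open>1 - 1/K\<close>; the oldest
  visit provides the initial bound.\<close>

lemma goodI: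
  assumes \<omega>: "\<omega> \<in> space M" and K: "1 \<le> K"
    and rec: "\<And>m. \<exists>n\<ge>m. \<kappa> (\<theta> (- (real n * T)) \<omega>) \<le> K"
  shows "good \<omega>"
proof -
  let ?o = "\<lambda>n. \<theta> (- (real n * T)) \<omega>"
  \<comment> \<open>\<open>?P n\<close> leads from time \<open>- n * T\<close> to the present.
    \<open>?J n n'\<close> is what remains between one focusing block started at
    \<open>- n' * T\<close> and time \<open>- n * T\<close>.\<close>
  let ?P = "\<lambda>n. U (?o n) (real n * T)" and ?J = "\<lambda>n n'. U (?o (n' - 1)) (real (n' - 1) * T - real n * T)"
  have T0: "0 \<le> T" using T_pos by simp
  define q where "q = 1 - 1 / K"
  have q: "0 \<le> q" "q < 1" using K by (auto simp: q_def)
  have step: "prox (q * r) (U (?o n') T x) (U (?o n') T y)"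
    if "\<kappa> (?o n') \<le> K" "0 \<le> r" "prox r x y" "0 \<preceq> y" for n' r x y
  proof (rule prox_mono)
    have \<omega>': "?o n' \<in> space M" by (rule flow_space[OF \<omega>])
    show "prox ((1 - 1 / \<kappa> (?o n')) * r) (U (?o n') T x) (U (?o n') T y)"
      by (rule prox_contract[OF \<omega>' that(2-4)])
    show "(1 - 1 / \<kappa> (?o n')) * r \<le> q * r"
      unfolding q_def using that \<kappa>_ge_1[OF \<omega>'] by (intro mult_right_mono) (auto simp: frac_le)
    show "0 \<preceq> U (?o n') T y" by (rule U_nonneg[OF \<omega>' T0 that(4)])
  qed
  have split: "?P n' x = ?P n (?J n n' (U (?o n') T x))" if n: "n < n'" for n n' x
  proof -
    have r: "real (n' - 1) * T \<le> real n' * T" using n T0 by (intro mult_right_mono) auto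
    have r': "real n * T \<le> real (n' - 1) * T" using n T0 by (intro mult_right_mono) auto
    have d: "real n' * T - real (n' - 1) * T = T" using n by (simp add: of_nat_diff algebra_simps)
    have "?P n' x = U (?o (n' - 1)) (real (n' - 1) * T) (U (?o n') T x)"
      using U_pullback[OF \<omega> _ r, of x] T0 d by simp
    also have "\<dots> = ?P n (?J n n' (U (?o n') T x))"
      using U_pullback[OF \<omega> _ r'] T0 by simp
    finally show ?thesis .
  qed
  have inner: "prox r (?J n n' x) (?J n n' y)"
    and inner_nonneg: "0 \<preceq> y \<Longrightarrow> 0 \<preceq> ?J n n' y"
    if "n < n'" "prox r x y" for n n' :: nat and r x y
  proof -
    have "real n * T \<le> real (n' - 1) * T" using that T0 by (intro mult_right_mono) auto
    then show "prox r (?J n n' x) (?J n n' y)"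
      by (intro prox_U flow_space \<omega> that) auto
    show "0 \<preceq> ?J n n' y" if "0 \<preceq> y"
      using that \<open>real n * T \<le> real (n' - 1) * T\<close> by (intro U_nonneg flow_space \<omega>) auto
  qed
  \<comment> \<open>After \<open>k\<close> visits the factor is \<open>q ^ k\<close>; the starting
    time \<open>n\<close> depends on \<open>k\<close> alone, not on \<open>r\<close>,
    \<open>x\<close> or \<open>y\<close>. Between visits positivity keeps \<open>prox\<close> from
    growing.\<close>
  have contr: "\<exists>n::nat. \<forall>r\<ge>0. \<forall>x y. 0 \<preceq> y \<longrightarrow> prox r x y \<longrightarrow>
      prox (q ^ k * r) (?P n x) (?P n y)" for k
  proof (induction k)
    case 0
    show ?case by (rule exI[of _ 0]) (simp add: flow_zero[OF \<omega>] U_zero[OF \<omega>])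
  next
    case (Suc k)
    then obtain n :: nat where n: "\<And>r x y. 0 \<le> r \<Longrightarrow> 0 \<preceq> y \<Longrightarrow> prox r x y \<Longrightarrow>
      prox (q ^ k * r) (?P n x) (?P n y)"
      by blast
    obtain n' where n': "n' \<ge> Suc n" "\<kappa> (?o n') \<le> K" using rec by blast
    then have lt: "n < n'" by simp
    show ?case
    proof (rule exI[of _ n'], intro allI impI)
      fix r :: real and x y :: "'n phase" assume r: "0 \<le> r" and y: "0 \<preceq> y" and p: "prox r x y"
      have s: "prox (q * r) (U (?o n') T x) (U (?o n') T y)"
        by (rule step[OF n'(2) r p y])
      have s0: "0 \<preceq> U (?o n') T y"
        by (intro U_nonneg flow_space \<omega> T0 y)
      have "prox (q ^ k * (q * r)) (?P n' x) (?P n' y)"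
        unfolding split[OF lt]
        by (rule n[OF _ inner_nonneg[OF lt s s0] inner[OF lt s]]) (use q r in simp)
      moreover have "q ^ k * (q * r) = q ^ Suc k * r" by simp
      ultimately show "prox (q ^ Suc k * r) (?P n' x) (?P n' y)" by metis
    qed
  qed
  show ?thesis
    unfolding good_def
  proof (intro allI impI)
    fix \<epsilon> :: real assume e: "0 < \<epsilon>"
    have "(\<lambda>k. q ^ k * (K\<^sup>2 - 1)) \<longlonglongrightarrow> 0"
      using tendsto_mult_right[OF LIMSEQ_realpow_zero[OF q], of "K\<^sup>2 - 1"] by simp
    then have "\<forall>\<^sub>F k in sequentially. q ^ k * (K\<^sup>2 - 1) < \<epsilon>" using e by (rule order_tendstoD)
    then obtain k where k: "q ^ k * (K\<^sup>2 - 1) < \<epsilon>" by (auto simp: eventually_sequentially)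
    obtain n :: nat where n: "\<And>r x y. 0 \<le> r \<Longrightarrow> 0 \<preceq> y \<Longrightarrow> prox r x y \<Longrightarrow>
      prox (q ^ k * r) (?P n x) (?P n y)"
      using contr[of k] by blast
    obtain n' where n': "n' \<ge> Suc n" "\<kappa> (?o n') \<le> K" using rec by blast
    then have lt: "n < n'" by simp
    have \<omega>': "?o n' \<in> space M" by (rule flow_space[OF \<omega>])
    have K0: "0 \<le> K\<^sup>2 - 1" using K by simp
    show "\<exists>t0\<ge>0. \<forall>t\<ge>t0. \<forall>x y. strictly_pos x \<longrightarrow> strictly_pos y \<longrightarrow>
        prox \<epsilon> (U (\<theta> (- t) \<omega>) t x) (U (\<theta> (- t) \<omega>) t y)"
    proof (intro exI[of _ "real n' * T"] conjI allI impI)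
      show "0 \<le> real n' * T" using T0 by simp
      fix t and x y :: "'n phase" assume t: "real n' * T \<le> t" and x: "strictly_pos x" and y: "strictly_pos y"
      \<comment> \<open>Whatever happens before the oldest visit only has to preserve strict
        positivity, since \<open>prox_first\<close> bounds the distance after that visit uniformly.
        This gives uniformity in \<open>t\<close>.\<close>
      define x' y' where "x' = U (\<theta> (- t) \<omega>) (t - real n' * T) x" and "y' = U (\<theta> (- t) \<omega>) (t - real n' * T) y"
      have x': "strictly_pos x'" and y': "strictly_pos y'"
        unfolding x'_def y'_def using t x y by (auto intro!: U_strictly_pos flow_space \<omega>)
      have "prox (K\<^sup>2 - 1) (U (?o n') T x') (U (?o n') T y')"
      proof (rule prox_mono[OF prox_first[OF \<omega>' x' y']])
        show "(\<kappa> (?o n'))\<^sup>2 - 1 \<le> K\<^sup>2 - 1"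
          using n' \<kappa>_ge_1[OF \<omega>'] by (intro diff_right_mono power_mono) auto
        show "0 \<preceq> U (?o n') T y'" by (intro U_nonneg \<omega>' T0 strictly_pos_nonneg y')
      qed
      note s = this
      have s0: "0 \<preceq> U (?o n') T y'" by (intro U_nonneg \<omega>' T0 strictly_pos_nonneg y')
      have "prox (q ^ k * (K\<^sup>2 - 1)) (?P n' x') (?P n' y')"
        unfolding split[OF lt]
        by (rule n[OF K0 inner_nonneg[OF lt s s0] inner[OF lt s]])
      then have "prox \<epsilon> (?P n' x') (?P n' y')"
      proof (rule prox_mono)
        show "0 \<preceq> ?P n' y'"
          using T0 by (intro U_nonneg \<omega>' strictly_pos_nonneg y') simp
      qed (use k in simp)
      then show "prox \<epsilon> (U (\<theta> (- t) \<omega>) t x) (U (\<theta> (- t) \<omega>) t y)"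
        using U_pullback[OF \<omega> _ t, of x] U_pullback[OF \<omega> _ t, of y] T0 by (simp add: x'_def y'_def)
    qed
  qed
qed

text \<open>If all late visits have \<open>\<kappa> > K\<close>, so has the visit at time
  \<open>m\<close>; by invariance this has at most the probability of \<open>\<kappa> > K\<close>,
  for every \<open>m\<close>. That probability tends to \<open>0\<close> because
  \<open>\<kappa>\<close> is finite. The bound \<open>K\<close> may depend on \<omega>.\<close>

lemma AE_recurrence: "AE \<omega> in M. \<exists>K\<ge>1. \<forall>m. \<exists>n\<ge>m. \<kappa> (\<theta> (- (real n * T)) \<omega>) \<le> K"
proof -
  define E where "E K = {\<omega>\<in>space M. real K < \<kappa> \<omega>}" for K :: nat
  have E[measurable]: "E K \<in> sets M" for K unfolding E_def by measurable
  define D where "D K m = {\<omega>\<in>space M. \<forall>n\<ge>m. real K < \<kappa> (\<theta> (- (real n * T)) \<omega>)}" for K m :: nat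
  have D[measurable]: "D K m \<in> sets M" for K m unfolding D_def by measurable
  have D_le: "prob (D K m) \<le> prob (E K)" for K m
  proof -
    let ?f = "\<theta> (- (real m * T))"
    have "prob (D K m) \<le> prob (?f -` E K \<inter> space M)"
      by (rule finite_measure_mono) (auto simp: D_def E_def flow_space)
    also have "\<dots> = measure (distr M M ?f) (E K)" by (rule measure_distr[symmetric]) auto
    also have "\<dots> = prob (E K)" by (simp add: preserves)
    finally show ?thesis .
  qed
  have "prob (\<Inter>K. \<Union>m. D K m) \<le> prob (E K)" for K
  proof -
    have "(\<lambda>m. prob (D K m)) \<longlonglongrightarrow> prob (\<Union>m. D K m)"
      by (rule finite_Lim_measure_incseq) (auto simp: incseq_def D_def)
    then have "prob (\<Union>m. D K m) \<le> prob (E K)" by (rule LIMSEQ_le_const2) (use D_le in auto)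
    moreover have "prob (\<Inter>K. \<Union>m. D K m) \<le> prob (\<Union>m. D K m)"
      by (rule finite_measure_mono) auto
    ultimately show ?thesis by simp
  qed
  moreover have "(\<lambda>K. prob (E K)) \<longlonglongrightarrow> prob (\<Inter>K. E K)"
    by (rule finite_Lim_measure_decseq) (auto simp: decseq_def E_def)
  moreover have "(\<Inter>K. E K) = {}"
  proof -
    have "\<exists>K. \<omega> \<notin> E K" for \<omega> using real_arch_simple[of "\<kappa> \<omega>"] by (auto simp: E_def not_less)
    then show ?thesis by auto
  qed
  ultimately have "prob (\<Inter>K. \<Union>m. D K m) \<le> 0"
    using LIMSEQ_le_const[of "\<lambda>K. prob (E K)" 0 "prob (\<Inter>K. \<Union>m. D K m)"] by simp
  then have "prob (\<Inter>K. \<Union>m. D K m) = 0" using measure_nonneg[of M "\<Inter>K. \<Union>m. D K m"] by linarith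
  then have "AE \<omega> in M. \<omega> \<notin> (\<Inter>K. \<Union>m. D K m)" by (subst (asm) prob_eq_0) auto
  with AE_space show ?thesis
  proof eventually_elim
    case (elim \<omega>)
    then obtain K where "\<forall>m. \<omega> \<notin> D K m" by auto
    then have "\<forall>m. \<exists>n\<ge>m. \<kappa> (\<theta> (- (real n * T)) \<omega>) \<le> real K" using elim by (auto simp: D_def not_less)
    then show ?case by (intro exI[of _ "max 1 (real K)"]) (auto simp: le_max_iff_disj)
  qed
qed

lemma AE_good: "AE \<omega> in M. good \<omega>"
  using AE_recurrence AE_space by eventually_elim (auto intro: goodI)

text \<open>A long pullback at \<open>\<theta> s \<omega>\<close> is a pullback at \<omega> followed
  by the flow over \<open>s\<close>, under which \<open>prox\<close> does not grow.\<close>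

lemma good_shift:
  assumes \<omega>: "\<omega> \<in> space M" and g: "good \<omega>" and s: "0 \<le> s"
  shows "good (\<theta> s \<omega>)"
  unfolding good_def
proof (intro allI impI)
  fix \<epsilon> :: real assume "0 < \<epsilon>"
  then obtain t0 where t0: "t0 \<ge> 0" "\<And>t x y. t \<ge> t0 \<Longrightarrow> strictly_pos x \<Longrightarrow> strictly_pos y \<Longrightarrow>
     prox \<epsilon> (U (\<theta> (- t) \<omega>) t x) (U (\<theta> (- t) \<omega>) t y)"
    using g unfolding good_def by blast
  show "\<exists>t0\<ge>0. \<forall>t\<ge>t0. \<forall>x y. strictly_pos x \<longrightarrow> strictly_pos y \<longrightarrow>
     prox \<epsilon> (U (\<theta> (- t) (\<theta> s \<omega>)) t x) (U (\<theta> (- t) (\<theta> s \<omega>)) t y)"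
  proof (intro exI[of _ "t0 + s"] conjI allI impI)
    show "0 \<le> t0 + s" using t0 s by simp
    fix t and x y :: "'n phase" assume t: "t0 + s \<le> t" and x: "strictly_pos x" and y: "strictly_pos y"
    have eq: "U (\<theta> (- t) (\<theta> s \<omega>)) t z = U \<omega> s (U (\<theta> (- (t - s)) \<omega>) (t - s) z)" for z
      using U_cocycle[OF flow_space[OF \<omega>], of "t - s" s "- (t - s)" z] t t0 s
      by (simp add: flow_neg_add[OF \<omega>] flow_zero[OF \<omega>] flow_inverse)
    show "prox \<epsilon> (U (\<theta> (- t) (\<theta> s \<omega>)) t x) (U (\<theta> (- t) (\<theta> s \<omega>)) t y)"
      unfolding eq by (intro prox_U \<omega> s t0 x y) (use t in simp)
  qed
qed

section \<open>The invariant set of full measure\<close>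

text \<open>Completeness of the measure supplies measurability of sets cut out by uncountably many
  conditions, such as \<open>\<Omega>0\<close>.\<close>

lemma sets_of_AE:
  assumes "S \<subseteq> space M" "AE \<omega> in M. \<omega> \<in> S" shows "S \<in> sets M" "prob S = 1"
proof -
  obtain N where N: "{\<omega>\<in>space M. \<omega> \<notin> S} \<subseteq> N" "N \<in> null_sets M"
    using assms(2) by (auto elim!: AE_E simp: null_sets_def)
  from complete[OF this] have "space M - {\<omega>\<in>space M. \<omega> \<notin> S} \<in> sets M" by auto
  moreover have "space M - {\<omega>\<in>space M. \<omega> \<notin> S} = S" using assms(1) by auto
  ultimately show S: "S \<in> sets M" by simp
  show "prob S = 1" using assms(2) S by (simp add: prob_eq_1)
qed

definition \<Omega>0 :: "'a set" where "\<Omega>0 = {\<omega>\<in>space M. \<forall>s. good (\<theta> s \<omega>)}"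

lemma \<Omega>0_space: "\<omega> \<in> \<Omega>0 \<Longrightarrow> \<omega> \<in> space M" by (simp add: \<Omega>0_def)

lemma \<Omega>0_flow: "\<omega> \<in> \<Omega>0 \<Longrightarrow> \<theta> t \<omega> \<in> \<Omega>0"
  by (auto simp: \<Omega>0_def flow_space flow_neg_add)

lemma \<Omega>0_good: "\<omega> \<in> \<Omega>0 \<Longrightarrow> good \<omega>"
  unfolding \<Omega>0_def using flow_zero by (metis (mono_tags, lifting) mem_Collect_eq)

text \<open>Goodness moves forward in time, so goodness at the countably many times
  \<open>- k\<close> gives it at all real times.\<close>

lemma AE_\<Omega>0: "AE \<omega> in M. \<omega> \<in> \<Omega>0"
proof -
  have "AE \<omega> in M. \<forall>k::nat. good (\<theta> (- real k) \<omega>)"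
    unfolding AE_all_countable by (intro allI AE_flow AE_good)
  with AE_space show ?thesis
  proof eventually_elim
    case (elim \<omega>)
    have "good (\<theta> s \<omega>)" for s
    proof -
      obtain k :: nat where k: "- s \<le> real k" using real_arch_simple by blast
      have "good (\<theta> (s + real k) (\<theta> (- real k) \<omega>))"
        by (rule good_shift) (use elim k in \<open>auto intro: flow_space\<close>)
      then show ?thesis using elim by (simp add: flow_neg_add)
    qed
    then show ?case using elim by (simp add: \<Omega>0_def)
  qed
qed

lemma \<Omega>0_sets [measurable]: "\<Omega>0 \<in> sets M" and \<Omega>0_prob: "prob \<Omega>0 = 1"
  using sets_of_AE[OF _ AE_\<Omega>0] by (auto simp: \<Omega>0_def)

end

section \<open>The principal direction\<close>

lemma tendsto_phase_eval:
  fixes f :: "'b \<Rightarrow> 'n::finite phase"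
  assumes "(f \<longlongrightarrow> l) F"
  shows "((\<lambda>n. apply_bcontfun (f n) \<tau> $ i) \<longlongrightarrow> apply_bcontfun l \<tau> $ i) F"
proof -
  have "bounded_linear (\<lambda>x :: 'n phase. apply_bcontfun x \<tau>)"
    by (rule bounded_linear_intro[where K = 1]) (auto simp: norm_bounded)
  from bounded_linear.tendsto[OF this assms] show ?thesis by (rule tendsto_vec_nth)
qed

lemma phase_le_LIMSEQ:
  fixes f :: "nat \<Rightarrow> 'n::finite phase"
  assumes "f \<longlonglongrightarrow> l" "\<And>n. n \<ge> N \<Longrightarrow> x \<preceq> f n"
  shows "x \<preceq> l"
  unfolding phase_le_def
proof (intro allI)
  fix \<tau> i
  show "apply_bcontfun x \<tau> $ i \<le> apply_bcontfun l \<tau> $ i"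
    by (rule LIMSEQ_le_const[OF tendsto_phase_eval[OF assms(1)]])
       (use assms(2) in \<open>auto simp: phase_le_def\<close>)
qed

text \<open>Shifts of time and additive constants vanish in the average. It makes convergence an
  invariant property and later absorbs the constant in the domination of arbitrary initial
  functions.\<close>

lemma tendsto_average_shift:
  fixes S :: "real \<Rightarrow> real"
  assumes "((\<lambda>t. ereal (S t / t)) \<longlongrightarrow> L) at_top"
  shows "((\<lambda>t. ereal ((S (t + s) - c) / t)) \<longlongrightarrow> L) at_top"
proof -
  have f: "filterlim (\<lambda>t. t + s) at_top at_top"
    by (rule filterlim_at_top_mono[OF filterlim_tendsto_add_at_top[OF tendsto_const[of s] filterlim_ident]])
       (auto simp: add.commute)
  have 1: "((\<lambda>t. ereal (S (t + s) / (t + s))) \<longlongrightarrow> L) at_top"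
    by (rule filterlim_compose[OF assms f])
  have id: "filterlim (\<lambda>t::real. t) at_infinity at_top"
    by (intro filterlim_at_top_imp_at_infinity filterlim_ident)
  have "((\<lambda>t. 1 + s / t) \<longlongrightarrow> 1 + 0) at_top"
    by (intro tendsto_add tendsto_const tendsto_divide_0[OF tendsto_const id])
  then have 2: "((\<lambda>t. ereal (1 + s / t)) \<longlongrightarrow> ereal 1) at_top" by simp
  have "((\<lambda>t. - c / t) \<longlongrightarrow> 0) at_top"
    by (rule tendsto_divide_0[OF tendsto_const id])
  then have 3: "((\<lambda>t. ereal (- c / t)) \<longlongrightarrow> ereal 0) at_top" by simp
  have "((\<lambda>t. ereal (1 + s / t) * ereal (S (t + s) / (t + s)) + ereal (- c / t)) \<longlongrightarrow> ereal 1 * L + ereal 0) at_top"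
    by (intro tendsto_add_ereal_general tendsto_mult_ereal 1 2 3) auto
  then have "((\<lambda>t. ereal (1 + s / t) * ereal (S (t + s) / (t + s)) + ereal (- c / t)) \<longlongrightarrow> L) at_top"
    by (simp flip: one_ereal_def zero_ereal_def)
  moreover have "\<forall>\<^sub>F t in at_top. ereal (1 + s / t) * ereal (S (t + s) / (t + s)) + ereal (- c / t)
      = ereal ((S (t + s) - c) / t)"
    using eventually_gt_at_top[of "max 0 (- s)"]
  proof eventually_elim
    case (elim t)
    then have t: "t \<noteq> 0" "t + s \<noteq> 0" by auto
    have "(1 + s / t) = (t + s) / t" using t by (simp add: add_divide_distrib)
    then have "(1 + s / t) * (S (t + s) / (t + s)) = S (t + s) / t" using t by simp
    then show ?case by (simp add: diff_divide_distrib)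
  qed
  ultimately show ?thesis by (rule Lim_transform_eventually)
qed

context focusing_mds begin

section \<open>Pullback limits and their equivariance\<close>

definition v :: "nat \<Rightarrow> 'a \<Rightarrow> 'n phase" where
  "v n \<omega> = U (\<theta> (- real n) \<omega>) (real n) one_phase"

abbreviation vn :: "nat \<Rightarrow> 'a \<Rightarrow> 'n phase" where
  "vn n \<omega> \<equiv> v n \<omega> /\<^sub>R norm (v n \<omega>)"

text \<open>A limit along integer times, hence along a countable family of measurable maps; its
  value carries meaning where \<open>good\<close> holds.\<close>

definition w :: "'a \<Rightarrow> 'n phase" where
  "w \<omega> = lim (\<lambda>n. vn n \<omega>)"

lemma v_strictly_pos: "\<omega> \<in> space M \<Longrightarrow> strictly_pos (v n \<omega>)"
  unfolding v_def by (intro U_strictly_pos flow_space strictly_pos_one) auto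

text \<open>For \<open>m \<ge> n\<close> both vectors are images under the last \<open>n\<close>
  time units, of a strictly positive function and of \<open>one_phase\<close>; \<open>good\<close>
  compares them uniformly in \<open>m\<close>.\<close>

lemma v_prox:
  assumes \<omega>: "\<omega> \<in> space M" and "good \<omega>" "0 < \<epsilon>"
  obtains n0 where "\<And>m n. n0 \<le> n \<Longrightarrow> n \<le> m \<Longrightarrow> prox \<epsilon> (v m \<omega>) (v n \<omega>)"
proof -
  obtain t0 where t0: "t0 \<ge> 0" "\<And>t x y. t \<ge> t0 \<Longrightarrow> strictly_pos x \<Longrightarrow> strictly_pos y \<Longrightarrow>
     prox \<epsilon> (U (\<theta> (- t) \<omega>) t x) (U (\<theta> (- t) \<omega>) t y)"
    using assms(2,3) unfolding good_def by blast
  obtain n0 :: nat where n0: "t0 \<le> real n0" using real_arch_simple by blast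
  have "prox \<epsilon> (v m \<omega>) (v n \<omega>)" if "n0 \<le> n" "n \<le> m" for m n
  proof -
    have "v m \<omega> = U (\<theta> (- real n) \<omega>) (real n) (U (\<theta> (- real m) \<omega>) (real m - real n) one_phase)"
      unfolding v_def using U_pullback[OF \<omega>, of "real n" "real m"] that by simp
    moreover have "prox \<epsilon> (U (\<theta> (- real n) \<omega>) (real n) (U (\<theta> (- real m) \<omega>) (real m - real n) one_phase))
        (U (\<theta> (- real n) \<omega>) (real n) one_phase)"
      using that n0 by (intro t0 U_strictly_pos flow_space \<omega> strictly_pos_one) auto
    ultimately show ?thesis by (simp add: v_def)
  qed
  then show thesis by (rule that)
qed

lemma w_lim:
  assumes \<omega>: "\<omega> \<in> space M" and g: "good \<omega>"
  shows "(\<lambda>n. vn n \<omega>) \<longlonglongrightarrow> w \<omega>"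
proof -
  have "Cauchy (\<lambda>n. vn n \<omega>)"
  proof (rule CauchyI)
    fix e :: real assume e: "0 < e"
    then obtain n0 where n0: "\<And>m n. n0 \<le> n \<Longrightarrow> n \<le> m \<Longrightarrow> prox (e/2) (v m \<omega>) (v n \<omega>)"
      using v_prox[OF \<omega> g, of "e/2"] by (metis half_gt_zero)
    have 1: "norm (vn m \<omega> - vn n \<omega>) < e" if "n0 \<le> n" "n \<le> m" for m n
    proof -
      have "norm (vn m \<omega> - vn n \<omega>) \<le> e / 2"
        by (rule normalize_close[OF n0[OF that]]) (use e v_strictly_pos[OF \<omega>] in auto)
      then show ?thesis using e by simp
    qed
    have "norm (vn m \<omega> - vn n \<omega>) < e" if "n0 \<le> n" "n0 \<le> m" for m n
    proof (cases "n \<le> m")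
      case True then show ?thesis by (rule 1[OF that(1)])
    next
      case False
      then show ?thesis using 1[OF that(2), of n] by (simp add: norm_minus_commute)
    qed
    then show "\<exists>M. \<forall>m\<ge>M. \<forall>n\<ge>M. norm (vn m \<omega> - vn n \<omega>) < e"
      by blast
  qed
  then have "convergent (\<lambda>n. vn n \<omega>)" by (simp add: Cauchy_convergent_iff)
  then show ?thesis unfolding w_def by (simp add: convergent_LIMSEQ_iff)
qed

lemma norm_w:
  assumes \<omega>: "\<omega> \<in> space M" and g: "good \<omega>" shows "norm (w \<omega>) = 1"
proof -
  have "norm (vn n \<omega>) = 1" for n
    using strictly_pos_norm[OF v_strictly_pos[OF \<omega>]] by simp
  with tendsto_norm[OF w_lim[OF \<omega> g]] have "(\<lambda>n::nat. 1) \<longlonglongrightarrow> norm (w \<omega>)" by simp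
  then show ?thesis by (simp add: LIMSEQ_const_iff)
qed

text \<open>All late normalized vectors stay above one fixed positive multiple of
  \<open>v n0 \<omega>\<close>, and this survives the limit.\<close>

lemma w_strictly_pos:
  assumes \<omega>: "\<omega> \<in> space M" and g: "good \<omega>" shows "strictly_pos (w \<omega>)"
proof -
  obtain n0 where n0: "\<And>m n. n0 \<le> n \<Longrightarrow> n \<le> m \<Longrightarrow> prox 1 (v m \<omega>) (v n \<omega>)"
    using v_prox[OF \<omega> g, of 1] by (metis zero_less_one)
  note pos = v_strictly_pos[OF \<omega>]
  let ?c = "inverse (2 * norm (v n0 \<omega>))"
  have c: "0 < ?c" using strictly_pos_norm[OF pos] by simp
  have "(1 / (1 + 1)) *\<^sub>R (vn n0 \<omega>) \<preceq> w \<omega>"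
    by (rule phase_le_LIMSEQ[OF w_lim[OF \<omega> g], of n0]) (rule normalize_lower[OF n0 _ pos pos]; simp)
  then have "?c *\<^sub>R v n0 \<omega> \<preceq> w \<omega>" by simp
  moreover obtain \<alpha> where \<alpha>: "0 < \<alpha>" "\<alpha> *\<^sub>R one_phase \<preceq> v n0 \<omega>"
    using pos by (auto simp: strictly_pos_def)
  moreover have "(?c * \<alpha>) *\<^sub>R one_phase \<preceq> ?c *\<^sub>R v n0 \<omega>"
    using phase_le_scaleR[OF \<alpha>(2), of ?c] c by simp
  ultimately have "(?c * \<alpha>) *\<^sub>R one_phase \<preceq> w \<omega>" by (blast intro: phase_le_trans)
  moreover have "0 < ?c * \<alpha>" using c \<alpha>(1) by (rule mult_pos_pos)
  ultimately show ?thesis unfolding strictly_pos_def by blast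
qed

text \<open>The image of \<open>v n \<omega>\<close> and the vector
  \<open>v n (\<theta> t \<omega>)\<close> are pullbacks over the same time \<open>n\<close> at
  \<open>\<theta> t \<omega>\<close>, from different strictly positive functions, so their
  directions have the same limit.\<close>

lemma U_w:
  assumes \<omega>: "\<omega> \<in> \<Omega>0" and t: "0 \<le> t"
  shows "U \<omega> t (w \<omega>) = norm (U \<omega> t (w \<omega>)) *\<^sub>R w (\<theta> t \<omega>)"
proof -
  note sp = \<Omega>0_space[OF \<omega>] and sp' = \<Omega>0_space[OF \<Omega>0_flow[OF \<omega>, of t]]
  note g = \<Omega>0_good[OF \<omega>] and g' = \<Omega>0_good[OF \<Omega>0_flow[OF \<omega>, of t]]
  define z where "z n = U \<omega> t (v n \<omega>)" for n
  define h where "h n = U \<omega> t (vn n \<omega>)" for n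
  have h_lim: "h \<longlonglongrightarrow> U \<omega> t (w \<omega>)"
    unfolding h_def by (rule bounded_linear.tendsto[OF U_bounded_linear[OF sp t] w_lim[OF sp g]])
  have z_pos: "strictly_pos (z n)" for n
    unfolding z_def by (intro U_strictly_pos sp t v_strictly_pos)
  \<comment> \<open>The total time \<open>t + n\<close> is cut after \<open>t\<close> instead of
    after \<open>n\<close>.\<close>
  have z_eq: "z n = U (\<theta> (- real n) (\<theta> t \<omega>)) (real n) (U (\<theta> (- real n) \<omega>) t one_phase)" for n
  proof -
    have "z n = U (\<theta> (- real n) \<omega>) (t + real n) one_phase"
      using U_cocycle[OF flow_space[OF sp], of "real n" t "- real n" one_phase] t
      by (simp add: z_def v_def flow_neg_add[OF sp] flow_zero[OF sp])
    also have "\<dots> = U (\<theta> (t - real n) \<omega>) (real n) (U (\<theta> (- real n) \<omega>) t one_phase)"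
      using U_cocycle[OF flow_space[OF sp], of t "real n" "- real n" one_phase] t
      by (simp add: flow_neg_add[OF sp] add.commute)
    finally show ?thesis by (simp add: flow_neg_add[OF sp])
  qed
  have z_lim: "(\<lambda>n. z n /\<^sub>R norm (z n)) \<longlonglongrightarrow> w (\<theta> t \<omega>)"
  proof -
    let ?y = "\<lambda>n. v n (\<theta> t \<omega>)"
    have "(\<lambda>n. z n /\<^sub>R norm (z n) - ?y n /\<^sub>R norm (?y n)) \<longlonglongrightarrow> 0"
    proof (rule LIMSEQ_I)
      fix e :: real assume e: "0 < e"
      then obtain t0 where t0: "t0 \<ge> 0" "\<And>s x y. s \<ge> t0 \<Longrightarrow> strictly_pos x \<Longrightarrow> strictly_pos y \<Longrightarrow>
         prox (e/2) (U (\<theta> (- s) (\<theta> t \<omega>)) s x) (U (\<theta> (- s) (\<theta> t \<omega>)) s y)"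
        using g' unfolding good_def by (metis half_gt_zero)
      obtain n0 :: nat where n0: "t0 \<le> real n0" using real_arch_simple by blast
      have "norm (z n /\<^sub>R norm (z n) - ?y n /\<^sub>R norm (?y n) - 0) < e" if "n \<ge> n0" for n
      proof -
        have "prox (e/2) (z n) (?y n)"
          unfolding z_eq v_def using that n0 t
          by (intro t0 U_strictly_pos flow_space sp strictly_pos_one) auto
        then have "norm (z n /\<^sub>R norm (z n) - ?y n /\<^sub>R norm (?y n)) \<le> e/2"
          by (rule normalize_close) (use e z_pos v_strictly_pos[OF sp'] in auto)
        then show ?thesis using e by simp
      qed
      then show "\<exists>no. \<forall>n\<ge>no. norm (z n /\<^sub>R norm (z n) - ?y n /\<^sub>R norm (?y n) - 0) < e" by blast
    qed
    from tendsto_add[OF this w_lim[OF sp' g']] show ?thesis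
      by (simp only: diff_add_cancel add_0_left)
  qed
  have "norm (h n) *\<^sub>R (z n /\<^sub>R norm (z n)) = h n" for n
  proof -
    have "h n = inverse (norm (v n \<omega>)) *\<^sub>R z n"
      by (simp add: h_def z_def U_scaleR[OF sp t])
    then show ?thesis using strictly_pos_norm[OF z_pos[of n]] by simp
  qed
  then have "h \<longlonglongrightarrow> norm (U \<omega> t (w \<omega>)) *\<^sub>R w (\<theta> t \<omega>)"
    using tendsto_scaleR[OF tendsto_norm[OF h_lim] z_lim] by simp
  with h_lim show ?thesis by (rule LIMSEQ_unique)
qed

lemma norm_U_w_pos: "\<omega> \<in> \<Omega>0 \<Longrightarrow> 0 \<le> t \<Longrightarrow> 0 < norm (U \<omega> t (w \<omega>))"
  by (intro strictly_pos_norm U_strictly_pos w_strictly_pos \<Omega>0_space \<Omega>0_good)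

section \<open>The exponent of the principal direction\<close>

definition log_growth :: "real \<Rightarrow> 'a \<Rightarrow> real" where
  "log_growth t \<omega> = ln (norm (U \<omega> t (w \<omega>)))"

definition rate_integral :: "real \<Rightarrow> 'a \<Rightarrow> real" where
  "rate_integral t \<omega> = integral {0..t} (\<lambda>r. g_up (\<theta> r \<omega>))"

lemma log_growth_cocycle:
  assumes \<omega>: "\<omega> \<in> \<Omega>0" and st: "0 \<le> s" "0 \<le> t"
  shows "log_growth (s + t) \<omega> = log_growth s \<omega> + log_growth t (\<theta> s \<omega>)"
proof -
  note sp = \<Omega>0_space[OF \<omega>]
  have "U \<omega> (s + t) (w \<omega>) = U (\<theta> s \<omega>) t (U \<omega> s (w \<omega>))"
    using U_cocycle[OF sp st] by (simp add: add.commute)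
  also have "\<dots> = norm (U \<omega> s (w \<omega>)) *\<^sub>R U (\<theta> s \<omega>) t (w (\<theta> s \<omega>))"
    by (subst U_w[OF \<omega> st(1)]) (rule U_scaleR[OF flow_space[OF sp] st(2)])
  finally have "norm (U \<omega> (s + t) (w \<omega>)) = norm (U \<omega> s (w \<omega>)) * norm (U (\<theta> s \<omega>) t (w (\<theta> s \<omega>)))"
    by simp
  then show ?thesis
    unfolding log_growth_def using norm_U_w_pos[OF \<omega> st(1)] norm_U_w_pos[OF \<Omega>0_flow[OF \<omega>] st(2)]
    by (simp add: ln_mult)
qed

lemma rate_integral_cocycle:
  assumes "\<omega> \<in> space M" "0 \<le> s" "0 \<le> t"
  shows "rate_integral (s + t) \<omega> = rate_integral s \<omega> + rate_integral t (\<theta> s \<omega>)"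
  unfolding rate_integral_def by (rule flow_integral_cocycle[OF assms(1) g_up_continuous[OF assms(1)] assms(2,3)])

lemma rate_integral_nonneg: "\<omega> \<in> space M \<Longrightarrow> 0 \<le> rate_integral t \<omega>"
  unfolding rate_integral_def
  by (intro integral_nonneg integrable_continuous_real continuous_on_subset[OF g_up_continuous]
      g_up_nonneg flow_space) auto

lemma log_growth_le:
  assumes \<omega>: "\<omega> \<in> \<Omega>0" and t: "0 \<le> t"
  shows "log_growth t \<omega> \<le> rate_integral t \<omega> + ln ((real CARD('n))\<^sup>2)"
proof -
  note sp = \<Omega>0_space[OF \<omega>]
  have N: "0 < (real CARD('n))\<^sup>2" by simp
  have "norm (U \<omega> t (w \<omega>)) \<le> (real CARD('n))\<^sup>2 * exp (rate_integral t \<omega>)"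
    using U_norm_upper[OF sp strictly_pos_nonneg[OF w_strictly_pos[OF sp \<Omega>0_good[OF \<omega>]]] t]
    by (simp add: rate_integral_def norm_w[OF sp \<Omega>0_good[OF \<omega>]])
  then have "log_growth t \<omega> \<le> ln ((real CARD('n))\<^sup>2 * exp (rate_integral t \<omega>))"
    unfolding log_growth_def using norm_U_w_pos[OF \<omega> t] by (rule ln_mono[rotated 2, simplified])
  also have "\<dots> = rate_integral t \<omega> + ln ((real CARD('n))\<^sup>2)"
    using N by (subst ln_mult) auto
  finally show ?thesis .
qed

lemma v_measurable: "v n \<in> borel_measurable M"
  unfolding v_def by (rule measurable_compose[OF flow_measurable U_measurable]) simp

lemma w_measurable:
  assumes "\<Omega>1 \<subseteq> \<Omega>0"
  shows "w \<in> restrict_space M \<Omega>1 \<rightarrow>\<^sub>M borel"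
proof (rule borel_measurable_LIMSEQ_metric)
  fix n
  note borel_measurable_phase_norm[OF v_measurable[of n], measurable]
  have "(\<lambda>\<omega>. vn n \<omega>) \<in> borel_measurable M"
    by (rule borel_measurable_phase_scaleR[OF v_measurable]) measurable
  then show "(\<lambda>\<omega>. vn n \<omega>) \<in> restrict_space M \<Omega>1 \<rightarrow>\<^sub>M borel"
    by (rule measurable_restrict_space1)
next
  fix \<omega> assume "\<omega> \<in> space (restrict_space M \<Omega>1)"
  then have "\<omega> \<in> \<Omega>0" using assms by (auto simp: space_restrict_space)
  then show "(\<lambda>n. vn n \<omega>) \<longlonglongrightarrow> w \<omega>" by (intro w_lim \<Omega>0_space \<Omega>0_good)
qed

text \<open>Measurability in \<omega> is available for \<open>U\<close> at a fixed initial function.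
  The norm for the random function \<open>w \<omega>\<close> is therefore obtained as a limit of
  quotients of norms of pullbacks of \<open>one_phase\<close>.\<close>

lemma log_growth_measurable: "(\<lambda>\<omega>. indicator \<Omega>0 \<omega> * log_growth 1 \<omega>) \<in> borel_measurable M"
proof -
  have "(\<lambda>\<omega>. indicator \<Omega>0 \<omega> * norm (U \<omega> 1 (w \<omega>))) \<in> borel_measurable M"
  proof (rule borel_measurable_LIMSEQ_real)
    fix n
    have "(\<lambda>\<omega>. U (\<theta> (- real n) \<omega>) (1 + real n) one_phase) \<in> borel_measurable M"
      by (rule measurable_compose[OF flow_measurable U_measurable]) simp
    note borel_measurable_phase_norm[OF this, measurable] borel_measurable_phase_norm[OF v_measurable[of n], measurable]
    show "(\<lambda>\<omega>. indicator \<Omega>0 \<omega> * (norm (U (\<theta> (- real n) \<omega>) (1 + real n) one_phase) / norm (v n \<omega>)))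
        \<in> borel_measurable M" by measurable
  next
    fix \<omega>
    show "(\<lambda>n. indicator \<Omega>0 \<omega> * (norm (U (\<theta> (- real n) \<omega>) (1 + real n) one_phase) / norm (v n \<omega>)))
        \<longlonglongrightarrow> indicator \<Omega>0 \<omega> * norm (U \<omega> 1 (w \<omega>))"
    proof (cases "\<omega> \<in> \<Omega>0")
      case True
      note sp = \<Omega>0_space[OF True]
      have "norm (U (\<theta> (- real n) \<omega>) (1 + real n) one_phase) / norm (v n \<omega>)
          = norm (U \<omega> 1 (vn n \<omega>))" for n
        using U_cocycle[OF flow_space[OF sp], of "real n" 1 "- real n" one_phase]
        by (simp add: U_scaleR[OF sp] v_def flow_neg_add[OF sp] flow_zero[OF sp] divide_inverse mult.commute)
      moreover have "(\<lambda>n. norm (U \<omega> 1 (vn n \<omega>))) \<longlonglongrightarrow> norm (U \<omega> 1 (w \<omega>))"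
        by (intro tendsto_norm bounded_linear.tendsto[OF U_bounded_linear] w_lim sp \<Omega>0_good True) simp
      ultimately show ?thesis using True by simp
    qed simp
  qed
  note this[measurable]
  have "(\<lambda>\<omega>. indicator \<Omega>0 \<omega> * ln (indicator \<Omega>0 \<omega> * norm (U \<omega> 1 (w \<omega>)))) \<in> borel_measurable M"
    by measurable
  moreover have "indicator \<Omega>0 \<omega> * ln (indicator \<Omega>0 \<omega> * norm (U \<omega> 1 (w \<omega>))) = indicator \<Omega>0 \<omega> * log_growth 1 \<omega>"
    for \<omega> by (simp add: log_growth_def split: split_indicator)
  ultimately show ?thesis by simp
qed

text \<open>The growth is written as \<open>rate_integral - D\<close>. The first cocycle has a
  finite mean; \<open>D\<close> is bounded below by \<open>log_growth_le\<close>, and its mean may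
  be infinite, which is the case of the exponent \<open>-\<infinity>\<close>.\<close>

lemma log_growth_limit:
  obtains \<Lambda> :: ereal where "\<Lambda> < \<infinity>" "AE \<omega> in M. ((\<lambda>t. ereal (log_growth t \<omega> / t)) \<longlongrightarrow> \<Lambda>) at_top"
proof -
  have rm: "rate_integral 1 \<in> borel_measurable M"
    unfolding rate_integral_def[abs_def] by (rule flow_integral_measurable[OF g_up_measurable g_up_continuous])
  have ri: "integrable M (rate_integral 1)"
    unfolding rate_integral_def[abs_def]
    by (rule flow_integral_integrable[OF g_up_integrable g_up_nonneg g_up_continuous])
  note rm[measurable]
  obtain c where c: "-\<infinity> < c" "integrable M (\<lambda>\<omega>. indicator \<Omega>0 \<omega> * rate_integral 1 \<omega>) \<Longrightarrow> c < \<infinity>"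
    "AE \<omega> in M. ((\<lambda>t. ereal (rate_integral t \<omega> / t)) \<longlongrightarrow> c) at_top"
  proof (rule ergodic_cocycle[OF \<Omega>0_sets \<Omega>0_prob \<Omega>0_flow, where R = rate_integral and C = 0])
    show "(\<lambda>\<omega>. indicator \<Omega>0 \<omega> * rate_integral 1 \<omega>) \<in> borel_measurable M" by measurable
  qed (auto intro: rate_integral_cocycle rate_integral_nonneg \<Omega>0_space)
  have "integrable M (\<lambda>\<omega>. indicator \<Omega>0 \<omega> * rate_integral 1 \<omega>)"
    using integrable_mult_indicator[OF \<Omega>0_sets ri] by simp
  with c have "c < \<infinity>" by blast
  then obtain c' where c': "c = ereal c'" using c(1) by (cases c) auto
  define D where "D t \<omega> = rate_integral t \<omega> - log_growth t \<omega>" for t \<omega>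
  have Dm: "(\<lambda>\<omega>. indicator \<Omega>0 \<omega> * D 1 \<omega>) \<in> borel_measurable M"
  proof -
    note log_growth_measurable[measurable]
    have "(\<lambda>\<omega>. indicator \<Omega>0 \<omega> * rate_integral 1 \<omega> - indicator \<Omega>0 \<omega> * log_growth 1 \<omega>) \<in> borel_measurable M"
      by measurable
    then show ?thesis by (simp add: D_def right_diff_distrib)
  qed
  obtain d where d: "-\<infinity> < d" "AE \<omega> in M. ((\<lambda>t. ereal (D t \<omega> / t)) \<longlongrightarrow> d) at_top"
  proof (rule ergodic_cocycle[where R = D and C = "ln ((real CARD('n))\<^sup>2)", OF \<Omega>0_sets \<Omega>0_prob \<Omega>0_flow _ _ Dm])
    fix \<omega> s t assume "\<omega> \<in> \<Omega>0" "0 \<le> (s::real)" "0 \<le> (t::real)"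
    then show "D (s + t) \<omega> = D s \<omega> + D t (\<theta> s \<omega>)"
      by (simp add: D_def log_growth_cocycle rate_integral_cocycle \<Omega>0_space)
  next
    fix \<omega> t assume "\<omega> \<in> \<Omega>0" "0 \<le> (t::real)"
    then show "- ln ((real CARD('n))\<^sup>2) \<le> D t \<omega>" using log_growth_le[of \<omega> t] by (simp add: D_def)
  qed auto
  have "AE \<omega> in M. ((\<lambda>t. ereal (log_growth t \<omega> / t)) \<longlongrightarrow> c - d) at_top"
    using c(3) d(2)
  proof eventually_elim
    case (elim \<omega>)
    have "((\<lambda>t. ereal (rate_integral t \<omega> / t) - ereal (D t \<omega> / t)) \<longlongrightarrow> c - d) at_top"
      using elim by (intro tendsto_diff_ereal_general) (auto simp: c')
    then show ?case by (simp add: D_def diff_divide_distrib)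
  qed
  moreover have "c - d < \<infinity>" using d(1) by (cases d) (auto simp: c')
  ultimately show thesis using that by blast
qed

theorem ex_gen_principal_Floquet: "\<exists>\<Omega>1 E1 w \<Lambda>1. gen_principal_Floquet M \<theta> U \<Omega>1 E1 w \<Lambda>1"
proof -
  obtain \<Lambda> :: ereal where \<Lambda>: "\<Lambda> < \<infinity>"
    and lim: "AE \<omega> in M. ((\<lambda>t. ereal (log_growth t \<omega> / t)) \<longlongrightarrow> \<Lambda>) at_top"
    using log_growth_limit by blast
  define \<Omega>1 where "\<Omega>1 = {\<omega>\<in>\<Omega>0. ((\<lambda>t. ereal (log_growth t \<omega> / t)) \<longlongrightarrow> \<Lambda>) at_top}"
  have sub: "\<Omega>1 \<subseteq> \<Omega>0" by (auto simp: \<Omega>1_def)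
  have AE1: "AE \<omega> in M. \<omega> \<in> \<Omega>1" using lim AE_\<Omega>0 by eventually_elim (simp add: \<Omega>1_def)
  have "\<Omega>1 \<subseteq> space M" using sub \<Omega>0_space by blast
  note S = sets_of_AE[OF this AE1]
  have flow1: "\<theta> s \<omega> \<in> \<Omega>1" if \<omega>: "\<omega> \<in> \<Omega>1" for s \<omega>
  proof -
    have \<omega>0: "\<omega> \<in> \<Omega>0" and l: "((\<lambda>t. ereal (log_growth t \<omega> / t)) \<longlongrightarrow> \<Lambda>) at_top"
      using \<omega> by (auto simp: \<Omega>1_def)
    note sp = \<Omega>0_space[OF \<omega>0]
    obtain c where c: "\<forall>\<^sub>F t in at_top. log_growth t (\<theta> s \<omega>) = log_growth (t + s) \<omega> - c"
    proof (cases "0 \<le> s")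
      case True
      have "\<forall>\<^sub>F t in at_top. log_growth t (\<theta> s \<omega>) = log_growth (t + s) \<omega> - log_growth s \<omega>"
        using eventually_ge_at_top[of 0]
        by eventually_elim (use log_growth_cocycle[OF \<omega>0 True] in \<open>simp add: add.commute\<close>)
      then show thesis by (rule that)
    next
      \<comment> \<open>For negative \<open>s\<close> the cocycle is started at
        \<open>\<theta> s \<omega>\<close>, from which the time \<open>- s\<close> leads back to
        \<omega>; eventually \<open>t + s\<close> is nonnegative.\<close>
      case False
      have "\<forall>\<^sub>F t in at_top. log_growth t (\<theta> s \<omega>) = log_growth (t + s) \<omega> - (- log_growth (- s) (\<theta> s \<omega>))"
        using eventually_ge_at_top[of "- s"]
      proof eventually_elim
        case (elim t)
        then show ?case
          using log_growth_cocycle[OF \<Omega>0_flow[OF \<omega>0], of "- s" "t + s" s] False flow_inverse[OF sp, of s]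
          by simp
      qed
      then show thesis by (rule that)
    qed
    have "((\<lambda>t. ereal (log_growth t (\<theta> s \<omega>) / t)) \<longlongrightarrow> \<Lambda>) at_top"
      by (rule Lim_transform_eventually[OF tendsto_average_shift[OF l, of s c]])
         (use c in \<open>auto elim: eventually_mono\<close>)
    then show ?thesis using \<Omega>0_flow[OF \<omega>0] by (simp add: \<Omega>1_def)
  qed
  have gr: "\<forall>\<^sub>F t in at_top. ereal (log_growth t \<omega> / t) = growth_rate (\<lambda>t. U \<omega> t (w \<omega>)) t" if "\<omega> \<in> \<Omega>1" for \<omega>
    using eventually_ge_at_top[of 0]
  proof eventually_elim
    case (elim t)
    then have "0 < norm (U \<omega> t (w \<omega>))" using that sub by (intro norm_U_w_pos) auto
    then show ?case by (simp add: growth_rate_def ereal_ln_def log_growth_def)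
  qed
  have growth: "(growth_rate (\<lambda>t. U \<omega> t (w \<omega>)) \<longlongrightarrow> \<Lambda>) at_top" if "\<omega> \<in> \<Omega>1" for \<omega>
    by (rule Lim_transform_eventually[OF _ gr[OF that]]) (use that in \<open>simp add: \<Omega>1_def\<close>)
  have "gen_principal_Floquet M \<theta> U \<Omega>1 (\<lambda>\<omega>. span {w \<omega>}) w \<Lambda>"
    unfolding gen_principal_Floquet_def
  proof (intro conjI ballI allI impI)
    show "\<Omega>1 \<in> sets M" "measure M \<Omega>1 = 1" by (rule S)+
    show "invariant_set \<theta> \<Omega>1" by (rule invariant_setI) (use flow1 sub \<Omega>0_space in auto)
    show "w \<in> restrict_space M \<Omega>1 \<rightarrow>\<^sub>M borel" by (rule w_measurable[OF sub])
    show "\<Lambda> < \<infinity>" by (rule \<Lambda>)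
  next
    fix \<omega> assume "\<omega> \<in> \<Omega>1"
    then have "\<omega> \<in> \<Omega>0" using sub by auto
    then have "strictly_pos (w \<omega>)" by (intro w_strictly_pos \<Omega>0_space \<Omega>0_good)
    then show "w \<omega> \<in> phase_cone - {0}"
      using strictly_pos_norm[of "w \<omega>"] strictly_pos_nonneg[of "w \<omega>"] by (auto simp: phase_cone_iff)
  next
    fix \<omega> and t :: real assume "\<omega> \<in> \<Omega>1" and t: "0 < t"
    then have \<omega>: "\<omega> \<in> \<Omega>0" using sub by auto
    have t0: "0 \<le> t" using t by simp
    define c where "c = norm (U \<omega> t (w \<omega>))"
    have c: "0 < c" unfolding c_def by (rule norm_U_w_pos[OF \<omega> t0])
    have "U \<omega> t ` span {w \<omega>} = span (U \<omega> t ` {w \<omega>})"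
      by (rule linear_span_image[OF U_linear[OF \<Omega>0_space[OF \<omega>] t0], symmetric])
    also have "U \<omega> t ` {w \<omega>} = {c *\<^sub>R w (\<theta> t \<omega>)}"
      using U_w[OF \<omega> t0] by (simp add: c_def)
    also have "span {c *\<^sub>R w (\<theta> t \<omega>)} = span {w (\<theta> t \<omega>)}"
    proof -
      have "span ((\<lambda>x. c *\<^sub>R x) ` {w (\<theta> t \<omega>)}) = span {w (\<theta> t \<omega>)}"
        by (rule span_image_scale) (use c in auto)
      then show ?thesis by simp
    qed
    finally show "U \<omega> t ` span {w \<omega>} = span {w (\<theta> t \<omega>)}" .
  next
    fix \<omega> assume \<omega>1: "\<omega> \<in> \<Omega>1"
    show "(growth_rate (\<lambda>t. U \<omega> t (w \<omega>)) \<longlongrightarrow> \<Lambda>) at_top" by (rule growth[OF \<omega>1])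
    have \<omega>: "\<omega> \<in> \<Omega>0" using \<omega>1 sub by auto
    note sp = \<Omega>0_space[OF \<omega>]
    fix u :: "'n phase" assume "u \<noteq> 0"
    obtain \<alpha> where \<alpha>: "0 < \<alpha>" "\<alpha> *\<^sub>R one_phase \<preceq> w \<omega>"
      using w_strictly_pos[OF sp \<Omega>0_good[OF \<omega>]] by (auto simp: strictly_pos_def)
    \<comment> \<open>Chosen so that \<open>c *\<^sub>R w \<omega>\<close> lies above
      \<open>norm u *\<^sub>R one_phase\<close>, hence above \<open>u\<close> and its
      negative.\<close>
    define c where "c = norm u / \<alpha>"
    have c: "0 < c" using \<open>u \<noteq> 0\<close> \<alpha> by (simp add: c_def)
    have cw: "norm u *\<^sub>R one_phase \<preceq> c *\<^sub>R w \<omega>"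
      using phase_le_scaleR[OF \<alpha>(2), of c] c \<alpha> by (simp add: c_def)
    have bd: "norm (U \<omega> t u) \<le> c * norm (U \<omega> t (w \<omega>))" if t: "0 \<le> t" for t
    proof -
      have *: "\<bar>apply_bcontfun u \<tau> $ i\<bar> \<le> c * apply_bcontfun (w \<omega>) \<tau> $ i" for \<tau> i
        using cw by (intro order_trans[OF abs_phase_le_norm[of u]]) (simp add: phase_le_def)
      have "u \<preceq> c *\<^sub>R w \<omega>" "- (c *\<^sub>R w \<omega>) \<preceq> u"
        unfolding phase_le_def using * by (simp_all add: abs_le_iff minus_le_iff)
      from coop_delay.flow_abs_le[OF coop_delay[OF sp] t this(2,1)]
      have "norm (U \<omega> t u) \<le> norm (U \<omega> t (c *\<^sub>R w \<omega>))" by (simp add: delay_semiflow_eq_flow)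
      then show ?thesis using c by (simp add: U_scaleR[OF sp t])
    qed
    have "Limsup at_top (growth_rate (\<lambda>t. U \<omega> t u)) \<le> Limsup at_top (\<lambda>t. ereal ((log_growth (t + 0) \<omega> - (- ln c)) / t))"
    proof (rule Limsup_mono)
      show "\<forall>\<^sub>F t in at_top. growth_rate (\<lambda>t. U \<omega> t u) t \<le> ereal ((log_growth (t + 0) \<omega> - (- ln c)) / t)"
        using eventually_gt_at_top[of 0]
      proof eventually_elim
        case (elim t)
        then have t: "0 \<le> t" by simp
        show ?case
        proof (cases "U \<omega> t u = 0")
          case True
          then show ?thesis using elim by (simp add: growth_rate_def ereal_ln_def)
        next
          case False
          have "ln (norm (U \<omega> t u)) \<le> ln (c * norm (U \<omega> t (w \<omega>)))"
            using False bd[OF t] by (intro ln_mono) (auto simp: c norm_U_w_pos[OF \<omega> t])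
          also have "\<dots> = log_growth t \<omega> + ln c"
            using c norm_U_w_pos[OF \<omega> t] by (simp add: ln_mult log_growth_def)
          finally show ?thesis using False elim
            by (simp add: growth_rate_def ereal_ln_def divide_right_mono)
        qed
      qed
    qed
    also have "\<dots> = \<Lambda>"
      by (rule lim_imp_Limsup[OF _ tendsto_average_shift]) (use \<omega>1 in \<open>simp_all add: \<Omega>1_def\<close>)
    finally show "Limsup at_top (growth_rate (\<lambda>t. U \<omega> t u)) \<le> \<Lambda>" .
  qed auto
  then show ?thesis by blast
qed

end

section \<open>Finiteness of the exponent\<close>

lemma ln_low_le:
  assumes "0 < a" "0 < d" "0 < \<beta>" "\<beta> \<le> a ^ p * d" "0 < p" "d \<le> b"
  shows "- ln a \<le> ln_minus \<beta> + b"
proof -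
  have b: "0 \<le> b" using assms by simp
  have "ln \<beta> \<le> ln (a ^ p * d)" using assms by (intro ln_mono) auto
  also have "\<dots> = real p * ln a + ln d" using assms by (simp add: ln_mult ln_realpow)
  also have "ln d \<le> b" using ln_le_minus_one[of d] assms by linarith
  finally have 1: "real p * (- ln a) \<le> ln_minus \<beta> + b" by (simp add: ln_minus_def)
  show ?thesis
  proof (cases "0 \<le> - ln a")
    case True
    have "1 * (- ln a) \<le> real p * (- ln a)" using True assms(5) by (intro mult_right_mono) auto
    then show ?thesis using 1 by simp
  next
    case False
    then show ?thesis using b by (simp add: ln_minus_def)
  qed
qed

section \<open>Lower growth of the constant function\<close>

context delay_mds begin

lemma diagonal_continuous: "\<omega> \<in> space M \<Longrightarrow> continuous_on UNIV (\<lambda>r. A (\<theta> r \<omega>) $ i $ i)"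
  using coop_delay.cont_a[OF coop_delay] by (intro continuous_intros)

lemma a_low_pos: "0 < a_low \<theta> A \<omega>"
proof -
  have "Min (range (\<lambda>i. exp (a_diag_low \<theta> A i \<omega>))) \<in> range (\<lambda>i. exp (a_diag_low \<theta> A i \<omega>))"
    by (rule Min_in) auto
  then obtain i where "Min (range (\<lambda>i. exp (a_diag_low \<theta> A i \<omega>))) = exp (a_diag_low \<theta> A i \<omega>)"
    unfolding image_iff by blast
  then show ?thesis by (simp add: a_low_def)
qed

text \<open>The interval \<open>{0..1}\<close> is the choice \<open>k = 0\<close>,
  \<open>s = 0\<close>, \<open>t = 1\<close> in the infimum, whose set is bounded below because the
  diagonal is continuous along the orbit.\<close>

lemma ln_a_low_le:
  assumes \<omega>: "\<omega> \<in> space M"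
  shows "ln (a_low \<theta> A \<omega>) \<le> integral {0..1} (\<lambda>r. A (\<theta> r \<omega>) $ i $ i)"
proof -
  let ?f = "\<lambda>r. A (\<theta> r \<omega>) $ i $ i"
  let ?S = "{integral {real k + s..real k + t} ?f |s t k. 0 \<le> s \<and> s < t \<and> t \<le> 1 \<and> k \<in> {0..CARD('n) + 1}}"
  have fi: "?f integrable_on {a..b}" "(\<lambda>r. \<bar>?f r\<bar>) integrable_on {a..b}" for a b
    by (intro integrable_continuous_real continuous_intros continuous_on_subset[OF diagonal_continuous[OF \<omega>]]; simp)+
  have "bdd_below ?S"
  proof (rule bdd_belowI)
    fix y assume "y \<in> ?S"
    then obtain s t :: real and k :: nat where y: "y = integral {real k + s..real k + t} ?f"
      and stk: "0 \<le> s" "s < t" "t \<le> 1" "k \<in> {0..CARD('n) + 1}" by auto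
    have "- y \<le> norm (integral {real k + s..real k + t} ?f)" unfolding y by simp
    also have "\<dots> \<le> integral {real k + s..real k + t} (\<lambda>r. \<bar>?f r\<bar>)"
      by (rule integral_norm_bound_integral) (use fi in auto)
    also have "\<dots> \<le> integral {0..real CARD('n) + 2} (\<lambda>r. \<bar>?f r\<bar>)"
      by (rule integral_subset_le) (use stk fi in auto)
    finally show "- integral {0..real CARD('n) + 2} (\<lambda>r. \<bar>?f r\<bar>) \<le> y" by simp
  qed
  moreover have "integral {0..1} ?f \<in> ?S"
    by (rule CollectI, rule exI[of _ 0], rule exI[of _ 1], rule exI[of _ 0]) simp
  ultimately have "a_diag_low \<theta> A i \<omega> \<le> integral {0..1} ?f"
    unfolding a_diag_low_def by (rule cInf_lower[rotated])
  moreover have "a_low \<theta> A \<omega> \<le> exp (a_diag_low \<theta> A i \<omega>)"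
    unfolding a_low_def by (rule Min_le) auto
  then have "ln (a_low \<theta> A \<omega>) \<le> ln (exp (a_diag_low \<theta> A i \<omega>))"
    using a_low_pos by (intro ln_mono) auto
  ultimately show ?thesis by simp
qed

text \<open>\<open>traj_weighted_lower\<close> with \<open>c\<close> the diagonal entry itself,
  discarding the nonnegative delayed inflow, read off at the right end of the segment.\<close>

lemma norm_U_one_ge:
  assumes \<omega>: "\<omega> \<in> space M" and t: "0 \<le> t"
  shows "exp (integral {0..t} (\<lambda>r. A (\<theta> r \<omega>) $ i $ i)) \<le> norm (U \<omega> t one_phase)"
proof -
  interpret c: coop_delay "\<lambda>t. A (\<theta> t \<omega>)" "\<lambda>t. B (\<theta> t \<omega>)" by (rule coop_delay[OF \<omega>])
  let ?u = "traj (\<lambda>t. A (\<theta> t \<omega>)) (\<lambda>t. B (\<theta> t \<omega>)) one_phase"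
  let ?I = "integral {0..t} (\<lambda>r. A (\<theta> r \<omega>) $ i $ i)"
  have one: "0 \<preceq> (one_phase :: 'n phase)" by (rule one_phase_nonneg)
  obtain \<sigma> where \<sigma>: "0 = lag_time \<sigma>" using lag_timeE[of 0] by auto
  have u0: "?u 0 $ i = 1" unfolding \<sigma> c.traj_lag by simp
  have W: "continuous_on {0..t} (\<lambda>r. exp (- integral {0..r} (\<lambda>r. A (\<theta> r \<omega>) $ i $ i)))"
    by (intro continuous_intros continuous_on_subset[OF continuous_on_integral_upper[OF diagonal_continuous[OF \<omega>]]]) auto
  have "1 \<le> exp (- integral {0..0} (\<lambda>r. A (\<theta> r \<omega>) $ i $ i)) * ?u 0 $ i +
      integral {0..t} (\<lambda>r. exp (- integral {0..r} (\<lambda>r. A (\<theta> r \<omega>) $ i $ i)) *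
        (\<Sum>j\<in>UNIV. B (\<theta> r \<omega>) $ i $ j * ?u (r - 1) $ j))"
    using u0 by (simp, intro integral_nonneg integrable_continuous_real continuous_on_mult continuous_on_sum
        continuous_on_component c.continuous_parts W mult_nonneg_nonneg sum_nonneg c.b_nonneg c.traj_nonneg one) auto
  also have "\<dots> \<le> exp (- ?I) * ?u t $ i"
    by (rule c.traj_weighted_lower[OF one order_refl t diagonal_continuous[OF \<omega>]]) simp
  finally have "exp ?I \<le> ?u t $ i" by (simp add: exp_minus field_simps)
  also have "?u t $ i = apply_bcontfun (U \<omega> t one_phase) \<sigma> $ i"
    using c.flow_apply[OF t, of one_phase \<sigma>] \<sigma> by (simp add: delay_semiflow_eq_flow)
  also have "\<dots> \<le> norm (U \<omega> t one_phase)"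
    using abs_phase_le_norm[of "U \<omega> t one_phase" \<sigma> i] by linarith
  finally show ?thesis .
qed

lemma exponent_finite:
  assumes h: "integrable M h" and h0: "\<And>\<omega>. \<omega> \<in> space M \<Longrightarrow> 0 \<le> h \<omega>"
    and le: "\<And>\<omega>. \<omega> \<in> space M \<Longrightarrow> - ln (a_low \<theta> A \<omega>) \<le> h \<omega>"
    and F: "gen_principal_Floquet M \<theta> U \<Omega>1 E1 w \<Lambda>"
  shows "-\<infinity> < \<Lambda>"
proof -
  have \<Omega>1: "\<Omega>1 \<in> sets M" "prob \<Omega>1 = 1"
    and dom: "\<And>\<omega> u. \<omega> \<in> \<Omega>1 \<Longrightarrow> u \<noteq> 0 \<Longrightarrow> Limsup at_top (growth_rate (\<lambda>t. U \<omega> t u)) \<le> \<Lambda>"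
    using F unfolding gen_principal_Floquet_def by blast+
  have hm[measurable]: "h \<in> borel_measurable M" using h by simp
  define f where "f n \<omega> = ennreal ((\<Sum>k<n. h (\<theta> (real k) \<omega>)) / real n)" for n \<omega>
  have fm[measurable]: "f n \<in> borel_measurable M" for n unfolding f_def by measurable
  have int_f: "(\<integral>\<^sup>+\<omega>. f n \<omega> \<partial>M) = (\<integral>\<^sup>+\<omega>. ennreal (h \<omega>) \<partial>M)" if n: "0 < n" for n
  proof -
    have "(\<integral>\<^sup>+\<omega>. f n \<omega> \<partial>M) = (\<integral>\<^sup>+\<omega>. ennreal (1 / real n) * (\<Sum>k<n. ennreal (h (\<theta> (real k) \<omega>))) \<partial>M)"
      unfolding f_def
      by (intro nn_integral_cong)
         (simp add: sum_ennreal h0 flow_space ennreal_mult[symmetric] sum_nonneg)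
    also have "\<dots> = ennreal (1 / real n) * (\<Sum>k<n. \<integral>\<^sup>+\<omega>. ennreal (h (\<theta> (real k) \<omega>)) \<partial>M)"
      by (subst nn_integral_cmult, measurable, subst nn_integral_sum) auto
    also have "\<dots> = ennreal (1 / real n) * (ennreal (real n) * (\<integral>\<^sup>+\<omega>. ennreal (h \<omega>) \<partial>M))"
      using nn_integral_flow[of "\<lambda>\<omega>. ennreal (h \<omega>)"] by (simp add: ennreal_of_nat_eq_real_of_nat)
    also have "\<dots> = (\<integral>\<^sup>+\<omega>. ennreal (h \<omega>) \<partial>M)"
      using n by (simp add: mult.assoc[symmetric] ennreal_mult[symmetric])
    finally show ?thesis .
  qed
  \<comment> \<open>All averages have the same expectation as \<open>h\<close>, so Fatou makes their
    lower limit finite almost everywhere; one such point in \<open>\<Omega>1\<close>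
    suffices.\<close>
  have "(\<integral>\<^sup>+\<omega>. liminf (\<lambda>n. f n \<omega>) \<partial>M) \<le> liminf (\<lambda>n. \<integral>\<^sup>+\<omega>. f n \<omega> \<partial>M)"
    by (rule nn_integral_liminf) measurable
  also have "\<dots> = (\<integral>\<^sup>+\<omega>. ennreal (h \<omega>) \<partial>M)"
  proof (rule lim_imp_Liminf)
    show "(\<lambda>n. \<integral>\<^sup>+\<omega>. f n \<omega> \<partial>M) \<longlonglongrightarrow> (\<integral>\<^sup>+\<omega>. ennreal (h \<omega>) \<partial>M)"
      by (rule tendsto_eventually, rule eventually_mono[OF eventually_gt_at_top[of 0]], rule int_f)
  qed simp
  also have "\<dots> < top" using h by (simp add: real_integrable_def less_top)
  finally have "AE \<omega> in M. liminf (\<lambda>n. f n \<omega>) \<noteq> \<infinity>"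
    by (intro nn_integral_noteq_infinite) (auto simp: less_top)
  moreover have "AE \<omega> in M. \<omega> \<in> \<Omega>1"
    using \<Omega>1 by (simp add: prob_eq_1)
  ultimately have "AE \<omega> in M. \<omega> \<in> \<Omega>1 \<and> liminf (\<lambda>n. f n \<omega>) \<noteq> \<infinity>" by eventually_elim simp
  moreover have "ae_filter M \<noteq> bot" by (simp add: ae_filter_eq_bot_iff emeasure_space_1)
  ultimately obtain \<omega> where \<omega>1: "\<omega> \<in> \<Omega>1" and fin: "liminf (\<lambda>n. f n \<omega>) \<noteq> \<infinity>"
    using eventually_happens'[of "ae_filter M"] by blast
  have \<omega>: "\<omega> \<in> space M" using \<omega>1 sets.sets_into_space[OF \<Omega>1(1)] by auto
  obtain m :: real where m: "0 \<le> m" "liminf (\<lambda>n. f n \<omega>) < ennreal m"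
  proof -
    from fin obtain l where l: "liminf (\<lambda>n. f n \<omega>) = ennreal l" "0 \<le> l"
      by (cases "liminf (\<lambda>n. f n \<omega>)") auto
    then show thesis by (intro that[of "l + 1"]) (auto simp: ennreal_less_iff)
  qed
  have growth: "ereal (- ((\<Sum>k<n. h (\<theta> (real k) \<omega>)) / real n)) \<le> growth_rate (\<lambda>t. U \<omega> t one_phase) (real n)"
    if n: "0 < n" for n :: nat
  proof -
    fix i :: 'n
    have "- (\<Sum>k<m. h (\<theta> (real k) \<omega>)) \<le> integral {0..real m} (\<lambda>r. A (\<theta> r \<omega>) $ i $ i)" for m :: nat
    proof (induction m)
      case (Suc m)
      have "- h (\<theta> (real m) \<omega>) \<le> integral {0..1} (\<lambda>r. A (\<theta> r (\<theta> (real m) \<omega>)) $ i $ i)"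
        using le[OF flow_space[OF \<omega>], of "real m"] ln_a_low_le[OF flow_space[OF \<omega>], of "real m" i]
        by linarith
      then show ?case
        using Suc flow_integral_cocycle[OF \<omega> diagonal_continuous[OF \<omega>, of i], of "real m" 1]
        by (simp add: add.commute)
    qed simp
    from this[of n] have "exp (- (\<Sum>k<n. h (\<theta> (real k) \<omega>))) \<le> norm (U \<omega> (real n) one_phase)"
      by (intro order_trans[OF _ norm_U_one_ge[OF \<omega>, of "real n" i]]) auto
    moreover from this have pos: "0 < norm (U \<omega> (real n) one_phase)" by (rule less_le_trans[OF exp_gt_zero])
    ultimately have "- (\<Sum>k<n. h (\<theta> (real k) \<omega>)) \<le> ln (norm (U \<omega> (real n) one_phase))"
      by (simp add: ln_ge_iff)
    then have "- (\<Sum>k<n. h (\<theta> (real k) \<omega>)) / real n \<le> ln (norm (U \<omega> (real n) one_phase)) / real n"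
      using n by (intro divide_right_mono) auto
    then show ?thesis using pos by (simp add: growth_rate_def ereal_ln_def)
  qed
  show ?thesis
  proof (rule ccontr)
    assume "\<not> -\<infinity> < \<Lambda>"
    then have "\<Lambda> = -\<infinity>" by simp
    moreover have "one_phase \<noteq> (0 :: 'n phase)" using strictly_pos_norm[OF strictly_pos_one] by auto
    ultimately have "Limsup at_top (growth_rate (\<lambda>t. U \<omega> t one_phase)) < ereal (- m)"
      using dom[OF \<omega>1, of one_phase] by simp
    then have "\<forall>\<^sub>F t in at_top. growth_rate (\<lambda>t. U \<omega> t one_phase) t < ereal (- m)"
      by (rule Limsup_lessD)
    then have "\<forall>\<^sub>F n in sequentially. growth_rate (\<lambda>t. U \<omega> t one_phase) (real n) < ereal (- m)"
      by (rule eventually_compose_filterlim[OF _ filterlim_real_sequentially])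
    with eventually_gt_at_top[of 0] have "\<forall>\<^sub>F n in sequentially. ennreal m \<le> f n \<omega>"
    proof eventually_elim
      case (elim n)
      have "ereal (- ((\<Sum>k<n. h (\<theta> (real k) \<omega>)) / real n)) < ereal (- m)"
        using growth[OF elim(1)] elim(2) by (rule le_less_trans)
      then show ?case unfolding f_def by (intro ennreal_leI) simp
    qed
    then have "ennreal m \<le> liminf (\<lambda>n. f n \<omega>)" by (rule Liminf_bounded)
    with m(2) show False by simp
  qed
qed

text \<open>Common form of both conditions (iii), with exponents \<open>p = N + 2\<close> and
  \<open>p = 2\<close>. Bounding \<open>d\<close> by an entry of \<open>B\<close> brings in the
  integrable maximum from (OA2).\<close>

lemma exponent_finite_beta:
  assumes \<beta>: "integrable M (\<lambda>\<omega>. ln_minus (\<beta> \<omega>))" and p: "0 < p"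
    and pos: "\<And>\<omega>. \<omega> \<in> space M \<Longrightarrow> 0 < \<beta> \<omega>" "\<And>\<omega>. \<omega> \<in> space M \<Longrightarrow> 0 < d \<omega>"
    and le: "\<And>\<omega>. \<omega> \<in> space M \<Longrightarrow> \<beta> \<omega> \<le> a_low \<theta> A \<omega> ^ p * d \<omega>"
    and d: "\<And>\<omega>. \<omega> \<in> space M \<Longrightarrow> \<exists>i j. d \<omega> \<le> B \<omega> $ i $ j"
    and F: "gen_principal_Floquet M \<theta> U \<Omega>1 E1 w \<Lambda>"
  shows "-\<infinity> < \<Lambda>"
proof (rule exponent_finite[OF _ _ _ F])
  let ?h = "\<lambda>\<omega>. ln_minus (\<beta> \<omega>) + (MAX (i, j). B \<omega> $ i $ j)"
  show "integrable M ?h" using \<beta> OA2 by (auto simp: OA2_def)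
  have dB: "d \<omega> \<le> (MAX (i, j). B \<omega> $ i $ j)" if \<omega>: "\<omega> \<in> space M" for \<omega>
  proof -
    obtain i j where "d \<omega> \<le> B \<omega> $ i $ j" using d[OF \<omega>] by blast
    also have "\<dots> \<le> (MAX (i, j). B \<omega> $ i $ j)" by (rule Max_ge) auto
    finally show ?thesis .
  qed
  fix \<omega> assume \<omega>: "\<omega> \<in> space M"
  show "0 \<le> ?h \<omega>" using dB[OF \<omega>] pos(2)[OF \<omega>] by (simp add: ln_minus_def)
  show "- ln (a_low \<theta> A \<omega>) \<le> ?h \<omega>"
    by (rule ln_low_le[OF a_low_pos pos(2)[OF \<omega>] pos(1)[OF \<omega>] le[OF \<omega>] p dB[OF \<omega>]])
qed

lemma exponent_finite_OA3:
  assumes "OA3_i_iii M \<theta> A B" and F: "gen_principal_Floquet M \<theta> U \<Omega>1 E1 w \<Lambda>"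
  shows "-\<infinity> < \<Lambda>"
proof -
  obtain \<delta> where \<delta>: "positive_measurable M \<delta>" "OA3_i M \<theta> B \<delta>" "OA3_iii M \<theta> A \<delta>"
    using assms(1) by (auto simp: OA3_i_iii_def)
  show ?thesis
  proof (rule exponent_finite_beta[OF _ _ _ _ _ _ F])
    show "integrable M (\<lambda>\<omega>. ln_minus (beta_low3 \<theta> A \<delta> \<omega>))" using \<delta>(3) by (simp add: OA3_iii_def)
    show "0 < CARD('n) + 2" by simp
    fix \<omega> assume \<omega>: "\<omega> \<in> space M"
    show d: "0 < \<delta> \<omega>" using \<delta>(1) \<omega> by (simp add: positive_measurable_def)
    show "0 < beta_low3 \<theta> A \<delta> \<omega>"
      unfolding beta_low3_def by (subst Min_gr_iff) (use d a_low_pos N2 in auto)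
    \<comment> \<open>Of the minimum, the member with \<open>k = 1\<close> and the smaller power is
      selected.\<close>
    have "beta_low3 \<theta> A \<delta> \<omega> \<le> a_low \<theta> A \<omega> ^ (CARD('n) + 2) * \<delta> \<omega> ^ 1 / fact 1"
      unfolding beta_low3_def by (rule Min_le, simp, rule UnI1, rule imageI) (use N2 in simp)
    then show "beta_low3 \<theta> A \<delta> \<omega> \<le> a_low \<theta> A \<omega> ^ (CARD('n) + 2) * \<delta> \<omega>" by simp
    obtain j :: "nat \<Rightarrow> 'n" where "\<forall>t\<in>{0..real CARD('n) + 2}. \<forall>l\<in>{0..CARD('n) - 2}.
           \<delta> \<omega> \<le> B (\<theta> t \<omega>) $ j (l + 1) $ j l"
      using \<delta>(2) \<omega> unfolding OA3_i_def by blast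
    from bspec[OF bspec[OF this, of 0], of 0] show "\<exists>i j. \<delta> \<omega> \<le> B \<omega> $ i $ j"
      by (auto simp: flow_zero[OF \<omega>])
  qed
qed

lemma exponent_finite_OA4:
  assumes "OA4_i_iii M \<theta> A B" and F: "gen_principal_Floquet M \<theta> U \<Omega>1 E1 w \<Lambda>"
  shows "-\<infinity> < \<Lambda>"
proof -
  obtain \<delta> where \<delta>: "positive_measurable M \<delta>" "OA4_i M \<theta> B \<delta>" "OA4_iii M \<theta> A \<delta>"
    using assms(1) by (auto simp: OA4_i_iii_def)
  obtain i j :: 'n where ij: "i \<noteq> j" using N2 by (metis card_2_iff' ex_card UNIV_I)
  show ?thesis
  proof (rule exponent_finite_beta[OF _ _ _ _ _ _ F])
    show "integrable M (\<lambda>\<omega>. ln_minus (beta_low4 \<theta> A \<delta> \<omega>))" using \<delta>(3) by (simp add: OA4_iii_def)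
    show "0 < (2::nat)" by simp
    fix \<omega> assume \<omega>: "\<omega> \<in> space M"
    show d: "0 < \<delta> \<omega>" using \<delta>(1) \<omega> by (simp add: positive_measurable_def)
    then show "0 < beta_low4 \<theta> A \<delta> \<omega>"
      unfolding beta_low4_def by (intro mult_pos_pos zero_less_power a_low_pos)
    show "beta_low4 \<theta> A \<delta> \<omega> \<le> a_low \<theta> A \<omega> ^ 2 * \<delta> \<omega>" by (simp add: beta_low4_def)
    have "\<delta> \<omega> \<le> B (\<theta> 0 \<omega>) $ i $ j" using \<delta>(2) \<omega> ij unfolding OA4_i_def by auto
    then show "\<exists>i j. \<delta> \<omega> \<le> B \<omega> $ i $ j" by (auto simp: flow_zero[OF \<omega>])
  qed
qed

text \<open>The horizon \<open>2\<close> of \<open>OA4\<close> is too short for uniform focusing when \<open>N = 2\<close>: an initial function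
  concentrated in one component near the right end of \<open>[-1,0]\<close> may get back to that component only
  after time \<open>2\<close>. The minimum of \<open>\<delta>\<close> over \<open>N + 1\<close> shifts covers the horizon \<open>N + 2\<close> of \<open>OA3\<close>.\<close>

lemma OA4_i_imp_OA3_i:
  assumes \<delta>: "positive_measurable M \<delta>" "OA4_i M \<theta> B \<delta>"
  obtains \<delta>' where "positive_measurable M \<delta>'" "OA3_i M \<theta> B \<delta>'"
proof -
  define \<delta>' where "\<delta>' \<omega> = Min ((\<lambda>k. \<delta> (\<theta> (2 * real k) \<omega>)) ` {..CARD('n)})" for \<omega>
  have [measurable]: "\<delta> \<in> borel_measurable M" using \<delta>(1) by (simp add: positive_measurable_def)
  have pm: "positive_measurable M \<delta>'"
    unfolding positive_measurable_def
  proof (intro conjI ballI)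
    show "\<delta>' \<in> borel_measurable M" unfolding \<delta>'_def[abs_def] by (rule borel_measurable_Min) auto
    fix \<omega> assume "\<omega> \<in> space M"
    then show "0 < \<delta>' \<omega>"
      unfolding \<delta>'_def using \<delta>(1) by (subst Min_gr_iff) (auto simp: positive_measurable_def flow_space)
  qed
  have low: "\<delta>' \<omega> \<le> B (\<theta> t \<omega>) $ i $ j"
    if \<omega>: "\<omega> \<in> space M" and ij: "i \<noteq> j" and t: "t \<in> {0..real CARD('n) + 2}" for \<omega> t i j
  proof -
    define k where "k = nat \<lfloor>t / 2\<rfloor>"
    have "t / 2 \<le> real CARD('n)" using t N2 by simp
    then have "\<lfloor>t / 2\<rfloor> \<le> int CARD('n)" by linarith
    then have k: "k \<le> CARD('n)" unfolding k_def by linarith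
    have rk: "real k = of_int \<lfloor>t / 2\<rfloor>" using t unfolding k_def by simp
    have s: "t - 2 * real k \<in> {0..2}"
      unfolding rk atLeastAtMost_iff
      using of_int_floor_le[of "t / 2"] real_of_int_floor_add_one_ge[of "t / 2"] by linarith
    have "\<delta>' \<omega> \<le> \<delta> (\<theta> (2 * real k) \<omega>)"
      unfolding \<delta>'_def by (rule Min_le) (use k in auto)
    also have "\<dots> \<le> B (\<theta> (t - 2 * real k) (\<theta> (2 * real k) \<omega>)) $ i $ j"
      using \<delta>(2) flow_space[OF \<omega>] ij s unfolding OA4_i_def by blast
    also have "\<theta> (t - 2 * real k) (\<theta> (2 * real k) \<omega>) = \<theta> t \<omega>"
      using flow_add[OF \<omega>, of "t - 2 * real k" "2 * real k"] by simp
    finally show ?thesis .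
  qed
  have "OA3_i M \<theta> B \<delta>'"
    unfolding OA3_i_def
  proof (intro ballI allI)
    fix \<omega> and i :: 'n assume \<omega>: "\<omega> \<in> space M"
    \<comment> \<open>All off-diagonal entries are bounded below, so any enumeration of the indices
      that starts with \<open>i\<close> is an admissible path.\<close>
    obtain xs :: "'n list" where xs: "set xs = UNIV - {i}" "distinct xs"
      using finite_distinct_list[of "UNIV - {i}"] by auto
    define ys where "ys = i # xs"
    have ys: "set ys = UNIV" "distinct ys" using xs by (auto simp: ys_def)
    have len: "length ys = CARD('n)" using distinct_card[OF ys(2)] ys(1) by simp
    have img: "(!) ys ` {0..CARD('n) - 1} = UNIV"
    proof -
      have "{0..CARD('n) - 1} = {0..<length ys}" using N2 len by auto
      then show ?thesis using ys(1) nth_image[of "length ys" ys] by simp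
    qed
    have "\<delta>' \<omega> \<le> B (\<theta> t \<omega>) $ (ys ! (l + 1)) $ (ys ! l)"
      if "t \<in> {0..real CARD('n) + 2}" "l \<in> {0..CARD('n) - 2}" for t l
    proof (rule low[OF \<omega> _ that(1)])
      have "l + 1 < length ys" using that(2) N2 len by auto
      then show "ys ! (l + 1) \<noteq> ys ! l" using ys(2) by (simp add: nth_eq_iff_index_eq)
    qed
    then show "\<exists>j::nat \<Rightarrow> 'n. j 0 = i \<and> j ` {0..CARD('n) - 1} = UNIV \<and>
        (\<forall>t\<in>{0..real CARD('n) + 2}. \<forall>l\<in>{0..CARD('n) - 2}. \<delta>' \<omega> \<le> B (\<theta> t \<omega>) $ j (l + 1) $ j l)"
      using img by (intro exI[of _ "(!) ys"]) (auto simp: ys_def)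
  qed
  with pm show thesis by (rule that)
qed

lemma ex_Floquet_of_OA3_i:
  assumes "positive_measurable M \<delta>" "OA3_i M \<theta> B \<delta>"
  shows "\<exists>\<Omega>1 E1 w \<Lambda>1. gen_principal_Floquet M \<theta> U \<Omega>1 E1 w \<Lambda>1"
proof -
  interpret focusing_mds M \<theta> A B \<delta> by unfold_locales (rule assms)+
  show ?thesis by (rule ex_gen_principal_Floquet)
qed

end

theorem theorem4p2:
  fixes M :: "'a measure" and \<theta> :: "real \<Rightarrow> 'a \<Rightarrow> 'a"
    and A B :: "'a \<Rightarrow> real ^ 'n::finite ^ 'n"
  assumes "ergodic_mds M \<theta>"
    and "CARD('n) \<ge> 2"
    and "OA0 M \<theta> A B" and "OA1 M A B" and "OA2 M A B"
  shows "(OA3_i_ii M \<theta> A B \<or> OA4_i_ii M \<theta> A B \<longrightarrow>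
            (\<exists>\<Omega>1 E1 w \<Lambda>1. gen_principal_Floquet M \<theta> (delay_semiflow \<theta> A B) \<Omega>1 E1 w \<Lambda>1)) \<and>
         (OA3_i_iii M \<theta> A B \<or> OA4_i_iii M \<theta> A B \<longrightarrow>
            (\<forall>\<Omega>1 E1 w \<Lambda>1. gen_principal_Floquet M \<theta> (delay_semiflow \<theta> A B) \<Omega>1 E1 w \<Lambda>1 \<longrightarrow>
              -\<infinity> < \<Lambda>1))"
proof -
  interpret delay_mds M \<theta> A B
    using assms by (intro delay_mds.intro delay_mds_axioms.intro)
  show ?thesis
  proof (intro conjI impI allI)
    assume "OA3_i_ii M \<theta> A B \<or> OA4_i_ii M \<theta> A B"
    then obtain \<delta> where "positive_measurable M \<delta>" "OA3_i M \<theta> B \<delta>"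
      using OA4_i_imp_OA3_i unfolding OA3_i_ii_def OA4_i_ii_def by metis
    then show "\<exists>\<Omega>1 E1 w \<Lambda>1. gen_principal_Floquet M \<theta> (delay_semiflow \<theta> A B) \<Omega>1 E1 w \<Lambda>1"
      by (rule ex_Floquet_of_OA3_i)
  next
    fix \<Omega>1 E1 w \<Lambda>1
    assume "OA3_i_iii M \<theta> A B \<or> OA4_i_iii M \<theta> A B"
      "gen_principal_Floquet M \<theta> (delay_semiflow \<theta> A B) \<Omega>1 E1 w \<Lambda>1"
    then show "-\<infinity> < \<Lambda>1" using exponent_finite_OA3 exponent_finite_OA4 by blast
  qed
qed

end
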